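(* Let $k\in\mathbb{Z}^+$ with $p\nmid k$. Then $$e^{C_1k}\le |X_{k-1}|\le e^{C_2k}$$ for some constants $C_1<C_2$. In particular, the dimension of $(\mathrm{Res}_P\,\mathrm{Lie}(kp))_{pf}$ grows exponentially with $k$, but $$\frac{\dim\big((\mathrm{Res}_P\,\mathrm{Lie}(kp))_{pf}\big)}{\dim(\mathrm{Lie}(kp))}\to 0\quad\text{as } k\to\infty.$$
   Context: $p$ is a fixed prime and $F$ is a field of characteristic $p$. $\mathfrak{S}_n$ is the symmetric group on $[1,n]=\{1,\dots,n\}$, acting on the right (products composed left to right); for $m<n$, $\mathfrak{S}_m$ is identified with the subgroup of $\mathfrak{S}_n$ fixing $m+1,\dots,n$. $\mathbb{Z}^+$ is the set of positive integers and $\mathbb{Z}_p^*$ is the set of nonzero residues mod $p$. Lie module: $\mathrm{Lie}(n)=\omega_nF\mathfrak{S}_n$ is the right ideal of the group algebra $F\mathfrak{S}_n$ generated by $\omega_n=(1-c_2)(1-c_3)\cdots(1-c_n)$, where $c_j$ is the $j$-cycle $(1,2,\dots,j)$. A finite-dimensional module $W$ over $FG$, $G$ a finite group, decomposes as $W=W_{pr}\oplus W_{pf}$ (unique up to isomorphism) with $W_{pr}$ projective and $W_{pf}$ having no nonzero projective summand. For $\sigma\in\mathfrak{S}_a$, $\sigma^{[b]}\in\mathfrak{S}_{ab}$ is given by $((i-1)b+j)\sigma^{[b]}=(i\sigma-1)b+j$ for $i\in[1,a]$, $j\in[1,b]$. For $\tau\in\mathfrak{S}_b$ and an integer $r\ge1$,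 $\tau[r]$ is the permutation with $((r-1)b+j)\tau[r]=(r-1)b+j\tau$ for $j\in[1,b]$, fixing everything else. For $K\subseteq\mathfrak{S}_b$, $K[r]=\{g[r]:g\in K\}$. $\pi=(1,2,\dots,p)\in\mathfrak{S}_p$. $P$ denotes the Sylow $p$-subgroup $P_k=\langle \pi^{[p^i]}[j] : i\ge0,\ j\ge1,\ jp^i\le k\rangle$ of $\mathfrak{S}_{kp}$ (here $\pi^{[p^i]}$ is regarded as an element of $\mathfrak{S}_{p^{i+1}}$), and $\mathrm{Res}_P$ denotes restriction from $F\mathfrak{S}_{kp}$ to $FP$. For $i\ge0$, $R_i=\langle \pi^{[p^j]}:0\le j\le i\rangle\le\mathfrak{S}_{p^{i+1}}$, and $R_{-1}=1$. For $s\ge1$, $H_s=\prod_{a=1}^s\langle\pi[a]\rangle$. For $m\ge0$, $R_m^0=\prod_{i=1}^{p-1}R_{m-1}[i]$ (blocks of size $p^m$). For $t\in\mathbb{Z}_p^*$ and $m\ge0$, $z_{m,t}\in\mathfrak{S}_{p^{m+1}}$ is given by $((i-1)p+j)z_{m,t}=i+\overline{t(j-1)}\,p^m$ for $1\le i\le p^m$, $1\le j\le p$, where $\overline{x}\in\{0,\dots,p-1\}$ is the residue of $x$ mod $p$. Put $Y_m=\{hz_{m,t}b : h\in H_{p^m},\ t\in\mathbb{Z}_p^*,\ b\in R_m^0\}\subseteq\mathfrak{S}_{p^{m+1}}$. A $p$-composition of $d$ is a finite sequence $\lambda=(\lambda_1,\dots,\lambda_s)$ of non-negative integers with $\sum_{i=1}^s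 p^{\lambda_i}=d$ such that for each $j\in[1,s]$ the partial sum $\Sigma^\lambda_j=\sum_{i=1}^jp^{\lambda_i}$ is divisible by $p^{\lambda_j}$. For a $p$-composition $\lambda=(\lambda_1,\dots,\lambda_s)$ of $d$, put $X_\lambda=\prod_{r=1}^sY_{\lambda_r}[\Sigma^\lambda_r/p^{\lambda_r}]\subseteq\mathfrak{S}_{pd}$, and $X_d=\bigcup_\lambda X_\lambda$, the union over all $p$-compositions $\lambda$ of $d$ (for $d=0$ only the empty sequence occurs, and $X_0=\{1\}$). *)

theory Defs
  imports
    "HOL-Algebra.Sym_Groups"
    "HOL-Algebra.Generated_Groups"
    "HOL-Combinatorics.Cycles"
    "HOL-Computational_Algebra.Primes"
    "HOL-Library.Function_Algebras"
    Complex_Main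
begin

text \<open>
  Permutations are functions \<open>nat \<Rightarrow> nat\<close> fixing everything outside \<open>{1..n}\<close>, so that the symmetric
  group on \<open>{1..m}\<close> is literally a subset of the one on \<open>{1..n}\<close> for \<open>m \<le> n\<close>. Permutations act on
  the right: the image of \<open>i\<close> under \<open>\<sigma>\<close> is \<open>\<sigma> i\<close>, and the product ``first \<open>\<sigma>\<close>, then \<open>\<tau>\<close>'' is
  \<open>\<tau> \<circ> \<sigma>\<close>. Subgroups generated by a set do not depend on this choice of product, so \<^const>\<open>generate\<close>
  in \<^const>\<open>sym_group\<close> can be used for them.
\<close>

abbreviation Sym :: "nat \<Rightarrow> (nat \<Rightarrow> nat) set" where
  "Sym n \<equiv> carrier (sym_group n)"

definition cyc :: "nat \<Rightarrow> nat \<Rightarrow> nat" where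
  "cyc j = cycle_of_list [1..<Suc j]"


section \<open>Modules over the group algebra of a permutation group\<close>

text \<open>
  All vector spaces are subspaces of spaces of functions \<open>'b \<Rightarrow> 'a\<close> with values in the field \<open>'a\<close>.
\<close>

definition fscale :: "'a::field \<Rightarrow> ('b \<Rightarrow> 'a) \<Rightarrow> 'b \<Rightarrow> 'a" where
  "fscale c f = (\<lambda>x. c * f x)"

global_interpretation fv: vector_space "fscale :: 'a::field \<Rightarrow> ('b \<Rightarrow> 'a) \<Rightarrow> 'b \<Rightarrow> 'a"
  by unfold_locales (auto simp: fscale_def fun_eq_iff algebra_simps)

definition ga_carrier :: "(nat \<Rightarrow> nat) set \<Rightarrow> ((nat \<Rightarrow> nat) \<Rightarrow> 'a::field) set" where
  "ga_carrier G = {f. \<forall>\<sigma>. \<sigma> \<notin> G \<longrightarrow> f \<sigma> = 0}"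

definition ga_of :: "(nat \<Rightarrow> nat) \<Rightarrow> (nat \<Rightarrow> nat) \<Rightarrow> 'a::field" where
  "ga_of \<sigma> = (\<lambda>\<rho>. if \<rho> = \<sigma> then 1 else 0)"

definition ga_mult ::
    "(nat \<Rightarrow> nat) set \<Rightarrow> ((nat \<Rightarrow> nat) \<Rightarrow> 'a::field) \<Rightarrow> ((nat \<Rightarrow> nat) \<Rightarrow> 'a) \<Rightarrow> (nat \<Rightarrow> nat) \<Rightarrow> 'a" where
  "ga_mult G f g = (\<lambda>\<rho>. \<Sum>\<sigma>\<in>G. \<Sum>\<tau>\<in>G. if \<tau> \<circ> \<sigma> = \<rho> then f \<sigma> * g \<tau> else 0)"

text \<open>
  In the following, \<open>act w g\<close> is the right action of the group element \<open>g\<close> on the vector \<open>w\<close>; it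
  is relevant only for \<open>g \<in> G\<close> and for \<open>w\<close> in the module under consideration.
\<close>

definition fg_submodule ::
    "(nat \<Rightarrow> nat) set \<Rightarrow> (('b \<Rightarrow> 'a::field) \<Rightarrow> (nat \<Rightarrow> nat) \<Rightarrow> ('b \<Rightarrow> 'a)) \<Rightarrow> ('b \<Rightarrow> 'a) set \<Rightarrow> bool" where
  "fg_submodule G act W \<longleftrightarrow> fv.subspace W \<and> (\<forall>g\<in>G. \<forall>w\<in>W. act w g \<in> W)"

definition fg_direct_sum ::
    "(nat \<Rightarrow> nat) set \<Rightarrow> (('b \<Rightarrow> 'a::field) \<Rightarrow> (nat \<Rightarrow> nat) \<Rightarrow> ('b \<Rightarrow> 'a)) \<Rightarrow>
     ('b \<Rightarrow> 'a) set \<Rightarrow> ('b \<Rightarrow> 'a) set \<Rightarrow> ('b \<Rightarrow> 'a) set \<Rightarrow> bool" where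
  "fg_direct_sum G act W A B \<longleftrightarrow>
     fg_submodule G act A \<and> fg_submodule G act B \<and> A \<inter> B = {0} \<and> W = {a + b | a b. a \<in> A \<and> b \<in> B}"

definition fg_iso ::
    "(nat \<Rightarrow> nat) set \<Rightarrow> (('b \<Rightarrow> 'a::field) \<Rightarrow> (nat \<Rightarrow> nat) \<Rightarrow> ('b \<Rightarrow> 'a)) \<Rightarrow> ('b \<Rightarrow> 'a) set \<Rightarrow>
     (('c \<Rightarrow> 'a) \<Rightarrow> (nat \<Rightarrow> nat) \<Rightarrow> ('c \<Rightarrow> 'a)) \<Rightarrow> ('c \<Rightarrow> 'a) set \<Rightarrow> bool" where
  "fg_iso G act V act' W \<longleftrightarrow>
     (\<exists>\<phi>. bij_betw \<phi> V W \<and>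
        (\<forall>x\<in>V. \<forall>y\<in>V. \<phi> (x + y) = \<phi> x + \<phi> y) \<and>
        (\<forall>c. \<forall>x\<in>V. \<phi> (fscale c x) = fscale c (\<phi> x)) \<and>
        (\<forall>g\<in>G. \<forall>x\<in>V. \<phi> (act x g) = act' (\<phi> x) g))"

text \<open>The free right module of rank \<open>n\<close> over the group algebra of \<open>G\<close>.\<close>

definition free_module :: "(nat \<Rightarrow> nat) set \<Rightarrow> nat \<Rightarrow> (nat \<times> (nat \<Rightarrow> nat) \<Rightarrow> 'a::field) set" where
  "free_module G n = {f. \<forall>i \<sigma>. \<not> (i < n \<and> \<sigma> \<in> G) \<longrightarrow> f (i, \<sigma>) = 0}"

definition free_act ::
    "(nat \<Rightarrow> nat) set \<Rightarrow> (nat \<times> (nat \<Rightarrow> nat) \<Rightarrow> 'a::field) \<Rightarrow> (nat \<Rightarrow> nat) \<Rightarrow> nat \<times> (nat \<Rightarrow> nat) \<Rightarrow> 'a" where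
  "free_act G f g = (\<lambda>(i, \<rho>). ga_mult G (\<lambda>\<sigma>. f (i, \<sigma>)) (ga_of g) \<rho>)"

text \<open>
  A module is projective if it is isomorphic to a direct summand of a free module; for
  finite-dimensional modules, the only ones considered, free modules of finite rank suffice.
\<close>

definition fg_projective ::
    "(nat \<Rightarrow> nat) set \<Rightarrow> (('b \<Rightarrow> 'a::field) \<Rightarrow> (nat \<Rightarrow> nat) \<Rightarrow> ('b \<Rightarrow> 'a)) \<Rightarrow> ('b \<Rightarrow> 'a) set \<Rightarrow> bool" where
  "fg_projective G act W \<longleftrightarrow>
     (\<exists>n A B. fg_direct_sum G (free_act G) (free_module G n) A B \<and> fg_iso G act W (free_act G) A)"

definition pr_pf_decomposition ::
    "(nat \<Rightarrow> nat) set \<Rightarrow> (('b \<Rightarrow> 'a::field) \<Rightarrow> (nat \<Rightarrow> nat) \<Rightarrow> ('b \<Rightarrow> 'a)) \<Rightarrow>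
     ('b \<Rightarrow> 'a) set \<Rightarrow> ('b \<Rightarrow> 'a) set \<Rightarrow> ('b \<Rightarrow> 'a) set \<Rightarrow> bool" where
  "pr_pf_decomposition G act W Wpr Wpf \<longleftrightarrow>
     fg_direct_sum G act W Wpr Wpf \<and> fg_projective G act Wpr \<and>
     (\<forall>A B. fg_direct_sum G act Wpf A B \<and> fg_projective G act A \<longrightarrow> A = {0})"

text \<open>
  The projective-free part is unique only up to isomorphism; its dimension is well defined.
\<close>

definition pf_dim ::
    "(nat \<Rightarrow> nat) set \<Rightarrow> (('b \<Rightarrow> 'a::field) \<Rightarrow> (nat \<Rightarrow> nat) \<Rightarrow> ('b \<Rightarrow> 'a)) \<Rightarrow> ('b \<Rightarrow> 'a) set \<Rightarrow> nat" where
  "pf_dim G act W = (THE d. \<exists>Wpr Wpf. pr_pf_decomposition G act W Wpr Wpf \<and> d = fv.dim Wpf)"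


section \<open>The Lie module\<close>

text \<open>The product \<open>(1 - c\<^sub>2) (1 - c\<^sub>3) \<dots> (1 - c\<^sub>n)\<close>, in this order.\<close>

definition lie_omega :: "nat \<Rightarrow> (nat \<Rightarrow> nat) \<Rightarrow> 'a::field" where
  "lie_omega n = foldl (ga_mult (Sym n)) (ga_of id) (map (\<lambda>j. ga_of id - ga_of (cyc j)) [2..<Suc n])"

definition Lie :: "nat \<Rightarrow> ((nat \<Rightarrow> nat) \<Rightarrow> 'a::field) set" where
  "Lie n = {ga_mult (Sym n) (lie_omega n) x | x. x \<in> ga_carrier (Sym n)}"

definition ga_act ::
    "nat \<Rightarrow> ((nat \<Rightarrow> nat) \<Rightarrow> 'a::field) \<Rightarrow> (nat \<Rightarrow> nat) \<Rightarrow> (nat \<Rightarrow> nat) \<Rightarrow> 'a" where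
  "ga_act n w g = ga_mult (Sym n) w (ga_of g)"


section \<open>Permutations and sets of permutations\<close>

text \<open>
  \<open>perm_blow b \<sigma>\<close> is \<open>\<sigma>\<^sup>[\<^sup>b\<^sup>]\<close>: it sends \<open>(i - 1) b + j\<close> to \<open>(\<sigma> i - 1) b + j\<close> for \<open>1 \<le> j \<le> b\<close>. The degree of \<open>\<sigma>\<close> is not
  needed, since \<open>\<sigma>\<close> fixes all larger numbers.
\<close>

definition perm_blow :: "nat \<Rightarrow> (nat \<Rightarrow> nat) \<Rightarrow> nat \<Rightarrow> nat" where
  "perm_blow b \<sigma> x =
     (if x = 0 then 0 else (\<sigma> ((x - 1) div b + 1) - 1) * b + ((x - 1) mod b + 1))"

text \<open>
  \<open>perm_shift b r \<tau>\<close> is \<open>\<tau>[r]\<close> for \<open>\<tau>\<close> of degree \<open>b\<close>; the degree has to be specified.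
\<close>

definition perm_shift :: "nat \<Rightarrow> nat \<Rightarrow> (nat \<Rightarrow> nat) \<Rightarrow> nat \<Rightarrow> nat" where
  "perm_shift b r \<tau> x =
     (if x \<in> {(r - 1) * b + 1 .. (r - 1) * b + b} then (r - 1) * b + \<tau> (x - (r - 1) * b) else x)"

definition set_product :: "(nat \<Rightarrow> nat) set list \<Rightarrow> (nat \<Rightarrow> nat) set" where
  "set_product As = foldl (\<lambda>A B. {\<tau> \<circ> \<sigma> | \<sigma> \<tau>. \<sigma> \<in> A \<and> \<tau> \<in> B}) {id} As"

definition P_group :: "nat \<Rightarrow> nat \<Rightarrow> (nat \<Rightarrow> nat) set" where
  "P_group p k = generate (sym_group (k * p))
     {perm_shift (p ^ (i + 1)) j (perm_blow (p ^ i) (cyc p)) | i j. 1 \<le> j \<and> j * p ^ i \<le> k}"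

text \<open>The index is shifted by one: \<open>R_group p m\<close> is \<open>R\<^bsub>m-1\<^esub>\<close>, of degree \<open>p\<^sup>m\<close>.\<close>

definition R_group :: "nat \<Rightarrow> nat \<Rightarrow> (nat \<Rightarrow> nat) set" where
  "R_group p m = generate (sym_group (p ^ m)) {perm_blow (p ^ j) (cyc p) | j. j < m}"

definition H_group :: "nat \<Rightarrow> nat \<Rightarrow> (nat \<Rightarrow> nat) set" where
  "H_group p s =
     set_product (map (\<lambda>a. generate (sym_group (s * p)) {perm_shift p a (cyc p)}) [1..<Suc s])"

definition R0_group :: "nat \<Rightarrow> nat \<Rightarrow> (nat \<Rightarrow> nat) set" where
  "R0_group p m = set_product (map (\<lambda>i. perm_shift (p ^ m) i ` R_group p m) [1..<p])"

definition z_perm :: "nat \<Rightarrow> nat \<Rightarrow> nat \<Rightarrow> nat \<Rightarrow> nat" where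
  "z_perm p m t x =
     (if x \<in> {1..p ^ (m + 1)}
      then ((x - 1) div p + 1) + ((t * ((x - 1) mod p)) mod p) * p ^ m
      else x)"

definition Y_set :: "nat \<Rightarrow> nat \<Rightarrow> (nat \<Rightarrow> nat) set" where
  "Y_set p m = set_product [H_group p (p ^ m), z_perm p m ` {1..p - 1}, R0_group p m]"

definition partial_sum :: "nat \<Rightarrow> nat list \<Rightarrow> nat \<Rightarrow> nat" where
  "partial_sum p l j = (\<Sum>i<j. p ^ (l ! i))"

text \<open>List positions start at \<open>0\<close>, so the part \<open>l ! r\<close> goes with \<open>partial_sum p l (Suc r)\<close>.\<close>

definition p_composition :: "nat \<Rightarrow> nat \<Rightarrow> nat list \<Rightarrow> bool" where
  "p_composition p d l \<longleftrightarrow>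
     partial_sum p l (length l) = d \<and> (\<forall>r<length l. p ^ (l ! r) dvd partial_sum p l (Suc r))"

definition X_comp :: "nat \<Rightarrow> nat list \<Rightarrow> (nat \<Rightarrow> nat) set" where
  "X_comp p l = set_product
     (map (\<lambda>r. perm_shift (p ^ (l ! r + 1)) (partial_sum p l (Suc r) div p ^ (l ! r)) ` Y_set p (l ! r))
       [0..<length l])"

definition X_set :: "nat \<Rightarrow> nat \<Rightarrow> (nat \<Rightarrow> nat) set" where
  "X_set p d = (\<Union>l\<in>{l. p_composition p d l}. X_comp p l)"

end

theory Submission
  imports Defs "HOL-Combinatorics.Multiset_Permutations" "HOL-Number_Theory.Cong"
begin

text \<open>
  The proof compares two numbers: the dimension \<open>(n - 1)!\<close> of \<open>Lie n\<close>, where \<open>n = k p\<close>, and the order of \<open>P\<close>.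

  Multiplication by \<open>\<omega>\<^sub>n\<close> peels off the factors \<open>1 - c\<^sub>j\<close> one at a time, and each of them turns a functional on
  words into its composite with \<open>w \<mapsto> [w, c]\<close>. So the elements of \<open>Lie n\<close> are exactly the functions that send
  \<open>\<rho>\<close> to the value of a functional on the left-normed bracket of the word \<open>\<rho> 1, \<dots>, \<rho> n\<close>. Such a function is
  determined by its values where \<open>\<rho> 1 = 1\<close>, and these are arbitrary, whence the dimension (\<open>dim_Lie\<close>).

  Let \<open>G\<close> be a \<open>p\<close>-group and let \<open>N\<close> be the sum of its elements. Nonzero modules in characteristic \<open>p\<close> contain nonzero
  fixed vectors, so that vectors with linearly independent images under \<open>N\<close> generate a free direct summand.
  Taking as many of them as possible gives \<open>dim V\<^sub>p\<^sub>f = dim V - |G| dim (V N)\<close> (\<open>pf_dim_eq\<close>).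

  For the lower bound, \<open>|P|\<close> is the exact power of \<open>p\<close> in \<open>(k p)!\<close>. If \<open>p\<close> does not divide \<open>k\<close>, the exact power in
  \<open>(k p - 1)!\<close> is \<open>|P| / p\<close>. The projective-free part has a dimension congruent to \<open>(k p - 1)!\<close> modulo \<open>|P|\<close>,
  hence it is a nonzero multiple of \<open>|P| / p\<close>, which is at least \<open>p ^ (k - 1)\<close> (\<open>pf_dim_Lie_ge\<close>).

  For the upper bound, the set \<open>A\<close> of the last \<open>p\<close> letters is invariant under \<open>P\<close>, again because \<open>p\<close> does not divide
  \<open>k\<close>, and \<open>P\<close> rotates it. Cut a word that begins in \<open>A\<close> before each letter of \<open>A\<close>. By Lazard elimination the
  brackets of these blocks generate a free subalgebra. As long as the \<open>p\<close> blocks do not all have the same length,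
  one of the \<open>p\<close> rotations of the list of lengths can be selected in a way that is compatible with \<open>P\<close>. The
  left-normed brackets of blocks in which the corresponding block comes first are linearly independent, and \<open>P\<close>
  permutes them freely. Evaluation at these brackets maps \<open>Lie n\<close> onto a free module, with a kernel of dimension at
  most \<open>(p - 1)! (n - p)!\<close>, and this number bounds the projective-free part (\<open>pf_dim_Lie_le\<close>). Divided by
  \<open>(n - 1)!\<close> it tends to \<open>0\<close>.

  The bounds for \<open>|X\<^sub>d|\<close> are direct. The \<open>p\<close>-composition \<open>(0, \<dots>, 0)\<close> already contributes the \<open>2 ^ d\<close> products of
  distinct \<open>p\<close>-cycles \<open>\<pi>[r]\<close> (\<open>card_X_set_ge\<close>); conversely there are at most \<open>2 ^ d\<close> compositions, and the groups that enter a
  set \<open>X_comp p l\<close> are contained in Sylow subgroups, whose orders are exponential in the degree (\<open>X_set_bound\<close>).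
\<close>

section \<open>Left-normed brackets\<close>

text \<open>
  The transpose of \<open>w \<mapsto> [w, c]\<close>, acting on functionals on words. A functional on the free associative algebra is
  represented by its values on words.
\<close>

definition coad :: "'b \<Rightarrow> ('b list \<Rightarrow> 'a::comm_ring_1) \<Rightarrow> 'b list \<Rightarrow> 'a" where
  "coad c X = (\<lambda>x. X (x @ [c]) - X (c # x))"

text \<open>
  The value of the functional \<open>X\<close> at the left-normed bracket \<open>[\<dots>[[c\<^sub>1, c\<^sub>2], c\<^sub>3], \<dots>, c\<^sub>m]\<close>. Working with functionals
  avoids a formal free algebra; the letters have an arbitrary type because blocks of letters will later serve as
  letters.
\<close>

fun eval_bracket :: "('b list \<Rightarrow> 'a::comm_ring_1) \<Rightarrow> 'b list \<Rightarrow> 'a" where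
  "eval_bracket X [] = 0"
| "eval_bracket X (a # cs) = foldr coad cs X [a]"

lemma eval_bracket_single [simp]: "eval_bracket X [a] = X [a]"
  by simp

lemma eval_bracket_snoc: "xs \<noteq> [] \<Longrightarrow> eval_bracket X (xs @ [c]) = eval_bracket (coad c X) xs"
  by (cases xs) auto

lemma eval_bracket_append: "xs \<noteq> [] \<Longrightarrow> eval_bracket X (xs @ ys) = eval_bracket (foldr coad ys X) xs"
  by (cases xs) auto

declare eval_bracket.simps(2) [simp del]

lemma eval_bracket_induct [case_names empty single snoc]:
  assumes "P []" "\<And>a. P [a]" "\<And>xs c. xs \<noteq> [] \<Longrightarrow> P xs \<Longrightarrow> P (xs @ [c])"
  shows "P xs"
  using assms
proof (induction xs rule: rev_induct)
  case (snoc x xs)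
  then show ?case by (cases "xs = []") auto
qed auto

lemma eval_bracket_add: "eval_bracket (\<lambda>x. X x + Y x) xs = eval_bracket X xs + eval_bracket Y xs"
proof (induction xs arbitrary: X Y rule: eval_bracket_induct)
  case (snoc xs c)
  have "coad c (\<lambda>x. X x + Y x) = (\<lambda>x. coad c X x + coad c Y x)"
    by (auto simp: coad_def)
  then show ?case using snoc by (simp add: eval_bracket_snoc)
qed auto

lemma eval_bracket_scale: "eval_bracket (\<lambda>x. s * X x) xs = s * eval_bracket X xs"
proof (induction xs arbitrary: X rule: eval_bracket_induct)
  case (snoc xs c)
  have "coad c (\<lambda>x. s * X x) = (\<lambda>x. s * coad c X x)"
    by (auto simp: coad_def algebra_simps)
  then show ?case using snoc by (simp add: eval_bracket_snoc)
qed auto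

lemma eval_bracket_diff: "eval_bracket (\<lambda>x. X x - Y x) xs = eval_bracket X xs - eval_bracket Y xs"
  using eval_bracket_add[of X "\<lambda>x. - 1 * Y x" xs] unfolding eval_bracket_scale by simp

lemma eval_bracket_zero: "eval_bracket (\<lambda>x. 0) xs = 0"
  using eval_bracket_scale[of 0 "\<lambda>_. 0" xs] by simp

lemma eval_bracket_sum: "finite I \<Longrightarrow> eval_bracket (\<lambda>x. \<Sum>i\<in>I. X i x) xs = (\<Sum>i\<in>I. eval_bracket (X i) xs)"
  by (induction I rule: finite_induct) (auto simp: eval_bracket_zero eval_bracket_add)

lemma eval_bracket_cong:
  assumes "\<And>x. mset x = mset xs \<Longrightarrow> X x = Y x"
  shows "eval_bracket X xs = eval_bracket Y xs"
  using assms
proof (induction xs arbitrary: X Y rule: eval_bracket_induct)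
  case (snoc xs c)
  have "coad c X x = coad c Y x" if "mset x = mset xs" for x
    using snoc.prems[of "x @ [c]"] snoc.prems[of "c # x"] that by (simp add: coad_def)
  then have "eval_bracket (coad c X) xs = eval_bracket (coad c Y) xs"
    by (rule snoc.IH)
  then show ?case using snoc.hyps by (simp add: eval_bracket_snoc)
qed auto

lemma eval_bracket_map: "eval_bracket X (map f xs) = eval_bracket (\<lambda>x. X (map f x)) xs"
proof (induction xs arbitrary: X rule: eval_bracket_induct)
  case (snoc xs c)
  have "(\<lambda>x. coad (f c) X (map f x)) = coad c (\<lambda>x. X (map f x))"
    by (auto simp: coad_def)
  then show ?case using snoc by (simp add: eval_bracket_snoc)
qed auto

text \<open>
  Expanding a left-normed bracket, the first letter stays in front in a single term, namely in the product of all
  letters in their given order.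
\<close>

lemma eval_bracket_leading:
  assumes "a \<notin> set u" "\<And>x. mset x = mset (a # u) \<Longrightarrow> hd x \<noteq> a \<Longrightarrow> X x = 0"
  shows "eval_bracket X (a # u) = X (a # u)"
  using assms
proof (induction u arbitrary: X rule: rev_induct)
  case (snoc c u)
  have ac: "a \<noteq> c" "a \<notin> set u"
    using snoc.prems by auto
  have "eval_bracket X (a # u @ [c]) = eval_bracket (coad c X) (a # u)"
    using eval_bracket_snoc[of "a # u"] by simp
  also have "\<dots> = eval_bracket (\<lambda>x. X (x @ [c])) (a # u)"
    by (rule eval_bracket_cong) (use ac snoc.prems(2) in \<open>auto simp: coad_def\<close>)
  also have "\<dots> = X ((a # u) @ [c])"
  proof (rule snoc.IH[OF ac(2)])
    fix x assume x: "mset x = mset (a # u)" "hd x \<noteq> a"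
    moreover from x have "x \<noteq> []" by auto
    ultimately show "X (x @ [c]) = 0"
      by (intro snoc.prems(2)) auto
  qed
  finally show ?case by simp
qed auto

text \<open>
  The transpose of the bracket with a whole left-normed bracket \<open>[z\<^sub>1, \<dots>, z\<^sub>m]\<close>. The recursion
  \<open>coad_bracket_snoc\<close> for it is the Jacobi identity.
\<close>

definition coad_bracket :: "'b list \<Rightarrow> ('b list \<Rightarrow> 'a::comm_ring_1) \<Rightarrow> 'b list \<Rightarrow> 'a" where
  "coad_bracket z X = (\<lambda>x. eval_bracket (\<lambda>t. X (x @ t)) z - eval_bracket (\<lambda>t. X (t @ x)) z)"

lemma coad_bracket_single: "coad_bracket [c] X = coad c X"
  by (simp add: coad_bracket_def coad_def)

lemma coad_bracket_snoc:
  assumes "z \<noteq> []"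
  shows "coad_bracket (z @ [c]) X x = coad_bracket z (coad c X) x - coad c (coad_bracket z X) x"
proof -
  have 1: "coad_bracket (z @ [c]) X x =
    (eval_bracket (\<lambda>t. X (x @ t @ [c])) z - eval_bracket (\<lambda>t. X (x @ c # t)) z) -
    (eval_bracket (\<lambda>t. X (t @ c # x)) z - eval_bracket (\<lambda>t. X (c # t @ x)) z)"
    unfolding coad_bracket_def eval_bracket_snoc[OF assms] coad_def eval_bracket_diff by simp
  have 2: "coad_bracket z (coad c X) x =
    (eval_bracket (\<lambda>t. X (x @ t @ [c])) z - eval_bracket (\<lambda>t. X (c # x @ t)) z) -
    (eval_bracket (\<lambda>t. X (t @ x @ [c])) z - eval_bracket (\<lambda>t. X (c # t @ x)) z)"
    unfolding coad_bracket_def coad_def eval_bracket_diff by simp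
  have 3: "coad c (coad_bracket z X) x =
    (eval_bracket (\<lambda>t. X (x @ c # t)) z - eval_bracket (\<lambda>t. X (t @ x @ [c])) z) -
    (eval_bracket (\<lambda>t. X (c # x @ t)) z - eval_bracket (\<lambda>t. X (t @ c # x)) z)"
    unfolding coad_bracket_def coad_def by simp
  show ?thesis unfolding 1 2 3 by simp
qed

text \<open>
  By the Jacobi identity the bracket of two left-normed brackets is a combination of left-normed brackets that
  begin like the first one and continue with a rearrangement of the second one. So a functional that vanishes on
  the latter vanishes on the former.
\<close>

lemma eval_bracket_coad_bracket_eq_0:
  assumes "z \<noteq> []" "y \<noteq> []" "\<And>z'. mset z' = mset z \<Longrightarrow> eval_bracket X (y @ z') = 0"
  shows "eval_bracket (coad_bracket z X) y = 0"
  using assms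
proof (induction z arbitrary: X y rule: eval_bracket_induct)
  case empty
  then show ?case by simp
next
  case (single c)
  then show ?case
    using single.prems(3)[of "[c]"] by (simp add: coad_bracket_single eval_bracket_snoc)
next
  case (snoc z c)
  have "eval_bracket (coad_bracket z (coad c X)) y = 0"
  proof (rule snoc.IH[OF snoc.hyps(1) snoc.prems(2)])
    fix z' assume "mset z' = mset z"
    then have "eval_bracket X (y @ z' @ [c]) = 0"
      by (intro snoc.prems(3)) simp
    then show "eval_bracket (coad c X) (y @ z') = 0"
      using snoc.prems(2) eval_bracket_snoc[of "y @ z'" X c] by simp
  qed
  moreover have "eval_bracket (coad_bracket z X) (y @ [c]) = 0"
  proof (rule snoc.IH[OF snoc.hyps(1)])
    fix z' assume "mset z' = mset z"
    then have "eval_bracket X (y @ c # z') = 0"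
      by (intro snoc.prems(3)) simp
    then show "eval_bracket X ((y @ [c]) @ z') = 0" by simp
  qed simp
  ultimately show ?case
    using eval_bracket_snoc[OF snoc.prems(2), of "coad_bracket z X" c]
    unfolding coad_bracket_snoc[OF snoc.hyps(1), abs_def] eval_bracket_diff by simp
qed

lemma eval_bracket_antisym:
  assumes "u \<noteq> []"
  shows "eval_bracket X (u @ [c]) = - eval_bracket (coad_bracket u X) [c]"
  unfolding eval_bracket_snoc[OF assms] coad_bracket_def coad_def eval_bracket_diff by simp

text \<open>
  Antisymmetry brings the letter \<open>c\<close> to the front of \<open>[[us], c]\<close>; then the previous lemma applies.
\<close>

lemma eval_bracket_determined_by_first:
  assumes "\<And>v. mset v = mset us + mset vs \<Longrightarrow> eval_bracket X (c # v) = 0"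
  shows "eval_bracket X (us @ c # vs) = 0"
proof (cases "us = []")
  case True
  then show ?thesis using assms[of vs] by simp
next
  case False
  have "eval_bracket X (us @ c # vs) = eval_bracket (foldr coad vs X) (us @ [c])"
    using eval_bracket_append[of "us @ [c]" X vs] by simp
  also have "\<dots> = - eval_bracket (coad_bracket us (foldr coad vs X)) [c]"
    by (rule eval_bracket_antisym[OF False])
  also have "eval_bracket (coad_bracket us (foldr coad vs X)) [c] = 0"
  proof (rule eval_bracket_coad_bracket_eq_0[OF False])
    fix z' assume "mset z' = mset us"
    then show "eval_bracket (foldr coad vs X) ([c] @ z') = 0"
      using eval_bracket_append[of "[c] @ z'" X vs] assms[of "z' @ vs"] by simp
  qed simp
  finally show ?thesis by simp
qed

section \<open>The Lie module as a space of functions on brackets\<close>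

definition word :: "nat \<Rightarrow> (nat \<Rightarrow> nat) \<Rightarrow> nat list" where
  "word n \<rho> = map \<rho> [1..<Suc n]"

text \<open>
  Words are taken apart at their first letter, so intervals are unfolded at their lower end.
\<close>

declare upt_Suc [simp del]

lemma length_word [simp]: "length (word n \<rho>) = n"
  by (simp add: word_def)

text \<open>
  The function on the symmetric group that a functional on words induces through brackets. These functions will turn
  out to form the Lie module.
\<close>

definition lie_fun :: "nat \<Rightarrow> (nat list \<Rightarrow> 'a::field) \<Rightarrow> (nat \<Rightarrow> nat) \<Rightarrow> 'a" where
  "lie_fun n X = (\<lambda>\<rho>. if \<rho> \<in> Sym n then eval_bracket X (word n \<rho>) else 0)"

lemma Sym_iff: "\<sigma> \<in> Sym n \<longleftrightarrow> \<sigma> permutes {1..n}"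
  by (rule sym_group_carrier)

lemma finite_Sym: "finite (Sym n)"
  using finite_permutations[of "{1..n}"] by (simp add: sym_group_def)

lemma Sym_comp: "\<sigma> \<in> Sym n \<Longrightarrow> \<tau> \<in> Sym n \<Longrightarrow> \<tau> \<circ> \<sigma> \<in> Sym n"
  by (simp add: Sym_iff permutes_compose)

lemma Sym_inv: "g \<in> Sym n \<Longrightarrow> inv' g \<in> Sym n"
  by (simp add: Sym_iff permutes_inv)

text \<open>
  Besides the symmetric groups, this covers the Sylow subgroups and hence the free modules over their group algebras.
\<close>

locale perm_group =
  fixes G :: "(nat \<Rightarrow> nat) set"
  assumes finite_G: "finite G"
    and id_in: "id \<in> G"
    and comp_in: "\<sigma> \<in> G \<Longrightarrow> \<tau> \<in> G \<Longrightarrow> \<tau> \<circ> \<sigma> \<in> G"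
    and inv_in: "g \<in> G \<Longrightarrow> inv' g \<in> G"
    and bij_in: "g \<in> G \<Longrightarrow> bij g"
begin

lemma comp_inv: "g \<in> G \<Longrightarrow> g \<circ> inv' g = id" "g \<in> G \<Longrightarrow> inv' g \<circ> g = id"
  using bij_in by (auto simp: bij_def surj_iff inj_iff)

lemma comp_inv_right_iff: "g \<in> G \<Longrightarrow> \<rho> \<circ> inv' g \<in> G \<longleftrightarrow> \<rho> \<in> G"
  by (metis comp_assoc comp_id comp_in comp_inv(2) inv_in)

lemma comp_inv_left_iff: "g \<in> G \<Longrightarrow> inv' g \<circ> \<rho> \<in> G \<longleftrightarrow> \<rho> \<in> G"
  by (metis comp_assoc id_comp comp_in comp_inv(1) inv_in)

lemma comp_eq_iff_left: "g \<in> G \<Longrightarrow> g \<circ> \<sigma> = \<rho> \<longleftrightarrow> \<sigma> = inv' g \<circ> \<rho>"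
  by (metis comp_assoc id_comp comp_inv)

lemma comp_eq_iff_right: "g \<in> G \<Longrightarrow> \<tau> \<circ> g = \<rho> \<longleftrightarrow> \<tau> = \<rho> \<circ> inv' g"
  by (metis comp_assoc comp_id comp_inv)

lemma ga_mult_of_left:
  assumes "g \<in> G"
  shows "ga_mult G (ga_of g) x \<rho> = (if \<rho> \<in> G then x (\<rho> \<circ> inv' g) else 0)"
proof -
  have "ga_mult G (ga_of g) x \<rho> = (\<Sum>\<tau>\<in>G. \<Sum>\<sigma>\<in>G. if \<tau> \<circ> \<sigma> = \<rho> then ga_of g \<sigma> * x \<tau> else 0)"
    unfolding ga_mult_def by (rule sum.swap)
  also have "\<dots> = (\<Sum>\<tau>\<in>G. \<Sum>\<sigma>\<in>G. if \<sigma> = g then (if \<tau> \<circ> g = \<rho> then x \<tau> else 0) else 0)"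
    by (intro sum.cong) (auto simp: ga_of_def)
  also have "\<dots> = (\<Sum>\<tau>\<in>G. if \<tau> = \<rho> \<circ> inv' g then x \<tau> else 0)"
    using assms finite_G by (simp add: sum.delta comp_eq_iff_right)
  also have "\<dots> = (if \<rho> \<circ> inv' g \<in> G then x (\<rho> \<circ> inv' g) else 0)"
    using finite_G by (simp add: sum.delta)
  finally show ?thesis
    by (simp add: comp_inv_right_iff[OF assms])
qed

lemma ga_mult_of_right:
  assumes "g \<in> G"
  shows "ga_mult G w (ga_of g) \<rho> = (if \<rho> \<in> G then w (inv' g \<circ> \<rho>) else 0)"
proof -
  have "ga_mult G w (ga_of g) \<rho> = (\<Sum>\<sigma>\<in>G. \<Sum>\<tau>\<in>G. if \<tau> = g then (if g \<circ> \<sigma> = \<rho> then w \<sigma> else 0) else 0)"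
    unfolding ga_mult_def by (intro sum.cong) (auto simp: ga_of_def)
  also have "\<dots> = (\<Sum>\<sigma>\<in>G. if \<sigma> = inv' g \<circ> \<rho> then w \<sigma> else 0)"
    using assms finite_G by (simp add: sum.delta comp_eq_iff_left)
  also have "\<dots> = (if inv' g \<circ> \<rho> \<in> G then w (inv' g \<circ> \<rho>) else 0)"
    using finite_G by (simp add: sum.delta)
  finally show ?thesis
    by (simp add: comp_inv_left_iff[OF assms])
qed

lemma ga_mult_zero: "\<rho> \<notin> G \<Longrightarrow> ga_mult G f g \<rho> = 0"
  unfolding ga_mult_def by (intro sum.neutral ballI) (metis comp_in)

end

interpretation Sym: perm_group "Sym n" for n
proof
  show "finite (Sym n)" by (rule finite_Sym)
  show "id \<in> Sym n" by (simp add: Sym_iff permutes_id)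
  show "\<And>g. g \<in> Sym n \<Longrightarrow> bij g"
    unfolding Sym_iff by (rule permutes_bij)
qed (rule Sym_comp Sym_inv; assumption)+

lemma sum_rotate3:
  "(\<Sum>a\<in>A. \<Sum>b\<in>B. \<Sum>c\<in>C. T a b c) = (\<Sum>b\<in>B. \<Sum>c\<in>C. \<Sum>a\<in>A. T a b c)"
  for T :: "_ \<Rightarrow> _ \<Rightarrow> _ \<Rightarrow> 'a::comm_monoid_add"
proof -
  have "(\<Sum>a\<in>A. \<Sum>b\<in>B. \<Sum>c\<in>C. T a b c) = (\<Sum>b\<in>B. \<Sum>a\<in>A. \<Sum>c\<in>C. T a b c)"
    by (rule sum.swap)
  also have "\<dots> = (\<Sum>b\<in>B. \<Sum>c\<in>C. \<Sum>a\<in>A. T a b c)"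
    by (intro sum.cong refl, rule sum.swap)
  finally show ?thesis .
qed

lemma sum_rotate4:
  "(\<Sum>a\<in>A. \<Sum>b\<in>B. \<Sum>c\<in>C. \<Sum>d\<in>D. T a b c d) = (\<Sum>b\<in>B. \<Sum>c\<in>C. \<Sum>d\<in>D. \<Sum>a\<in>A. T a b c d)"
  for T :: "_ \<Rightarrow> _ \<Rightarrow> _ \<Rightarrow> _ \<Rightarrow> 'a::comm_monoid_add"
proof -
  have "(\<Sum>a\<in>A. \<Sum>b\<in>B. \<Sum>c\<in>C. \<Sum>d\<in>D. T a b c d) = (\<Sum>b\<in>B. \<Sum>c\<in>C. \<Sum>a\<in>A. \<Sum>d\<in>D. T a b c d)"
    by (rule sum_rotate3)
  also have "\<dots> = (\<Sum>b\<in>B. \<Sum>c\<in>C. \<Sum>d\<in>D. \<Sum>a\<in>A. T a b c d)"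
    by (intro sum.cong refl, rule sum.swap)
  finally show ?thesis .
qed

lemma ga_mult_assoc:
  "ga_mult (Sym n) (ga_mult (Sym n) f g) h = ga_mult (Sym n) f (ga_mult (Sym n) g h)"
proof
  fix \<rho>
  note comp = Sym_comp[of _ n]
  have "ga_mult (Sym n) (ga_mult (Sym n) f g) h \<rho> =
     (\<Sum>\<mu>\<in>Sym n. \<Sum>\<nu>\<in>Sym n. \<Sum>\<sigma>\<in>Sym n. \<Sum>\<tau>\<in>Sym n.
        if \<tau> \<circ> \<sigma> = \<mu> then (if \<nu> \<circ> \<mu> = \<rho> then f \<sigma> * g \<tau> * h \<nu> else 0) else 0)"
    unfolding ga_mult_def by (intro sum.cong refl) (auto simp: sum_distrib_right intro!: sum.cong sum.neutral)
  also have "\<dots> = (\<Sum>\<nu>\<in>Sym n. \<Sum>\<sigma>\<in>Sym n. \<Sum>\<tau>\<in>Sym n. \<Sum>\<mu>\<in>Sym n.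
        if \<tau> \<circ> \<sigma> = \<mu> then (if \<nu> \<circ> \<mu> = \<rho> then f \<sigma> * g \<tau> * h \<nu> else 0) else 0)"
    by (rule sum_rotate4)
  also have "\<dots> = (\<Sum>\<nu>\<in>Sym n. \<Sum>\<sigma>\<in>Sym n. \<Sum>\<tau>\<in>Sym n.
       if \<nu> \<circ> (\<tau> \<circ> \<sigma>) = \<rho> then f \<sigma> * g \<tau> * h \<nu> else 0)"
    by (intro sum.cong refl) (simp add: sum.delta'[OF finite_Sym] comp)
  also have "\<dots> = (\<Sum>\<sigma>\<in>Sym n. \<Sum>\<tau>\<in>Sym n. \<Sum>\<nu>\<in>Sym n.
       if \<nu> \<circ> (\<tau> \<circ> \<sigma>) = \<rho> then f \<sigma> * g \<tau> * h \<nu> else 0)"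
    by (rule sum_rotate3)
  finally have L: "ga_mult (Sym n) (ga_mult (Sym n) f g) h \<rho> = \<dots>" .
  have "ga_mult (Sym n) f (ga_mult (Sym n) g h) \<rho> =
     (\<Sum>\<sigma>\<in>Sym n. \<Sum>\<mu>\<in>Sym n. \<Sum>\<tau>\<in>Sym n. \<Sum>\<nu>\<in>Sym n.
        if \<nu> \<circ> \<tau> = \<mu> then (if \<mu> \<circ> \<sigma> = \<rho> then f \<sigma> * g \<tau> * h \<nu> else 0) else 0)"
    unfolding ga_mult_def
    by (intro sum.cong refl) (auto simp: sum_distrib_left mult.assoc intro!: sum.cong sum.neutral)
  also have "\<dots> = (\<Sum>\<sigma>\<in>Sym n. \<Sum>\<tau>\<in>Sym n. \<Sum>\<nu>\<in>Sym n. \<Sum>\<mu>\<in>Sym n.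
        if \<nu> \<circ> \<tau> = \<mu> then (if \<mu> \<circ> \<sigma> = \<rho> then f \<sigma> * g \<tau> * h \<nu> else 0) else 0)"
    by (rule sum.cong[OF refl], rule sum_rotate3[where T = "\<lambda>\<mu> \<tau> \<nu>.
       if \<nu> \<circ> \<tau> = \<mu> then (if \<mu> \<circ> \<sigma> = \<rho> then f \<sigma> * g \<tau> * h \<nu> else 0) else 0" for \<sigma>])
  also have "\<dots> = (\<Sum>\<sigma>\<in>Sym n. \<Sum>\<tau>\<in>Sym n. \<Sum>\<nu>\<in>Sym n.
       if \<nu> \<circ> (\<tau> \<circ> \<sigma>) = \<rho> then f \<sigma> * g \<tau> * h \<nu> else 0)"
    by (intro sum.cong refl) (simp add: sum.delta'[OF finite_Sym] comp o_assoc)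
  finally show "ga_mult (Sym n) (ga_mult (Sym n) f g) h \<rho> = ga_mult (Sym n) f (ga_mult (Sym n) g h) \<rho>"
    using L by simp
qed

lemma cyc_permutes: "1 \<le> j \<Longrightarrow> j \<le> n \<Longrightarrow> cyc j \<in> Sym n"
  unfolding Sym_iff cyc_def
  by (rule permutes_subset[OF cycle_permutes]) auto

lemma cyc_apply: "1 \<le> i \<Longrightarrow> i < j \<Longrightarrow> cyc j i = i + 1" "1 \<le> j \<Longrightarrow> cyc j j = 1"
  "i = 0 \<or> i > j \<Longrightarrow> cyc j i = i"
proof -
  have gen: "cycle_of_list [a..<a + Suc m] i =
     (if a \<le> i \<and> i < a + m then i + 1 else if i = a + m then a else i)" for a m i :: nat
  proof (induction m arbitrary: a)
    case (Suc m)
    have "[a..<a + Suc (Suc m)] = a # Suc a # [Suc (Suc a)..<Suc a + Suc m]"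
      by (simp add: upt_conv_Cons)
    moreover have "[Suc a..<Suc a + Suc m] = Suc a # [Suc (Suc a)..<Suc a + Suc m]"
      by (simp add: upt_conv_Cons)
    ultimately have "cycle_of_list [a..<a + Suc (Suc m)] = transpose a (Suc a) \<circ> cycle_of_list [Suc a..<Suc a + Suc m]"
      by simp
    then show ?case
      using Suc.IH[of "Suc a"] by (auto simp: transpose_def)
  qed (auto simp: upt_conv_Cons)
  have "cyc j i = (if 1 \<le> i \<and> i < j then i + 1 else if i = j then 1 else i)" if "1 \<le> j" for i
    using gen[of 1 "j - 1" i] that by (simp add: cyc_def)
  moreover have "cyc 0 = id"
    by (simp add: cyc_def id_def)
  ultimately show "1 \<le> i \<Longrightarrow> i < j \<Longrightarrow> cyc j i = i + 1" "1 \<le> j \<Longrightarrow> cyc j j = 1"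
    "i = 0 \<or> i > j \<Longrightarrow> cyc j i = i"
    by (cases "j = 0"; auto)+
qed

text \<open>
  Composition with the inverse of the cycle \<open>c\<^sub>j\<close> moves the \<open>j\<close>-th letter of a word to the front. This is the
  second term of \<open>[w, c] = w c - c w\<close>.
\<close>

lemma word_cyc:
  assumes "1 \<le> j" "j \<le> n" "\<rho> \<in> Sym n" "word n \<rho> = t @ c # s" "length t = j - 1"
  shows "word n (\<rho> \<circ> inv' (cyc j)) = c # t @ s"
proof (rule nth_equalityI)
  have len: "length t + length s + 1 = n"
    using arg_cong[OF assms(4), of length] by (simp add: word_def)
  then show "length (word n (\<rho> \<circ> inv' (cyc j))) = length (c # t @ s)"
    by (simp add: word_def)
  fix i assume "i < length (word n (\<rho> \<circ> inv' (cyc j)))"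
  then have i: "i < n" by (simp add: word_def)
  have bij: "bij (cyc j)"
    using cyc_permutes[OF assms(1,2)] by (auto simp: Sym_iff permutes_bij)
  define i' where "i' = (if i = 0 then j else if i < j then i else i + 1)"
  have "cyc j i' = i + 1"
    using assms(1) cyc_apply by (auto simp: i'_def)
  then have inv: "inv' (cyc j) (i + 1) = i'"
    using bij by (metis bij_inv_eq_iff)
  have i': "1 \<le> i'" "i' \<le> n"
    using assms(1,2) i by (auto simp: i'_def)
  have "word n (\<rho> \<circ> inv' (cyc j)) ! i = \<rho> (inv' (cyc j) (i + 1))"
    using i by (simp add: word_def)
  also have "\<dots> = word n \<rho> ! (i' - 1)"
    using inv i' by (simp add: word_def)
  also have "\<dots> = (c # t @ s) ! i"
    using assms(1,5) by (auto simp: assms(4) i'_def nth_append nth_Cons')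
  finally show "word n (\<rho> \<circ> inv' (cyc j)) ! i = (c # t @ s) ! i" .
qed

lemma word_in_Sym_distinct: "\<sigma> \<in> Sym n \<Longrightarrow> word n \<sigma> \<in> permutations_of_set {1..n}"
  unfolding Sym_iff word_def
  by (auto simp: permutations_of_set_def distinct_map permutes_image permutes_inj_on atLeastLessThanSuc_atLeastAtMost)

lemma bij_betw_word: "bij_betw (word n) (Sym n) (permutations_of_set {1..n})"
proof -
  have inj: "inj_on (word n) (Sym n)"
  proof (rule inj_onI)
    fix \<sigma> \<tau> assume *: "\<sigma> \<in> Sym n" "\<tau> \<in> Sym n" "word n \<sigma> = word n \<tau>"
    then have "\<sigma> x = \<tau> x" if "x \<in> {1..n}" for x
      using that by (auto simp: word_def)
    moreover have "\<sigma> x = \<tau> x" if "x \<notin> {1..n}" for x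
      using * that by (auto simp: Sym_iff permutes_def)
    ultimately show "\<sigma> = \<tau>" by blast
  qed
  have "card (word n ` Sym n) = card (permutations_of_set {1..n})"
    using card_image[OF inj] card_permutations[of "{1..n}" n] by (simp add: sym_group_def)
  then have "word n ` Sym n = permutations_of_set {1..n}"
    using word_in_Sym_distinct by (intro card_subset_eq) auto
  with inj show ?thesis by (simp add: bij_betw_def)
qed

lemma lie_omega_foldl:
  assumes "\<And>j. j \<in> set js \<Longrightarrow> 1 \<le> j \<and> j \<le> n"
  shows "ga_mult (Sym n) (foldl (ga_mult (Sym n)) f (map (\<lambda>j. ga_of id - ga_of (cyc j)) js)) x =
    ga_mult (Sym n) f (foldr (\<lambda>j. ga_mult (Sym n) (ga_of id - ga_of (cyc j))) js x)"
  using assms by (induction js arbitrary: f) (auto simp: ga_mult_assoc)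

lemma ga_mult_diff_left:
  "ga_mult (Sym n) (f - g) x = ga_mult (Sym n) f x - ga_mult (Sym n) g x"
  by (auto simp: ga_mult_def fun_eq_iff algebra_simps sum_subtractf[symmetric] intro!: sum.cong)

text \<open>
  Only the factors with \<open>j > length t\<close> are applied here. They bracket in the letters of \<open>s\<close> one after the other,
  while \<open>t\<close> is still an ordinary word.
\<close>

lemma foldr_one_minus_cyc:
  assumes "\<And>\<sigma>. \<sigma> \<in> Sym n \<Longrightarrow> x \<sigma> = X (word n \<sigma>)" "\<rho> \<in> Sym n" "word n \<rho> = t @ s" "1 \<le> length t"
  shows "foldr (\<lambda>j. ga_mult (Sym n) (ga_of id - ga_of (cyc j))) [Suc (length t)..<Suc n] x \<rho>
     = foldr coad s X t"
  using assms(2-)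
proof (induction s arbitrary: t \<rho>)
  case Nil
  then have "length t = n"
    using length_word[of n \<rho>] by simp
  then show ?case using Nil assms(1) by simp
next
  case (Cons c s)
  let ?f = "foldr (\<lambda>j. ga_mult (Sym n) (ga_of id - ga_of (cyc j))) [Suc (Suc (length t))..<Suc n] x"
  let ?j = "Suc (length t)"
  have len: "length t + length s + 1 = n"
    using arg_cong[OF Cons.prems(2), of length] by (simp add: word_def)
  have cyc: "cyc ?j \<in> Sym n"
    by (rule cyc_permutes) (use len in auto)
  have id: "id \<in> Sym n" by (simp add: Sym_iff permutes_id)
  have \<rho>': "\<rho> \<circ> inv' (cyc ?j) \<in> Sym n"
    using Cons.prems(1) cyc by (simp add: Sym_iff permutes_compose permutes_inv)
  have w': "word n (\<rho> \<circ> inv' (cyc ?j)) = (c # t) @ s"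
    using word_cyc[of ?j n \<rho> t c s] Cons.prems len by simp
  have "[?j..<Suc n] = ?j # [Suc (Suc (length t))..<Suc n]"
    using len by (simp add: upt_conv_Cons)
  then have "foldr (\<lambda>j. ga_mult (Sym n) (ga_of id - ga_of (cyc j))) [?j..<Suc n] x \<rho>
     = ?f \<rho> - ?f (\<rho> \<circ> inv' (cyc ?j))"
    using Cons.prems(1) by (simp add: ga_mult_diff_left Sym.ga_mult_of_left[OF cyc] Sym.ga_mult_of_left[OF id])
  also have "?f \<rho> = foldr coad s X (t @ [c])"
    using Cons.prems(1,2) by (intro Cons.IH[of \<rho> "t @ [c]", simplified length_append list.size add_Suc_right add_0_right]) auto
  also have "?f (\<rho> \<circ> inv' (cyc ?j)) = foldr coad s X (c # t)"
    by (rule Cons.IH[OF \<rho>' w', unfolded length_Cons]) simp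
  finally show ?case by (simp add: coad_def[of c])
qed

lemma lie_omega_mult:
  assumes n: "1 \<le> n" and x: "\<And>\<sigma>. \<sigma> \<in> Sym n \<Longrightarrow> x \<sigma> = X (word n \<sigma>)"
  shows "ga_mult (Sym n) (lie_omega n) x = lie_fun n X"
proof
  fix \<rho>
  have id: "id \<in> Sym n" by (simp add: Sym_iff permutes_id)
  show "ga_mult (Sym n) (lie_omega n) x \<rho> = lie_fun n X \<rho>"
  proof (cases "\<rho> \<in> Sym n")
    case True
    have w: "word n \<rho> = [\<rho> 1] @ map \<rho> [2..<Suc n]"
      using n by (simp add: word_def upt_conv_Cons numeral_2_eq_2)
    have "ga_mult (Sym n) (lie_omega n) x \<rho> =
       foldr (\<lambda>j. ga_mult (Sym n) (ga_of id - ga_of (cyc j))) [2..<Suc n] x \<rho>"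
      unfolding lie_omega_def using True
      by (subst lie_omega_foldl) (auto simp: Sym.ga_mult_of_left[OF id])
    also have "\<dots> = foldr coad (map \<rho> [2..<Suc n]) X [\<rho> 1]"
      using foldr_one_minus_cyc[where X = X, OF x True w] by (simp add: numeral_2_eq_2)
    also have "\<dots> = lie_fun n X \<rho>"
      unfolding lie_fun_def w using True by (simp add: eval_bracket.simps(2))
    finally show ?thesis .
  qed (simp add: Sym.ga_mult_zero lie_fun_def)
qed

lemma Lie_eq:
  assumes "1 \<le> n"
  shows "Lie n = range (lie_fun n)"
proof -
  have inv: "the_inv_into (Sym n) (word n) (word n \<sigma>) = \<sigma>" if "\<sigma> \<in> Sym n" for \<sigma>
    using bij_betw_word that by (auto simp: bij_betw_def the_inv_into_f_f)
  have "w \<in> range (lie_fun n)" if "w \<in> Lie n" for w :: "(nat \<Rightarrow> nat) \<Rightarrow> 'a"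
  proof -
    obtain x where x: "w = ga_mult (Sym n) (lie_omega n) x"
      using \<open>w \<in> Lie n\<close> by (auto simp: Lie_def)
    have "w = lie_fun n (\<lambda>l. x (the_inv_into (Sym n) (word n) l))"
      unfolding x by (rule lie_omega_mult[OF assms]) (simp add: inv)
    then show ?thesis by blast
  qed
  moreover have "lie_fun n X \<in> Lie n" for X :: "nat list \<Rightarrow> 'a"
  proof -
    have "lie_fun n X = ga_mult (Sym n) (lie_omega n) (\<lambda>\<sigma>. if \<sigma> \<in> Sym n then X (word n \<sigma>) else 0)"
      by (rule lie_omega_mult[OF assms, symmetric]) simp
    moreover have "(\<lambda>\<sigma>. if \<sigma> \<in> Sym n then X (word n \<sigma>) else 0) \<in> ga_carrier (Sym n)"
      by (simp add: ga_carrier_def)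
    ultimately show ?thesis unfolding Lie_def by blast
  qed
  ultimately show ?thesis by blast
qed

section \<open>Dimensions of spaces of functions\<close>

text \<open>
  The space of all functions on an infinite type is infinite-dimensional, so that finiteness has to be carried along.
\<close>

definition fin_dim :: "('b \<Rightarrow> 'a::field) set \<Rightarrow> bool" where
  "fin_dim V \<longleftrightarrow> (\<exists>B. finite B \<and> V \<subseteq> fv.span B)"

lemma fin_dim_subset: "fin_dim V \<Longrightarrow> A \<subseteq> V \<Longrightarrow> fin_dim A"
  by (auto simp: fin_dim_def)

lemma fin_dim_basis:
  assumes "fin_dim V"
  obtains B where "finite B" "B \<subseteq> V" "fv.independent B" "V \<subseteq> fv.span B" "card B = fv.dim V"
proof -
  obtain B where B: "B \<subseteq> V" "fv.independent B" "V \<subseteq> fv.span B" "card B = fv.dim V"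
    by (rule fv.basis_exists)
  obtain C where C: "finite C" "V \<subseteq> fv.span C"
    using assms by (auto simp: fin_dim_def)
  then have "finite B"
    using fv.independent_span_bound[of C B] B by blast
  with B that show ?thesis by blast
qed

lemma independent_card_le_dim:
  assumes "fin_dim V" "fv.independent B" "B \<subseteq> V"
  shows "finite B" "card B \<le> fv.dim V"
proof -
  obtain C where C: "finite C" "V \<subseteq> fv.span C" "card C = fv.dim V"
    using fin_dim_basis[OF assms(1)] by metis
  show "finite B" "card B \<le> fv.dim V"
    using fv.independent_span_bound[of C B] C assms by auto
qed

lemma dim_eqI:
  assumes "fv.subspace A" "A \<subseteq> V" "fin_dim V" "fv.dim V \<le> fv.dim A"
  shows "A = V"
proof -
  obtain B where B: "finite B" "B \<subseteq> A" "fv.independent B" "A \<subseteq> fv.span B" "card B = fv.dim A"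
    using fin_dim_basis[OF fin_dim_subset[OF assms(3,2)]] .
  have "x \<in> fv.span B" if "x \<in> V" for x
  proof (rule ccontr)
    assume x: "x \<notin> fv.span B"
    then have "fv.independent (insert x B)" "x \<notin> B"
      using B(3) fv.independent_insertI[OF x] by (auto intro: fv.span_base)
    then have "card (insert x B) \<le> fv.dim V"
      using B that assms(2) by (intro independent_card_le_dim[OF assms(3)]) auto
    then show False
      using B \<open>x \<notin> B\<close> assms(4) by simp
  qed
  moreover have "fv.span B \<subseteq> A"
    using B(2) assms(1) by (rule fv.span_minimal)
  ultimately show ?thesis using assms(2) by blast
qed

lemma dim_eq_0_iff:
  assumes "fin_dim V" "fv.subspace V"
  shows "fv.dim V = 0 \<longleftrightarrow> V = {0}"
proof
  assume "fv.dim V = 0"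
  then have "{0} = V"
    using assms by (intro dim_eqI) (auto simp: fv.subspace_0 fv.subspace_single_0)
  then show "V = {0}" by simp
next
  assume "V = {0}"
  then have "V \<subseteq> fv.span {}" by (simp add: fv.span_empty)
  then show "fv.dim V = 0"
    using fv.dim_le_card[of V "{}"] by simp
qed

definition indep_family :: "'i set \<Rightarrow> ('i \<Rightarrow> ('b \<Rightarrow> 'a::field)) \<Rightarrow> bool" where
  "indep_family I v \<longleftrightarrow> (\<forall>c. (\<Sum>i\<in>I. fscale (c i) (v i)) = 0 \<longrightarrow> (\<forall>i\<in>I. c i = 0))"

lemma indep_familyD: "indep_family I v \<Longrightarrow> (\<Sum>i\<in>I. fscale (c i) (v i)) = 0 \<Longrightarrow> i \<in> I \<Longrightarrow> c i = 0"
  by (simp add: indep_family_def)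

lemma indep_familyI:
  "(\<And>c i. (\<Sum>i\<in>I. fscale (c i) (v i)) = 0 \<Longrightarrow> i \<in> I \<Longrightarrow> c i = 0) \<Longrightarrow> indep_family I v"
  by (simp add: indep_family_def)

lemma indep_family_inj:
  fixes v :: "'i \<Rightarrow> 'c \<Rightarrow> 'b::field"
  assumes "finite I" "indep_family I v"
  shows "inj_on v I"
proof (rule inj_onI, rule ccontr)
  fix i j assume ij: "i \<in> I" "j \<in> I" "v i = v j" "i \<noteq> j"
  let ?c = "\<lambda>k. if k = i then 1 else if k = j then -1 else 0 :: 'b"
  have "(\<Sum>k\<in>I. fscale (?c k) (v k)) = (\<Sum>k\<in>{i, j}. fscale (?c k) (v k))"
    using ij assms(1) by (intro sum.mono_neutral_right) auto
  also have "\<dots> = 0" using ij by (simp add: fscale_def fun_eq_iff)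
  finally have "?c i = 0"
    by (rule indep_familyD[OF assms(2) _ ij(1)])
  then show False by simp
qed

lemma indep_family_independent:
  assumes "finite I" "indep_family I v"
  shows "fv.independent (v ` I)" "card (v ` I) = card I"
proof -
  note inj = indep_family_inj[OF assms]
  show "card (v ` I) = card I" using inj by (rule card_image)
  show "fv.independent (v ` I)"
    unfolding fv.dependent_finite[OF finite_imageI[OF assms(1)]]
  proof (rule notI, elim exE conjE bexE)
    fix u x assume u: "(\<Sum>v\<in>v ` I. fscale (u v) v) = 0" "x \<in> v ` I" "u x \<noteq> 0"
    have "(\<Sum>i\<in>I. fscale (u (v i)) (v i)) = 0"
      using u(1) inj by (simp add: sum.reindex)
    from indep_familyD[OF assms(2) this] show False using u by auto
  qed
qed

lemma indep_family_card_le: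
  assumes "fin_dim V" "finite I" "indep_family I v" "v ` I \<subseteq> V"
  shows "card I \<le> fv.dim V"
  using independent_card_le_dim(2)[OF assms(1) indep_family_independent(1)[OF assms(2,3)] assms(4)]
    indep_family_independent(2)[OF assms(2,3)] by simp

lemma basis_family:
  assumes "fv.independent B" "finite B"
  shows "indep_family B (\<lambda>b. b)"
  using assms unfolding fv.dependent_finite[OF assms(2)] indep_family_def by blast

definition lin_on :: "('b \<Rightarrow> 'a::field) set \<Rightarrow> (('b \<Rightarrow> 'a) \<Rightarrow> ('c \<Rightarrow> 'a)) \<Rightarrow> bool" where
  "lin_on V f \<longleftrightarrow> (\<forall>x\<in>V. \<forall>y\<in>V. f (x + y) = f x + f y) \<and> (\<forall>c. \<forall>x\<in>V. f (fscale c x) = fscale c (f x))"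

lemma lin_on_0: "fv.subspace V \<Longrightarrow> lin_on V f \<Longrightarrow> f 0 = 0"
  using fv.subspace_0[of V] unfolding lin_on_def
  by (metis fv.scale_zero_left)

lemma lin_on_sum:
  assumes "fv.subspace V" "lin_on V f" "\<And>i. i \<in> I \<Longrightarrow> v i \<in> V"
  shows "f (\<Sum>i\<in>I. fscale (c i) (v i)) = (\<Sum>i\<in>I. fscale (c i) (f (v i)))"
proof (cases "finite I")
  case True
  then show ?thesis using assms(3)
  proof (induction I rule: finite_induct)
    case (insert i I)
    have "(\<Sum>i\<in>I. fscale (c i) (v i)) \<in> V"
      using insert assms(1) by (auto intro!: fv.subspace_sum fv.subspace_scale)
    moreover have "fscale (c i) (v i) \<in> V"
      using insert assms(1) by (auto intro!: fv.subspace_scale)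
    ultimately have "f (fscale (c i) (v i) + (\<Sum>i\<in>I. fscale (c i) (v i))) =
        fscale (c i) (f (v i)) + f (\<Sum>i\<in>I. fscale (c i) (v i))"
      using insert.prems assms(2) unfolding lin_on_def by (metis insertI1)
    then show ?case using insert.IH insert.prems insert.hyps
      by (metis (no_types, lifting) insertCI sum.insert)
  qed (simp add: lin_on_0[OF assms(1,2)])
qed (simp add: lin_on_0[OF assms(1,2)])

lemma lin_on_diff:
  assumes "fv.subspace V" "lin_on V f" "x \<in> V" "y \<in> V"
  shows "f (x - y) = f x - f y"
proof -
  have "x - y \<in> V" using assms by (simp add: fv.subspace_diff)
  then have "f ((x - y) + y) = f (x - y) + f y"
    using assms(2,4) unfolding lin_on_def by blast
  then show ?thesis by simp
qed

lemma subspace_image_lin_on: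
  assumes "fv.subspace V" "lin_on V f"
  shows "fv.subspace (f ` V)"
proof (rule fv.subspaceI)
  show "0 \<in> f ` V" using lin_on_0[OF assms] fv.subspace_0[OF assms(1)] by (metis imageI)
  show "x + y \<in> f ` V" if xy: "x \<in> f ` V" "y \<in> f ` V" for x y
  proof -
    from xy obtain a b where "a \<in> V" "b \<in> V" "x = f a" "y = f b" by blast
    then have "x + y = f (a + b)" "a + b \<in> V"
      using assms by (auto simp: lin_on_def fv.subspace_add)
    then show ?thesis by blast
  qed
  show "fscale c x \<in> f ` V" if x: "x \<in> f ` V" for c x
  proof -
    from x obtain a where "a \<in> V" "x = f a" by blast
    then have "fscale c x = f (fscale c a)" "fscale c a \<in> V"
      using assms by (auto simp: lin_on_def fv.subspace_scale)
    then show ?thesis by blast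
  qed
qed

lemma subspace_kernel_lin_on:
  assumes "fv.subspace V" "lin_on V f"
  shows "fv.subspace {x \<in> V. f x = 0}"
proof (rule fv.subspaceI)
  show "0 \<in> {x \<in> V. f x = 0}" using lin_on_0[OF assms] fv.subspace_0[OF assms(1)] by simp
  show "x + y \<in> {x \<in> V. f x = 0}" if "x \<in> {x \<in> V. f x = 0}" "y \<in> {x \<in> V. f x = 0}" for x y
  proof -
    have xy: "x \<in> V" "y \<in> V" "f x = 0" "f y = 0" using that by auto
    then have "f (x + y) = f x + f y" using assms(2) unfolding lin_on_def by blast
    then show ?thesis using xy fv.subspace_add[OF assms(1)] by simp
  qed
  show "fscale c x \<in> {x \<in> V. f x = 0}" if "x \<in> {x \<in> V. f x = 0}" for c x
  proof -
    have x: "x \<in> V" "f x = 0" using that by auto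
    then have "f (fscale c x) = fscale c (f x)" using assms(2) unfolding lin_on_def by blast
    then show ?thesis using x fv.subspace_scale[OF assms(1)] by simp
  qed
qed

lemma fin_dim_image:
  assumes "fv.subspace V" "fin_dim V" "lin_on V f"
  shows "fin_dim (f ` V)" "fv.dim (f ` V) \<le> fv.dim V"
proof -
  obtain B where B: "finite B" "B \<subseteq> V" "fv.independent B" "V \<subseteq> fv.span B" "card B = fv.dim V"
    using fin_dim_basis[OF assms(2)] .
  have "f ` V \<subseteq> fv.span (f ` B)"
  proof
    fix y assume "y \<in> f ` V"
    then obtain x where x: "x \<in> V" "y = f x" by blast
    then have "x \<in> fv.span B" using B(4) by blast
    then obtain u where "x = (\<Sum>b\<in>B. fscale (u b) b)"
      unfolding fv.span_finite[OF B(1)] by auto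
    then have "y = (\<Sum>b\<in>B. fscale (u b) (f b))"
      using lin_on_sum[OF assms(1,3), of B "\<lambda>b. b"] B(2) x by auto
    moreover have "(\<Sum>b\<in>B. fscale (u b) (f b)) \<in> fv.span (f ` B)"
      by (intro fv.span_sum fv.span_scale fv.span_base imageI)
    ultimately show "y \<in> fv.span (f ` B)" by simp
  qed
  moreover have "finite (f ` B)" using B(1) by simp
  ultimately show "fin_dim (f ` V)" "fv.dim (f ` V) \<le> fv.dim V"
    using B(1,5) card_image_le[OF B(1), of f] fv.dim_le_card[of "f ` V" "f ` B"]
    by (auto simp: fin_dim_def)
qed

lemma indep_family_image:
  assumes "fv.subspace V" "lin_on V f" "finite I" "\<And>i. i \<in> I \<Longrightarrow> v i \<in> V"
    and "indep_family I v" "\<And>x. x \<in> V \<Longrightarrow> f x = 0 \<Longrightarrow> x = 0"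
  shows "indep_family I (\<lambda>i. f (v i))"
proof (rule indep_familyI)
  fix c i assume "i \<in> I" and "(\<Sum>i\<in>I. fscale (c i) (f (v i))) = 0"
  then have "f (\<Sum>i\<in>I. fscale (c i) (v i)) = 0"
    using lin_on_sum[OF assms(1,2), of I v c] assms(4) by simp
  moreover have "(\<Sum>i\<in>I. fscale (c i) (v i)) \<in> V"
    using assms(1,4) by (auto intro!: fv.subspace_sum fv.subspace_scale)
  ultimately have "(\<Sum>i\<in>I. fscale (c i) (v i)) = 0"
    using assms(6) by blast
  then show "c i = 0" using \<open>i \<in> I\<close> by (rule indep_familyD[OF assms(5)])
qed

lemma dim_image_inj:
  assumes "fv.subspace V" "fin_dim V" "lin_on V f" "\<And>x. x \<in> V \<Longrightarrow> f x = 0 \<Longrightarrow> x = 0"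
  shows "fv.dim (f ` V) = fv.dim V"
proof (rule antisym)
  obtain B where B: "finite B" "B \<subseteq> V" "fv.independent B" "V \<subseteq> fv.span B" "card B = fv.dim V"
    using fin_dim_basis[OF assms(2)] .
  have "indep_family B f"
    using indep_family_image[OF assms(1,3) B(1), of "\<lambda>b. b"] B(2) basis_family[OF B(3,1)] assms(4) by auto
  then have "card B \<le> fv.dim (f ` V)"
    using B by (intro indep_family_card_le fin_dim_image assms) auto
  then show "fv.dim V \<le> fv.dim (f ` V)" using B by simp
qed (rule fin_dim_image[OF assms(1-3)])

lemma dim_direct_sum:
  assumes A: "fv.subspace A" "fin_dim A" and B: "fv.subspace B" "fin_dim B"
    and AB: "A \<inter> B = {0}" and V: "V = {a + b | a b. a \<in> A \<and> b \<in> B}"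
  shows "fv.dim V = fv.dim A + fv.dim B" "fin_dim V"
proof -
  obtain C where C: "finite C" "C \<subseteq> A" "fv.independent C" "A \<subseteq> fv.span C" "card C = fv.dim A"
    using fin_dim_basis[OF A(2)] .
  obtain D where D: "finite D" "D \<subseteq> B" "fv.independent D" "B \<subseteq> fv.span D" "card D = fv.dim B"
    using fin_dim_basis[OF B(2)] .
  have 0: "0 \<in> A" "0 \<in> B" using A B by (auto simp: fv.subspace_0)
  have sp: "V \<subseteq> fv.span (C \<union> D)"
  proof
    fix x assume "x \<in> V"
    then obtain a b where ab: "x = a + b" "a \<in> A" "b \<in> B" unfolding V by blast
    have "a \<in> fv.span (C \<union> D)" "b \<in> fv.span (C \<union> D)"
      using ab(2,3) C(4) D(4) fv.span_mono[of C "C \<union> D"] fv.span_mono[of D "C \<union> D"] by blast+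
    then show "x \<in> fv.span (C \<union> D)" unfolding ab(1) by (rule fv.span_add)
  qed
  then show "fin_dim V" using C(1) D(1) by (auto simp: fin_dim_def)
  have disj: "C \<inter> D = {}"
  proof -
    have "0 \<notin> C" using C(3) fv.dependent_zero by blast
    moreover have "C \<inter> D \<subseteq> {0}" using C(2) D(2) AB by blast
    ultimately show ?thesis by blast
  qed
  have "fv.independent (C \<union> D)"
    unfolding fv.dependent_finite[OF finite_UnI[OF C(1) D(1)]]
  proof (rule notI, elim exE conjE bexE)
    fix u x assume u: "(\<Sum>v\<in>C \<union> D. fscale (u v) v) = 0" "x \<in> C \<union> D" "u x \<noteq> 0"
    let ?a = "\<Sum>v\<in>C. fscale (u v) v" and ?b = "\<Sum>v\<in>D. fscale (u v) v"
    have ab: "?a + ?b = 0"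
      using u(1) sum.union_disjoint[OF C(1) D(1) disj, of "\<lambda>v. fscale (u v) v"] by simp
    have a: "?a \<in> A" using C(2) by (intro fv.subspace_sum[OF A(1)] fv.subspace_scale[OF A(1)]) blast
    have b: "?b \<in> B" using D(2) by (intro fv.subspace_sum[OF B(1)] fv.subspace_scale[OF B(1)]) blast
    have "?a = - ?b" using ab by (rule eq_neg_iff_add_eq_0[THEN iffD2])
    moreover have "- ?b \<in> B" using b by (rule fv.subspace_neg[OF B(1)])
    ultimately have "?a \<in> B" by metis
    then have a0: "?a = 0" using a AB by blast
    moreover have "?b = 0" using ab unfolding a0 by (metis add_0)
    ultimately show False
      using u(2,3) indep_familyD[OF basis_family[OF C(3,1)], of u x]
        indep_familyD[OF basis_family[OF D(3,1)], of u x] by auto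
  qed
  moreover have "C \<union> D \<subseteq> V"
  proof -
    have "c \<in> V" if "c \<in> C" for c
      unfolding V using that C(2) 0 by (intro CollectI exI[of _ c] exI[of _ 0]) auto
    moreover have "d \<in> V" if "d \<in> D" for d
      unfolding V using that D(2) 0 by (intro CollectI exI[of _ 0] exI[of _ d]) auto
    ultimately show ?thesis by blast
  qed
  ultimately have "fv.dim V = card (C \<union> D)"
    using sp fv.basis_card_eq_dim[of "C \<union> D" V] by simp
  then show "fv.dim V = fv.dim A + fv.dim B"
    using C D disj by (simp add: card_Un_disjoint)
qed

definition supported :: "'b set \<Rightarrow> ('b \<Rightarrow> 'a::field) set" where
  "supported S = {f. \<forall>x. x \<notin> S \<longrightarrow> f x = 0}"

definition delta :: "'b \<Rightarrow> 'b \<Rightarrow> 'a::field" where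
  "delta s = (\<lambda>x. if x = s then 1 else 0)"

lemma subspace_supported: "fv.subspace (supported S)"
  by (rule fv.subspaceI) (auto simp: supported_def fscale_def)

lemma sum_apply: "(\<Sum>i\<in>I. F i) x = (\<Sum>i\<in>I. F i x)"
  by (induction I rule: infinite_finite_induct) auto

lemma sum_delta_apply: "finite S \<Longrightarrow> (\<Sum>s\<in>S. fscale (c s) (delta s)) x = (if x \<in> S then c x else 0)"
  by (simp add: sum_apply fscale_def delta_def if_distrib cong: if_cong)

lemma supported_eq_sum: "finite S \<Longrightarrow> f \<in> supported S \<Longrightarrow> f = (\<Sum>s\<in>S. fscale (f s) (delta s))"
  by (rule ext) (auto simp: sum_delta_apply supported_def)

lemma indep_family_delta:
  assumes "finite S"
  shows "indep_family S (delta :: 'b \<Rightarrow> 'b \<Rightarrow> 'a::field)"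
proof (rule indep_familyI)
  fix c :: "'b \<Rightarrow> 'a" and i assume "(\<Sum>s\<in>S. fscale (c s) (delta s)) = 0" "i \<in> S"
  then show "c i = 0" using sum_delta_apply[OF assms, of c i] by simp
qed

lemma dim_supported:
  fixes S :: "'b set"
  assumes "finite S"
  shows "fin_dim (supported S :: ('b \<Rightarrow> 'a::field) set)" "fv.dim (supported S :: ('b \<Rightarrow> 'a) set) = card S"
proof -
  have sp: "supported S \<subseteq> fv.span (delta ` S :: ('b \<Rightarrow> 'a) set)"
  proof
    fix f :: "'b \<Rightarrow> 'a" assume "f \<in> supported S"
    then have "f = (\<Sum>s\<in>S. fscale (f s) (delta s))"
      using assms by (intro supported_eq_sum)
    also have "\<dots> \<in> fv.span (delta ` S)"
      by (intro fv.span_sum fv.span_scale fv.span_base) auto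
    finally show "f \<in> fv.span (delta ` S)" .
  qed
  then show fd: "fin_dim (supported S :: ('b \<Rightarrow> 'a) set)"
    using assms unfolding fin_dim_def by (intro exI[of _ "delta ` S"]) auto
  have "fv.dim (supported S :: ('b \<Rightarrow> 'a) set) \<le> card (delta ` S :: ('b \<Rightarrow> 'a) set)"
    using sp assms by (intro fv.dim_le_card) auto
  moreover have "card (delta ` S :: ('b \<Rightarrow> 'a) set) \<le> card S"
    using assms by (rule card_image_le)
  moreover have "card S \<le> fv.dim (supported S :: ('b \<Rightarrow> 'a) set)"
    by (rule indep_family_card_le[OF fd assms indep_family_delta[OF assms]])
      (auto simp: supported_def delta_def)
  ultimately show "fv.dim (supported S :: ('b \<Rightarrow> 'a) set) = card S" by linarith
qed

section \<open>The dimension of the Lie module\<close>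

lemma lie_fun_add: "lie_fun n (\<lambda>x. X x + Y x) = lie_fun n X + lie_fun n Y"
  by (auto simp: lie_fun_def eval_bracket_add)

lemma lie_fun_scale: "lie_fun n (\<lambda>x. c * X x) = fscale c (lie_fun n X)"
  by (auto simp: lie_fun_def eval_bracket_scale fscale_def)

lemma subspace_Lie:
  assumes n: "1 \<le> n"
  shows "fv.subspace (Lie n :: ((nat \<Rightarrow> nat) \<Rightarrow> 'a::field) set)"
proof (rule fv.subspaceI)
  have "lie_fun n (\<lambda>_. 0) = (0 :: _ \<Rightarrow> 'a)" by (auto simp: lie_fun_def eval_bracket_zero)
  then show "0 \<in> (Lie n :: ((nat \<Rightarrow> nat) \<Rightarrow> 'a) set)" unfolding Lie_eq[OF n] by (metis rangeI)
  show "x + y \<in> Lie n" if "x \<in> Lie n" "y \<in> Lie n" for x y :: "(nat \<Rightarrow> nat) \<Rightarrow> 'a"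
    using that unfolding Lie_eq[OF n] by (auto simp: lie_fun_add[symmetric] simp del: plus_fun_apply)
  show "fscale c x \<in> Lie n" if "x \<in> Lie n" for c and x :: "(nat \<Rightarrow> nat) \<Rightarrow> 'a"
    using that unfolding Lie_eq[OF n] by (auto simp: lie_fun_scale[symmetric])
qed

lemma Lie_supported: "1 \<le> n \<Longrightarrow> Lie n \<subseteq> supported (Sym n)"
  unfolding Lie_eq by (auto simp: supported_def lie_fun_def)

lemma fin_dim_Lie: "1 \<le> n \<Longrightarrow> fin_dim (Lie n)"
  using fin_dim_subset[OF dim_supported(1)[OF finite_Sym] Lie_supported] .

lemma mset_word_iff: "mset x = mset [1..<Suc n] \<longleftrightarrow> x \<in> permutations_of_set {1..n}"
proof -
  have "mset x = mset [1..<Suc n] \<longleftrightarrow> mset x = mset_set {1..n}"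
    by (simp only: mset_upt atLeastLessThanSuc_atLeastAtMost)
  also have "\<dots> \<longleftrightarrow> x \<in> permutations_of_set {1..n}"
    using permutations_of_set_altdef[of "{1..n}"] by (simp add: permutations_of_multiset_def)
  finally show ?thesis .
qed

lemma mset_word: "\<sigma> \<in> Sym n \<Longrightarrow> mset (word n \<sigma>) = mset [1..<Suc n]"
  unfolding mset_word_iff by (rule word_in_Sym_distinct)

lemma word_obtain:
  assumes "mset x = mset [1..<Suc n]"
  obtains \<sigma> where "\<sigma> \<in> Sym n" "word n \<sigma> = x"
proof -
  have "x \<in> word n ` Sym n"
    using assms bij_betw_imp_surj_on[OF bij_betw_word[of n]] unfolding mset_word_iff by simp
  then show thesis using that by blast
qed

lemma permutes_fixing_1:
  fixes n :: nat
  assumes "1 \<le> n"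
  shows "\<rho> permutes {1..n} \<and> \<rho> 1 = 1 \<longleftrightarrow> \<rho> permutes {2..n}"
proof
  assume \<rho>: "\<rho> permutes {2..n}"
  then have "\<rho> 1 = 1" by (rule permutes_not_in) simp
  moreover have "\<rho> permutes {1..n}" using \<rho> by (rule permutes_subset) simp
  ultimately show "\<rho> permutes {1..n} \<and> \<rho> 1 = 1" by blast
next
  assume "\<rho> permutes {1..n} \<and> \<rho> 1 = 1"
  then have \<rho>: "\<rho> permutes {1..n}" "\<rho> 1 = 1" by blast+
  have "\<rho> x = x" if "x \<in> {1..n} - {2..n}" for x
  proof -
    from that have "x = 1" by auto
    then show ?thesis using \<rho>(2) by simp
  qed
  then show "\<rho> permutes {2..n}"
    by (intro permutes_superset[OF \<rho>(1)] ballI)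
qed

lemma word_fix_1:
  assumes "1 \<le> n" "\<rho> 1 = 1"
  shows "word n \<rho> = 1 # map \<rho> [2..<Suc n]"
proof -
  have "[1..<Suc n] = 1 # [2..<Suc n]"
    using assms(1) by (simp add: upt_conv_Cons numeral_2_eq_2)
  then show ?thesis using assms(2) by (simp add: word_def)
qed

text \<open>
  Brackets that begin with the letter \<open>1\<close> span the multilinear brackets.
\<close>

lemma lie_fun_eq_0:
  assumes n: "1 \<le> n" and "\<And>\<sigma>. \<sigma> \<in> Sym n \<Longrightarrow> \<sigma> 1 = 1 \<Longrightarrow> lie_fun n X \<sigma> = 0"
  shows "lie_fun n X \<rho> = 0"
proof (cases "\<rho> \<in> Sym n")
  case True
  have "set (word n \<rho>) = {1..n}"
    using word_in_Sym_distinct[OF True] by (simp add: permutations_of_set_def)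
  then have "1 \<in> set (word n \<rho>)" using n by simp
  then obtain us vs where us: "word n \<rho> = us @ 1 # vs" by (metis split_list)
  have "eval_bracket X (us @ 1 # vs) = 0"
  proof (rule eval_bracket_determined_by_first)
    fix v assume "mset v = mset us + mset vs"
    then have "mset (1 # v) = mset [1..<Suc n]" using mset_word[OF True] unfolding us by simp
    then obtain \<sigma> where \<sigma>: "\<sigma> \<in> Sym n" "word n \<sigma> = 1 # v" by (rule word_obtain)
    have "hd (word n \<sigma>) = \<sigma> 1" using n by (simp add: word_def upt_conv_Cons)
    then have "\<sigma> 1 = 1" unfolding \<sigma>(2) by simp
    then have "lie_fun n X \<sigma> = 0" by (rule assms(2)[OF \<sigma>(1)])
    then show "eval_bracket X (1 # v) = 0" using \<sigma> unfolding lie_fun_def by simp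
  qed
  then show ?thesis using us True unfolding lie_fun_def by simp
qed (simp add: lie_fun_def)

lemma lie_fun_first:
  assumes "1 \<le> n" "\<rho> \<in> Sym n" "\<rho> 1 = 1" "\<And>x. hd x \<noteq> 1 \<Longrightarrow> X x = 0"
  shows "lie_fun n X \<rho> = X (word n \<rho>)"
proof -
  have "distinct (word n \<rho>)"
    using word_in_Sym_distinct[OF assms(2)] by (simp add: permutations_of_set_def)
  then have "1 \<notin> set (map \<rho> [2..<Suc n])"
    unfolding word_fix_1[of n \<rho>, OF assms(1,3)] by simp
  then have "eval_bracket X (1 # map \<rho> [2..<Suc n]) = X (1 # map \<rho> [2..<Suc n])"
    by (rule eval_bracket_leading) (rule assms(4))
  then show ?thesis
    unfolding lie_fun_def word_fix_1[of n \<rho>, OF assms(1,3)] using assms(2) by simp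
qed

text \<open>
  Restriction to the permutations with \<open>\<rho> 1 = 1\<close> is injective by \<open>lie_fun_eq_0\<close>. It is surjective because, on a functional
  that lives on words beginning with \<open>1\<close>, a bracket takes the value of its leading word.
\<close>

lemma dim_Lie:
  assumes n: "1 \<le> n"
  shows "fv.dim (Lie n :: ((nat \<Rightarrow> nat) \<Rightarrow> 'a::field) set) = fact (n - 1)"
proof -
  let ?L = "Lie n :: ((nat \<Rightarrow> nat) \<Rightarrow> 'a) set"
  define S where "S = {\<rho> \<in> Sym n. \<rho> 1 = 1}"
  define \<phi> where "\<phi> w = (\<lambda>\<rho>. if \<rho> \<in> S then w \<rho> else 0)" for w :: "(nat \<Rightarrow> nat) \<Rightarrow> 'a"
  have lin: "lin_on ?L \<phi>"
    unfolding lin_on_def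
  proof (intro conjI ballI allI ext)
    fix x y \<rho> show "\<phi> (x + y) \<rho> = (\<phi> x + \<phi> y) \<rho>" by (simp add: \<phi>_def)
  next
    fix c x \<rho> show "\<phi> (fscale c x) \<rho> = fscale c (\<phi> x) \<rho>" by (simp add: \<phi>_def fscale_def)
  qed
  have inj: "w = 0" if w: "w \<in> ?L" "\<phi> w = 0" for w
  proof
    fix \<rho>
    obtain X where X: "w = lie_fun n X" using w(1) unfolding Lie_eq[OF n] by blast
    have "lie_fun n X \<rho> = 0"
    proof (rule lie_fun_eq_0[OF n])
      fix \<sigma> assume "\<sigma> \<in> Sym n" "\<sigma> 1 = 1"
      then have "\<phi> w \<sigma> = w \<sigma>" by (simp add: \<phi>_def S_def)
      then show "lie_fun n X \<sigma> = 0" using w(2) X by simp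
    qed
    then show "w \<rho> = 0 \<rho>" unfolding X by simp
  qed
  have "f \<in> \<phi> ` ?L" if f: "f \<in> supported S" for f
  proof -
    define X where "X x = (if hd x = 1 then f (the_inv_into (Sym n) (word n) x) else 0)" for x
    have "\<phi> (lie_fun n X) \<rho> = f \<rho>" for \<rho>
    proof (cases "\<rho> \<in> S")
      case True
      then have \<rho>: "\<rho> \<in> Sym n" "\<rho> 1 = 1" unfolding S_def by blast+
      have "lie_fun n X \<rho> = X (word n \<rho>)"
        by (rule lie_fun_first[OF n \<rho>]) (simp add: X_def)
      also have "\<dots> = f (the_inv_into (Sym n) (word n) (word n \<rho>))"
        unfolding X_def using word_fix_1[of n \<rho>, OF n \<rho>(2)] by simp
      also have "\<dots> = f \<rho>"
        using the_inv_into_f_f[OF bij_betw_imp_inj_on[OF bij_betw_word] \<rho>(1)] by simp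
      finally show ?thesis using True by (simp add: \<phi>_def)
    next
      case False
      then show ?thesis using f by (simp add: \<phi>_def supported_def)
    qed
    then have "f = \<phi> (lie_fun n X)" by (intro ext) simp
    then show ?thesis unfolding Lie_eq[OF n] by blast
  qed
  moreover have "\<phi> ` ?L \<subseteq> supported S" by (auto simp: \<phi>_def supported_def)
  ultimately have "\<phi> ` ?L = supported S" by blast
  then have "fv.dim ?L = fv.dim (supported S :: ((nat \<Rightarrow> nat) \<Rightarrow> 'a) set)"
    using dim_image_inj[OF subspace_Lie[OF n] fin_dim_Lie[OF n] lin inj] by simp
  also have "\<dots> = card S" by (rule dim_supported) (simp add: S_def finite_Sym)
  also have "S = {\<rho>. \<rho> permutes {2..n}}"
    unfolding S_def Sym_iff permutes_fixing_1[OF n] ..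
  also have "card \<dots> = fact (n - 1)"
    using card_permutations[of "{2..n}" "n - 1"] by simp
  finally show ?thesis .
qed

section \<open>Modules for p-groups in characteristic p\<close>

text \<open>
  Both uses are counting arguments: first for the translates by multiples of one vector, then for the nontrivial
  orbits of a \<open>p\<close>-group.
\<close>

lemma dvd_card_classes:
  assumes "finite M" and cl: "\<And>x. x \<in> M \<Longrightarrow> x \<in> cl x \<and> cl x \<subseteq> M \<and> p dvd card (cl x)"
    and eq: "\<And>x z. x \<in> M \<Longrightarrow> z \<in> cl x \<Longrightarrow> cl z = cl x"
  shows "p dvd card M"
proof -
  have M: "M = \<Union>(cl ` M)" using cl by blast
  have "p dvd card (\<Union>(cl ` M))"
  proof (rule dvd_partition)
    show "finite (\<Union>(cl ` M))" using assms(1) M by simp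
    show "\<forall>c\<in>cl ` M. p dvd card c" using cl by blast
    show "\<forall>c1\<in>cl ` M. \<forall>c2\<in>cl ` M. c1 \<noteq> c2 \<longrightarrow> c1 \<inter> c2 = {}" using eq by blast
  qed
  then show ?thesis using M by simp
qed

locale p_group = perm_group +
  fixes p :: nat
  assumes prime_p: "prime p"
    and card_G: "\<exists>e. card G = p ^ e"

locale pmodule = p_group G p for G p +
  fixes act :: "('b \<Rightarrow> 'a::field) \<Rightarrow> (nat \<Rightarrow> nat) \<Rightarrow> 'b \<Rightarrow> 'a"
    and V :: "('b \<Rightarrow> 'a) set"
  assumes char_p: "CHAR('a) = p"
    and sub: "fv.subspace V"
    and fin: "fin_dim V"
    and act_lin: "g \<in> G \<Longrightarrow> lin_on V (\<lambda>x. act x g)"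
    and act_in: "g \<in> G \<Longrightarrow> x \<in> V \<Longrightarrow> act x g \<in> V"
    and act_id: "x \<in> V \<Longrightarrow> act x id = x"
    and act_comp: "x \<in> V \<Longrightarrow> g \<in> G \<Longrightarrow> h \<in> G \<Longrightarrow> act (act x g) h = act x (h \<circ> g)"
begin

lemma act_add: "g \<in> G \<Longrightarrow> x \<in> V \<Longrightarrow> y \<in> V \<Longrightarrow> act (x + y) g = act x g + act y g"
  using act_lin unfolding lin_on_def by blast

lemma act_scale: "g \<in> G \<Longrightarrow> x \<in> V \<Longrightarrow> act (fscale c x) g = fscale c (act x g)"
  using act_lin unfolding lin_on_def by blast

lemma act_0: "g \<in> G \<Longrightarrow> act 0 g = 0"
  using lin_on_0[OF sub act_lin] .

lemma act_sum:
  assumes "g \<in> G" "\<And>i. i \<in> I \<Longrightarrow> v i \<in> V"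
  shows "act (\<Sum>i\<in>I. fscale (c i) (v i)) g = (\<Sum>i\<in>I. fscale (c i) (act (v i) g))"
  by (rule lin_on_sum[OF sub act_lin[OF assms(1)] assms(2)])

lemma sum_in: "(\<And>i. i \<in> I \<Longrightarrow> v i \<in> V) \<Longrightarrow> (\<Sum>i\<in>I. fscale (c i) (v i)) \<in> V"
  by (intro fv.subspace_sum[OF sub] fv.subspace_scale[OF sub])

lemma submodule: "fg_submodule G act A \<Longrightarrow> A \<subseteq> V \<Longrightarrow> pmodule G p act A"
  using fin_dim_subset[OF fin, of A] act_lin char_p act_id act_comp
  by unfold_locales (auto simp: fg_submodule_def lin_on_def subset_iff)

lemma fg_submodule_self: "fg_submodule G act V"
  using sub act_in by (simp add: fg_submodule_def)

lemma bij_left: "h \<in> G \<Longrightarrow> bij_betw (\<lambda>g. h \<circ> g) G G"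
  by (rule bij_betw_byWitness[where f' = "\<lambda>g. inv' h \<circ> g"])
    (auto simp: comp_assoc[symmetric] comp_inv comp_in inv_in)

text \<open>
  The fibres of \<open>g \<mapsto> x g\<close> are cosets of the stabilizer of \<open>x\<close> and so have the same size.
\<close>

lemma card_orbit_dvd:
  assumes "x \<in> V"
  shows "card ((\<lambda>g. act x g) ` G) dvd card G"
proof -
  define S where "S = {g \<in> G. act x g = x}"
  have fib: "card {g \<in> G. act x g = y} = card S" if "y \<in> (\<lambda>g. act x g) ` G" for y
  proof -
    from that obtain h where h: "h \<in> G" "y = act x h" by blast
    have "bij_betw (\<lambda>g. h \<circ> g) S {g \<in> G. act x g = y}"
    proof (rule bij_betw_byWitness[where f' = "\<lambda>g. inv' h \<circ> g"])
      show "(\<lambda>g. h \<circ> g) ` S \<subseteq> {g \<in> G. act x g = y}"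
        using h assms by (auto simp: S_def comp_in act_comp[symmetric])
      show "(\<lambda>g. inv' h \<circ> g) ` {g \<in> G. act x g = y} \<subseteq> S"
      proof clarify
        fix g assume "g \<in> G" "y = act x g"
        then have "act x (inv' h \<circ> g) = act (act x h) (inv' h)"
          using h assms by (simp add: act_comp[symmetric] inv_in)
        also have "\<dots> = x"
          using h assms by (simp add: act_comp inv_in comp_inv act_id)
        finally show "inv' h \<circ> g \<in> S"
          using h \<open>g \<in> G\<close> by (simp add: S_def comp_in inv_in)
      qed
    qed (use h in \<open>auto simp: comp_assoc[symmetric] comp_inv\<close>)
    then show ?thesis by (simp add: bij_betw_same_card)
  qed
  have "card G = (\<Sum>y\<in>(\<lambda>g. act x g) ` G. card {g \<in> G. act x g = y})"
    using sum.image_gen[OF finite_G, of "\<lambda>_. 1 :: nat" "\<lambda>g. act x g"] by simp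
  also have "\<dots> = card ((\<lambda>g. act x g) ` G) * card S"
    using fib by simp
  finally show ?thesis by simp
qed

lemma of_nat_mod: "(of_nat (n mod p) :: 'a) = of_nat n"
  by (simp add: of_nat_eq_iff_cong_CHAR char_p)

text \<open>
  The combinations of the orbit of a nonzero vector with coefficients in the prime field form a finite set. Its size is divisible by
  \<open>p\<close>, and so is the number of its elements that are not fixed; the fixed vector \<open>0\<close> cannot be the only one.
\<close>

lemma exists_fixed_vector:
  assumes "V \<noteq> {0}"
  shows "\<exists>x\<in>V. x \<noteq> 0 \<and> (\<forall>g\<in>G. act x g = x)"
proof -
  obtain v where v: "v \<in> V" "v \<noteq> 0"
    using assms fv.subspace_0[OF sub] by auto
  define F where "F n = (\<Sum>g\<in>G. fscale (of_nat (n g)) (act v g))" for n :: "(nat \<Rightarrow> nat) \<Rightarrow> nat"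
  define M where "M = range F"
  have MV: "M \<subseteq> V"
    unfolding M_def F_def using act_in v by (auto intro!: sum_in)
  have "M \<subseteq> F ` (PiE G (\<lambda>_. {..<p}))"
  proof
    fix x assume "x \<in> M"
    then obtain n where n: "x = F n" by (auto simp: M_def)
    have "F n = F (restrict (\<lambda>g. n g mod p) G)"
      unfolding F_def by (intro sum.cong) (simp_all add: of_nat_mod)
    moreover have "restrict (\<lambda>g. n g mod p) G \<in> PiE G (\<lambda>_. {..<p})"
      using prime_gt_0_nat[OF prime_p] by auto
    ultimately show "x \<in> F ` (PiE G (\<lambda>_. {..<p}))" using n by blast
  qed
  then have finM: "finite M"
    by (rule finite_subset) (auto intro!: finite_PiE finite_G)
  have F_add: "F m + F n = F (\<lambda>g. m g + n g)" for m n
    unfolding F_def by (simp add: sum.distrib[symmetric] fv.scale_left_distrib[symmetric])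
  have v_mult: "F (\<lambda>g. if g = id then i else 0) = fscale (of_nat i) v" for i
  proof -
    have "F (\<lambda>g. if g = id then i else 0) = (\<Sum>g\<in>G. if g = id then fscale (of_nat i) (act v g) else 0)"
      unfolding F_def by (intro sum.cong) (auto simp: fscale_def fun_eq_iff)
    then show ?thesis using finite_G id_in act_id[OF v(1)] by (simp add: sum.delta)
  qed
  have trans_M: "x + fscale (of_nat i) v \<in> M" if "x \<in> M" for x i
    using that F_add v_mult[of i, symmetric] by (auto simp: M_def)
  have act_M: "act x h \<in> M" if "x \<in> M" "h \<in> G" for x h
  proof -
    from that(1) obtain n where n: "x = F n" by (auto simp: M_def)
    have "act x h = (\<Sum>g\<in>G. fscale (of_nat (n g)) (act v (h \<circ> g)))"
      unfolding n F_def using that(2) v act_in by (subst act_sum) (auto simp: act_comp)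
    also have "\<dots> = F (\<lambda>g. n (inv' h \<circ> g))"
      using sum.reindex_bij_betw[OF bij_left[OF that(2)], of "\<lambda>g. fscale (of_nat (n (inv' h \<circ> g))) (act v g)"] that(2)
      by (simp add: F_def comp_assoc[symmetric] comp_inv)
    finally show ?thesis by (simp add: M_def)
  qed
  have p0: "p > 0" using prime_gt_0_nat[OF prime_p] .
  \<comment> \<open>Translation by the multiples of \<open>v\<close> splits \<open>M\<close> into classes of size \<open>p\<close>.\<close>
  have "p dvd card M"
  proof -
    define cl where "cl x = (\<lambda>i. x + fscale (of_nat i) v) ` {..<p}" for x
    have card_cl: "card (cl x) = p" for x
    proof -
      have "inj_on (\<lambda>i. x + fscale (of_nat i) v) {..<p}"
        using v by (intro inj_onI)
          (auto simp: fv.scale_cancel_right of_nat_eq_iff_cong_CHAR char_p cong_def)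
      then show ?thesis unfolding cl_def by (simp add: card_image)
    qed
    have cl_eq: "cl x = range (\<lambda>i. x + fscale (of_nat i) v)" for x
    proof -
      have "x + fscale (of_nat i) v \<in> cl x" for i
        unfolding cl_def using p0 of_nat_mod[of i] by (intro image_eqI[of _ _ "i mod p"]) auto
      then show ?thesis unfolding cl_def by auto
    qed
    have step: "cl (x + fscale (of_nat i) v) \<subseteq> cl x" for x i
      unfolding cl_eq by (auto simp: add.assoc fv.scale_left_distrib[symmetric] simp flip: of_nat_add)
    have undo: "x = (x + fscale (of_nat i) v) + fscale (of_nat ((p - 1) * i)) v" for x i
    proof -
      have "(of_nat (i + (p - 1) * i) :: 'a) = of_nat (p * i)"
        using p0 by (metis add.commute mult.commute mult_Suc Suc_diff_1)
      also have "\<dots> = 0" using of_nat_mod[of "p * i"] by simp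
      finally have "x + fscale (of_nat (i + (p - 1) * i)) v = x" by simp
      then show ?thesis
        by (simp only: add.assoc fv.scale_left_distrib[symmetric] of_nat_add[symmetric])
    qed
    show ?thesis
    proof (rule dvd_card_classes[OF finM])
      fix x assume x: "x \<in> M"
      have "x \<in> cl x" unfolding cl_eq by (intro image_eqI[of _ _ 0]) auto
      moreover have "cl x \<subseteq> M" using trans_M[OF x] by (auto simp: cl_def)
      ultimately show "x \<in> cl x \<and> cl x \<subseteq> M \<and> p dvd card (cl x)" using card_cl by simp
    next
      fix x z assume "z \<in> cl x"
      then obtain i where i: "z = x + fscale (of_nat i) v" by (auto simp: cl_eq)
      have "cl x \<subseteq> cl z"
        using step[of z "(p - 1) * i"] unfolding i undo[of x i, symmetric] .
      then show "cl z = cl x" using step[of x i] i by blast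
    qed
  qed
  moreover define Fix where "Fix = {x \<in> M. \<forall>g\<in>G. act x g = x}"
  have "p dvd card (M - Fix)"
  proof -
    define ob where "ob x = (\<lambda>g. act x g) ` G" for x
    have self: "x \<in> ob x" if "x \<in> V" for x
      unfolding ob_def using id_in act_id[OF that] by force
    have step: "ob (act x g) \<subseteq> ob x" if "x \<in> V" "g \<in> G" for x g
      unfolding ob_def using that comp_in by (auto simp: act_comp)
    have undo: "act (act x g) (inv' g) = x" if "x \<in> V" "g \<in> G" for x g
      using that by (simp add: act_comp inv_in comp_inv act_id)
    have ob_eq: "ob z = ob x" if "x \<in> V" "z \<in> ob x" for x z
    proof -
      from that(2) obtain g where g: "g \<in> G" "z = act x g" by (auto simp: ob_def)
      have "ob x \<subseteq> ob z"
        using step[of z "inv' g"] undo[of x g] g that act_in inv_in by simp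
      then show ?thesis using step[of x g] g that by blast
    qed
    have sub_ob: "ob x \<subseteq> M - Fix" if "x \<in> M - Fix" for x
    proof
      fix z assume z: "z \<in> ob x"
      have xV: "x \<in> V" using that MV by blast
      have "z \<in> M" using z that act_M by (auto simp: ob_def)
      moreover have "z \<notin> Fix"
      proof
        assume "z \<in> Fix"
        then have "ob z = {z}" using id_in by (auto simp: Fix_def ob_def)
        then have "x = z" using ob_eq[OF xV z] self[OF xV] by simp
        then show False using that \<open>z \<in> Fix\<close> by simp
      qed
      ultimately show "z \<in> M - Fix" by simp
    qed
    show ?thesis
    proof (rule dvd_card_classes)
      show "finite (M - Fix)" using finM by simp
      fix x assume x: "x \<in> M - Fix"
      then have xV: "x \<in> V" using MV by blast
      show "ob z = ob x" if "z \<in> ob x" for z by (rule ob_eq[OF xV that])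
      obtain e where e: "card G = p ^ e" using card_G by blast
      obtain i where i: "i \<le> e" "card (ob x) = p ^ i"
        using card_orbit_dvd[OF xV] divides_primepow_nat[OF prime_p, of "card (ob x)" e]
        unfolding ob_def e by auto
      have "i \<noteq> 0"
      proof
        assume "i = 0"
        then have "card (ob x) = 1" using i by simp
        then have "ob x = {x}" using self[OF xV] by (auto simp: card_1_singleton_iff)
        then have "x \<in> Fix" using x by (auto simp: Fix_def ob_def)
        with x show False by simp
      qed
      then show "x \<in> ob x \<and> ob x \<subseteq> M - Fix \<and> p dvd card (ob x)"
        using i self[OF xV] sub_ob[OF x] by simp
    qed
  qed
  moreover have "card M = card Fix + card (M - Fix)"
  proof -
    have "Fix \<subseteq> M" by (auto simp: Fix_def)
    then show ?thesis
      using finM card_Diff_subset[of Fix M] card_mono[of M Fix] finite_subset[of Fix M] by simp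
  qed
  ultimately have "p dvd card Fix"
    using dvd_add_left_iff[of p "card (M - Fix)" "card Fix"] by simp
  moreover have "0 \<in> Fix"
  proof -
    have "F (\<lambda>g. 0) = 0" unfolding F_def by simp
    then have "0 \<in> M" unfolding M_def by (metis rangeI)
    then show ?thesis using act_0 by (simp add: Fix_def)
  qed
  ultimately have "card Fix \<noteq> 1" using prime_p by auto
  then have "Fix \<noteq> {0}" by auto
  then show ?thesis using \<open>0 \<in> Fix\<close> MV unfolding Fix_def by blast
qed

end

section \<open>Splitting off free summands\<close>

text \<open>
  The action of the sum of all group elements.
\<close>

definition norm_map :: "(nat \<Rightarrow> nat) set \<Rightarrow> (('b \<Rightarrow> 'a::field) \<Rightarrow> (nat \<Rightarrow> nat) \<Rightarrow> ('b \<Rightarrow> 'a)) \<Rightarrow> ('b \<Rightarrow> 'a) \<Rightarrow> 'b \<Rightarrow> 'a" where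
  "norm_map G act x = (\<Sum>g\<in>G. act x g)"

lemma free_module_eq: "free_module G n = supported ({..<n} \<times> G)"
  by (auto simp: free_module_def supported_def)

context perm_group
begin

lemma free_act_apply:
  "g \<in> G \<Longrightarrow> free_act G f g (i, \<rho>) = (if \<rho> \<in> G then f (i, inv' g \<circ> \<rho>) else 0)"
  by (simp add: free_act_def ga_mult_of_right)

lemma inv_comp: "g \<in> G \<Longrightarrow> h \<in> G \<Longrightarrow> inv' (h \<circ> g) = inv' g \<circ> inv' h"
  by (simp add: o_inv_distrib bij_in)

end

lemma (in p_group) pmodule_free:
  assumes "CHAR('a::field) = p"
  shows "pmodule G p (free_act G) (free_module G n :: (nat \<times> (nat \<Rightarrow> nat) \<Rightarrow> 'a) set)"
proof
  show "fv.subspace (free_module G n :: (nat \<times> (nat \<Rightarrow> nat) \<Rightarrow> 'a) set)"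
    unfolding free_module_eq by (rule subspace_supported)
  show "fin_dim (free_module G n :: (nat \<times> (nat \<Rightarrow> nat) \<Rightarrow> 'a) set)"
    unfolding free_module_eq using finite_G by (intro dim_supported) auto
  fix g assume g: "g \<in> G"
  show "lin_on (free_module G n :: (nat \<times> (nat \<Rightarrow> nat) \<Rightarrow> 'a) set) (\<lambda>x. free_act G x g)"
    using g by (auto simp: lin_on_def fun_eq_iff free_act_apply fscale_def)
  fix x :: "nat \<times> (nat \<Rightarrow> nat) \<Rightarrow> 'a" assume x: "x \<in> free_module G n"
  show "free_act G x g \<in> free_module G n"
    using g x by (auto simp: free_module_def free_act_apply)
  show "free_act G (free_act G x g) h = free_act G x (h \<circ> g)" if "h \<in> G" for h
    using g that
    by (auto simp: fun_eq_iff free_act_apply comp_in comp_inv_left_iff inv_comp comp_assoc)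
next
  fix x :: "nat \<times> (nat \<Rightarrow> nat) \<Rightarrow> 'a" assume x: "x \<in> free_module G n"
  show "free_act G x id = x"
    using x by (auto simp: fun_eq_iff free_act_apply id_in free_module_def)
qed (rule assms)

context pmodule
begin

abbreviation nm where "nm \<equiv> norm_map G act"

lemma nm_eq: "nm x = (\<Sum>g\<in>G. fscale 1 (act x g))"
  by (simp add: norm_map_def)

lemma nm_in: "x \<in> V \<Longrightarrow> nm x \<in> V"
  unfolding nm_eq by (rule sum_in) (rule act_in)

lemma lin_on_nm: "lin_on V nm"
  unfolding lin_on_def norm_map_def
  by (auto simp: act_add act_scale sum.distrib fv.scale_sum_right)

lemma fin_dim_nm: "fin_dim (nm ` V)" "fv.subspace (nm ` V)"
  using fin_dim_image[OF sub fin lin_on_nm] subspace_image_lin_on[OF sub lin_on_nm] by auto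

text \<open>
  The vectors \<open>v i\<close> define a map \<open>\<psi>\<close> from a free module to \<open>V\<close>, and the functionals \<open>lam i\<close> define a map \<open>\<phi>\<close> back. The
  kernel of \<open>\<phi> \<circ> \<psi>\<close> contains no nonzero fixed vector: such a vector has coefficients that are constant along the
  group, and the functionals read them off from the norms. So the kernel is zero, \<open>\<phi> \<circ> \<psi>\<close> is bijective by a count of
  dimensions, and the image of \<open>\<psi>\<close> is complemented by the kernel of \<open>\<phi>\<close>.
\<close>

lemma free_summand:
  fixes v :: "nat \<Rightarrow> 'b \<Rightarrow> 'a" and lam :: "nat \<Rightarrow> ('b \<Rightarrow> 'a) \<Rightarrow> 'a"
  assumes v: "\<And>i. i < r \<Longrightarrow> v i \<in> V"
    and lam_add: "\<And>i x y. lam i (x + y) = lam i x + lam i y"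
    and lam_scale: "\<And>i c x. lam i (fscale c x) = c * lam i x"
    and dual: "\<And>i j. i < r \<Longrightarrow> j < r \<Longrightarrow> lam i (nm (v j)) = (if i = j then 1 else 0)"
  obtains A B where "fg_direct_sum G act V A B" "fg_iso G act A (free_act G) (free_module G r)"
    "fv.dim A = r * card G" "\<And>x i. x \<in> B \<Longrightarrow> i < r \<Longrightarrow> lam i x = 0"
proof -
  let ?F = "free_module G r :: (nat \<times> (nat \<Rightarrow> nat) \<Rightarrow> 'a) set"
  let ?I = "{..<r} \<times> G"
  interpret F: pmodule G p "free_act G" ?F
    by (rule pmodule_free) (rule char_p)
  have finI: "finite ?I" using finite_G by simp
  have lam_0: "lam i 0 = 0" for i using lam_scale[of i 0 0] by simp
  have lam_sum: "lam i (\<Sum>j\<in>J. f j) = (\<Sum>j\<in>J. lam i (f j))" for i and f :: "nat \<Rightarrow> 'b \<Rightarrow> 'a" and J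
    by (induction J rule: infinite_finite_induct) (auto simp: lam_0 lam_add simp del: plus_fun_apply zero_fun_apply)
  define \<phi> where "\<phi> x = (\<lambda>(i, g). if i < r \<and> g \<in> G then lam i (act x (inv' g)) else 0)" for x
  define \<psi> where "\<psi> c = (\<Sum>k\<in>?I. fscale (c k) (act (v (fst k)) (snd k)))" for c
  have \<phi>_lin: "lin_on V \<phi>"
    unfolding lin_on_def
  proof (intro conjI ballI allI)
    fix x y assume "x \<in> V" "y \<in> V"
    then show "\<phi> (x + y) = \<phi> x + \<phi> y"
      by (intro ext) (simp add: \<phi>_def act_add inv_in lam_add split: prod.split)
  next
    fix a x assume "x \<in> V"
    then have "\<phi> (fscale a x) k = a * \<phi> x k" for k
      by (cases k) (simp add: \<phi>_def act_scale inv_in lam_scale)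
    then show "\<phi> (fscale a x) = fscale a (\<phi> x)"
      by (simp add: fun_eq_iff fscale_def)
  qed
  have \<phi>_in: "\<phi> x \<in> ?F" for x
    by (auto simp: \<phi>_def free_module_def)
  have \<phi>_eq: "\<phi> (act x h) = free_act G (\<phi> x) h" if "x \<in> V" "h \<in> G" for x h
  proof (rule ext, clarify)
    fix i g show "\<phi> (act x h) (i, g) = free_act G (\<phi> x) h (i, g)"
      using that by (auto simp: \<phi>_def free_act_apply act_comp inv_in comp_inv_left_iff inv_comp inv_inv_eq bij_in)
  qed
  have \<psi>_lin: "lin_on ?F \<psi>"
    unfolding lin_on_def
  proof (intro conjI ballI allI)
    fix x y :: "nat \<times> (nat \<Rightarrow> nat) \<Rightarrow> 'a"
    have "(x + y) k = x k + y k" for k by simp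
    then have "\<psi> (x + y) = (\<Sum>k\<in>?I. fscale (x k) (act (v (fst k)) (snd k)) + fscale (y k) (act (v (fst k)) (snd k)))"
      unfolding \<psi>_def fv.scale_left_distrib[symmetric] by metis
    then show "\<psi> (x + y) = \<psi> x + \<psi> y"
      unfolding \<psi>_def sum.distrib .
  next
    fix a and x :: "nat \<times> (nat \<Rightarrow> nat) \<Rightarrow> 'a"
    have "fscale a x k = a * x k" for k by (simp add: fscale_def)
    then show "\<psi> (fscale a x) = fscale a (\<psi> x)"
      unfolding \<psi>_def fv.scale_sum_right fv.scale_scale by metis
  qed
  have \<psi>_in: "\<psi> c \<in> V" for c
    unfolding \<psi>_def using v act_in by (intro sum_in) auto
  have \<psi>_eq: "\<psi> (free_act G c h) = act (\<psi> c) h" if "h \<in> G" for c h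
  proof -
    have bij: "bij_betw (\<lambda>k. (fst k, h \<circ> snd k)) ?I ?I"
      using bij_betw_apply[OF bij_left[OF that]] that
      by (intro bij_betw_byWitness[where f' = "\<lambda>k. (fst k, inv' h \<circ> snd k)"])
        (auto simp: comp_assoc[symmetric] comp_inv comp_in inv_in)
    have "act (\<psi> c) h = (\<Sum>k\<in>?I. fscale (c k) (act (v (fst k)) (h \<circ> snd k)))"
      unfolding \<psi>_def using v act_in that
      by (subst act_sum[OF that]) (auto simp: act_comp intro!: sum.cong)
    also have "\<dots> = (\<Sum>k\<in>?I. fscale (free_act G c h (fst k, h \<circ> snd k)) (act (v (fst k)) (h \<circ> snd k)))"
      using that by (intro sum.cong refl) (auto simp: free_act_apply comp_in comp_assoc[symmetric] comp_inv)
    also have "\<dots> = \<psi> (free_act G c h)"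
      unfolding \<psi>_def
      using sum.reindex_bij_betw[OF bij, of "\<lambda>k. fscale (free_act G c h k) (act (v (fst k)) (snd k))"] by simp
    finally show ?thesis by (rule sym)
  qed
  have \<chi>_lin: "lin_on ?F (\<lambda>c. \<phi> (\<psi> c))"
    using \<psi>_lin \<phi>_lin \<psi>_in unfolding lin_on_def by simp
  have inj: "c = 0" if c: "c \<in> ?F" "\<phi> (\<psi> c) = 0" for c
  proof (rule ccontr)
    assume "c \<noteq> 0"
    define K where "K = {c \<in> ?F. \<phi> (\<psi> c) = 0}"
    have "fv.subspace K" unfolding K_def by (rule subspace_kernel_lin_on[OF F.sub \<chi>_lin])
    moreover have "free_act G c g \<in> K" if "c \<in> K" "g \<in> G" for c g
      using that F.act_in F.act_0[OF that(2)] \<phi>_eq \<psi>_eq \<psi>_in by (simp add: K_def)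
    ultimately have "fg_submodule G (free_act G) K"
      by (simp add: fg_submodule_def)
    then interpret K: pmodule G p "free_act G" K
      by (rule F.submodule) (auto simp: K_def)
    have "K \<noteq> {0}" using c \<open>c \<noteq> 0\<close> by (auto simp: K_def)
    then obtain d where d: "d \<in> K" "d \<noteq> 0" "\<And>g. g \<in> G \<Longrightarrow> free_act G d g = d"
      using K.exists_fixed_vector by blast
    have const: "d (i, g) = d (i, id)" if "g \<in> G" for i g
    proof -
      have "d (i, g) = free_act G d g (i, g)" using d(3)[OF that] by simp
      also have "\<dots> = d (i, id)" using that by (simp add: free_act_apply comp_inv)
      finally show ?thesis .
    qed
    have "\<psi> d = (\<Sum>i<r. \<Sum>g\<in>G. fscale (d (i, g)) (act (v i) g))"
      unfolding \<psi>_def sum.cartesian_product by (simp add: case_prod_beta)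
    also have "\<dots> = (\<Sum>i<r. fscale (d (i, id)) (nm (v i)))"
      unfolding norm_map_def fv.scale_sum_right using const by (intro sum.cong) auto
    finally have \<psi>d: "\<psi> d = \<dots>" .
    have "d (j, id) = 0" if "j < r" for j
    proof -
      have "0 = \<phi> (\<psi> d) (j, id)" using d(1) by (simp add: K_def)
      also have "\<dots> = lam j (\<psi> d)"
        using that id_in act_id[OF \<psi>_in, of d] by (simp add: \<phi>_def)
      also have "\<dots> = (\<Sum>i<r. d (i, id) * (if j = i then 1 else 0))"
        unfolding \<psi>d lam_sum using that dual by (intro sum.cong) (auto simp: lam_scale)
      also have "\<dots> = d (j, id)" using that by (simp add: if_distrib sum.delta cong: if_cong)
      finally show ?thesis by simp
    qed
    then have "d (j, g) = 0" if "j < r" "g \<in> G" for j g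
      using const[OF that(2)] that(1) by simp
    moreover have "d (j, g) = 0" if "\<not> (j < r \<and> g \<in> G)" for j g
      using d(1) that unfolding K_def free_module_def by blast
    ultimately have "d = 0"
      by (metis ext surj_pair zero_fun_apply)
    with d(2) show False by simp
  qed
  have \<chi>_surj: "(\<lambda>c. \<phi> (\<psi> c)) ` ?F = ?F"
  proof (rule dim_eqI)
    show "fv.subspace ((\<lambda>c. \<phi> (\<psi> c)) ` ?F)" by (rule subspace_image_lin_on[OF F.sub \<chi>_lin])
    show "(\<lambda>c. \<phi> (\<psi> c)) ` ?F \<subseteq> ?F" using \<phi>_in by blast
    show "fin_dim ?F" by (rule F.fin)
    show "fv.dim ?F \<le> fv.dim ((\<lambda>c. \<phi> (\<psi> c)) ` ?F)"
      using dim_image_inj[OF F.sub F.fin \<chi>_lin inj] by simp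
  qed
  define A where "A = \<psi> ` ?F"
  define B where "B = {x \<in> V. \<phi> x = 0}"
  have subA: "fv.subspace A" unfolding A_def by (rule subspace_image_lin_on[OF F.sub \<psi>_lin])
  have subB: "fv.subspace B" unfolding B_def by (rule subspace_kernel_lin_on[OF sub \<phi>_lin])
  have AV: "A \<subseteq> V" using \<psi>_in by (auto simp: A_def)
  have AB: "A \<inter> B = {0}"
  proof -
    have "x = 0" if "x \<in> A" "x \<in> B" for x
      using that inj lin_on_0[OF F.sub \<psi>_lin] by (auto simp: A_def B_def)
    then show ?thesis using fv.subspace_0[OF subA] fv.subspace_0[OF subB] by blast
  qed
  have V: "V = {a + b | a b. a \<in> A \<and> b \<in> B}"
  proof -
    have "\<exists>a b. x = a + b \<and> a \<in> A \<and> b \<in> B" if x: "x \<in> V" for x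
    proof -
      obtain c where c: "c \<in> ?F" "\<phi> x = \<phi> (\<psi> c)"
        using \<chi>_surj \<phi>_in[of x] by (metis (no_types, lifting) imageE)
      have "\<phi> (x - \<psi> c) = 0"
        using lin_on_diff[OF sub \<phi>_lin x \<psi>_in, of c] c by simp
      then have "x - \<psi> c \<in> B" using x \<psi>_in fv.subspace_diff[OF sub] by (simp add: B_def)
      moreover have "\<psi> c \<in> A" using c by (simp add: A_def)
      moreover have "x = \<psi> c + (x - \<psi> c)" by simp
      ultimately show ?thesis by blast
    qed
    moreover have "a + b \<in> V" if "a \<in> A" "b \<in> B" for a b
      using that AV fv.subspace_add[OF sub, of a b] by (auto simp: B_def)
    ultimately show ?thesis by blast
  qed
  have "fg_submodule G act A"
    unfolding fg_submodule_def using subA \<psi>_eq[symmetric] F.act_in by (auto simp: A_def)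
  moreover have "fg_submodule G act B"
    unfolding fg_submodule_def using subB \<phi>_eq act_in F.act_0 by (auto simp: B_def)
  ultimately have ds: "fg_direct_sum G act V A B"
    using AB V by (simp add: fg_direct_sum_def)
  have iso: "fg_iso G act A (free_act G) ?F"
    unfolding fg_iso_def
  proof (intro exI[of _ \<phi>] conjI ballI allI)
    have "inj_on \<phi> A"
    proof (rule inj_onI)
      fix x y assume xy: "x \<in> A" "y \<in> A" "\<phi> x = \<phi> y"
      then have "\<phi> (x - y) = 0" using lin_on_diff[OF sub \<phi>_lin, of x y] AV by auto
      moreover have "x - y \<in> A" using xy fv.subspace_diff[OF subA] by blast
      ultimately have "x - y \<in> A \<inter> B" using AV by (auto simp: B_def)
      then show "x = y" using AB by auto
    qed
    moreover have "\<phi> ` A = ?F" using \<chi>_surj by (simp add: A_def image_image)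
    ultimately show "bij_betw \<phi> A ?F" by (simp add: bij_betw_def)
  qed (use AV \<phi>_lin \<phi>_eq in \<open>auto simp: lin_on_def subset_iff\<close>)
  have dim: "fv.dim A = r * card G"
  proof -
    have "fv.dim A = fv.dim ?F"
      unfolding A_def
      by (rule dim_image_inj[OF F.sub F.fin \<psi>_lin], rule inj, assumption)
        (use lin_on_0[OF sub \<phi>_lin] in simp)
    then show ?thesis using dim_supported(2)[OF finI] by (simp add: free_module_eq card_cartesian_product)
  qed
  have "lam i x = 0" if "x \<in> B" "i < r" for x i
  proof -
    have "\<phi> x (i, id) = 0" using that by (simp add: B_def)
    then show ?thesis using that id_in act_id[of x] by (simp add: \<phi>_def B_def)
  qed
  with ds iso dim that show thesis by blast
qed

end

section \<open>The dimension of the projective-free part\<close>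

lemma fg_iso_dims:
  assumes "pmodule G p act V" "pmodule G p act' W" "fg_iso G act V act' W"
  shows "fv.dim W = fv.dim V" "fv.dim (norm_map G act' ` W) = fv.dim (norm_map G act ` V)"
proof -
  interpret V: pmodule G p act V by (rule assms(1))
  interpret W: pmodule G p act' W by (rule assms(2))
  obtain \<phi> where \<phi>: "bij_betw \<phi> V W" "\<And>x y. x \<in> V \<Longrightarrow> y \<in> V \<Longrightarrow> \<phi> (x + y) = \<phi> x + \<phi> y"
    "\<And>c x. x \<in> V \<Longrightarrow> \<phi> (fscale c x) = fscale c (\<phi> x)"
    "\<And>g x. g \<in> G \<Longrightarrow> x \<in> V \<Longrightarrow> \<phi> (act x g) = act' (\<phi> x) g"
    using assms(3) unfolding fg_iso_def by metis
  have lin: "lin_on V \<phi>" using \<phi>(2,3) by (simp add: lin_on_def)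
  have inj: "x = 0" if "x \<in> V" "\<phi> x = 0" for x
  proof -
    have "\<phi> x = \<phi> 0" using that(2) lin_on_0[OF V.sub lin] by simp
    then show ?thesis
      using \<phi>(1) that(1) fv.subspace_0[OF V.sub] unfolding bij_betw_def inj_on_def by blast
  qed
  have W: "W = \<phi> ` V" using \<phi>(1) by (simp add: bij_betw_def)
  show "fv.dim W = fv.dim V"
    unfolding W by (rule dim_image_inj[OF V.sub V.fin lin inj])
  have nm: "norm_map G act' (\<phi> x) = \<phi> (norm_map G act x)" if "x \<in> V" for x
    unfolding W.nm_eq V.nm_eq using lin_on_sum[OF V.sub lin, of G "act x" "\<lambda>_. 1"] V.act_in that \<phi>(4)
    by simp
  have "norm_map G act' ` W = \<phi> ` (norm_map G act ` V)"
    unfolding W image_image using nm by (rule image_cong[OF refl])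
  also have "fv.dim \<dots> = fv.dim (norm_map G act ` V)"
  proof (rule dim_image_inj)
    have NV: "norm_map G act ` V \<subseteq> V" using V.nm_in by blast
    show "lin_on (norm_map G act ` V) \<phi>" using lin NV by (auto simp: lin_on_def subset_iff)
    show "x = 0" if "x \<in> norm_map G act ` V" "\<phi> x = 0" for x
      using inj that NV by blast
  qed (rule V.fin_dim_nm)+
  finally show "fv.dim (norm_map G act' ` W) = fv.dim (norm_map G act ` V)" .
qed

context pmodule
begin

lemma direct_sum_parts:
  assumes "fg_direct_sum G act V A B"
  shows "pmodule G p act A" "pmodule G p act B" "fv.dim V = fv.dim A + fv.dim B"
    "fv.dim (nm ` V) = fv.dim (nm ` A) + fv.dim (nm ` B)"
proof -
  have AB: "fg_submodule G act A" "fg_submodule G act B" "A \<inter> B = {0}"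
    and V: "V = {a + b | a b. a \<in> A \<and> b \<in> B}"
    using assms unfolding fg_direct_sum_def by blast+
  have 0: "0 \<in> A" "0 \<in> B" using AB(3) by blast+
  have AV: "A \<subseteq> V"
  proof
    fix a assume "a \<in> A"
    moreover have "a = a + 0" by simp
    ultimately show "a \<in> V" unfolding V using 0(2) by blast
  qed
  have BV: "B \<subseteq> V"
  proof
    fix b assume "b \<in> B"
    moreover have "b = 0 + b" by simp
    ultimately show "b \<in> V" unfolding V using 0(1) by blast
  qed
  show A: "pmodule G p act A" and B: "pmodule G p act B"
    by (rule submodule[OF AB(1) AV], rule submodule[OF AB(2) BV])
  interpret A: pmodule G p act A by (rule A)
  interpret B: pmodule G p act B by (rule B)
  show "fv.dim V = fv.dim A + fv.dim B"
    by (rule dim_direct_sum[OF A.sub A.fin B.sub B.fin AB(3) V])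
  have "nm ` V = {a + b | a b. a \<in> nm ` A \<and> b \<in> nm ` B}"
  proof -
    have "nm (a + b) = nm a + nm b" if "a \<in> A" "b \<in> B" for a b
      using lin_on_nm that AV BV unfolding lin_on_def by blast
    note nm_add = this
    show ?thesis
    proof (intro subset_antisym subsetI)
      fix y assume "y \<in> nm ` V"
      then obtain a b where "y = nm (a + b)" "a \<in> A" "b \<in> B" unfolding V by blast
      then show "y \<in> {a + b | a b. a \<in> nm ` A \<and> b \<in> nm ` B}"
        using nm_add by blast
    next
      fix y assume "y \<in> {a + b | a b. a \<in> nm ` A \<and> b \<in> nm ` B}"
      then obtain a b where "y = nm a + nm b" "a \<in> A" "b \<in> B" by blast
      moreover from this have "a + b \<in> V" unfolding V by blast
      ultimately have "y = nm (a + b)" "a + b \<in> V" using nm_add[of a b] by metis+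
      then show "y \<in> nm ` V" by blast
    qed
  qed
  moreover have "nm ` A \<inter> nm ` B = {0}"
  proof -
    have "nm ` A \<subseteq> A" "nm ` B \<subseteq> B" using A.nm_in B.nm_in by blast+
    moreover have "0 \<in> nm ` A" "0 \<in> nm ` B"
      using fv.subspace_0[OF A.fin_dim_nm(2)] fv.subspace_0[OF B.fin_dim_nm(2)] .
    ultimately show ?thesis using AB(3) by blast
  qed
  ultimately show "fv.dim (nm ` V) = fv.dim (nm ` A) + fv.dim (nm ` B)"
    by (intro dim_direct_sum(1)[OF A.fin_dim_nm(2,1) B.fin_dim_nm(2,1)])
qed

text \<open>
  Vectors whose norms form a basis of the space of all norms split off together as a free summand \<open>A\<close>. Its complement can
  contain no nonzero norm, since the dual functionals vanish there.
\<close>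

lemma split_off_free:
  obtains A B where "fg_direct_sum G act V A B" "fg_projective G act A"
    "fv.dim A = fv.dim (nm ` V) * card G" "nm ` B = {0}"
proof -
  obtain U where U: "finite U" "U \<subseteq> nm ` V" "fv.independent U" "nm ` V \<subseteq> fv.span U"
    "card U = fv.dim (nm ` V)"
    using fin_dim_basis[OF fin_dim_nm(1)] .
  define r where "r = card U"
  obtain u where u: "bij_betw u {..<r} U"
    using ex_bij_betw_nat_finite[OF U(1)] unfolding r_def atLeast0LessThan by blast
  have "\<exists>v. v \<in> V \<and> nm v = u i" if "i < r" for i
  proof -
    have "u i \<in> U" using u that by (auto simp: bij_betw_def)
    then have "u i \<in> nm ` V" using U(2) by blast
    then show ?thesis by (auto simp: image_iff)
  qed
  then obtain v where v: "\<And>i. i < r \<Longrightarrow> v i \<in> V" "\<And>i. i < r \<Longrightarrow> nm (v i) = u i"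
    by metis
  define C where "C = fv.extend_basis U"
  have C: "fv.independent C" "fv.span C = UNIV" "U \<subseteq> C"
    using fv.independent_extend_basis[OF U(3)] fv.span_extend_basis[OF U(3)] fv.extend_basis_superset[OF U(3)]
    by (auto simp: C_def)
  \<comment> \<open>Coordinates for a basis of the whole space that extends \<open>U\<close> are functionals dual to \<open>U\<close>.\<close>
  define lam where "lam i x = fv.representation C x (u i)" for i x
  have uC: "u i \<in> C" if "i < r" for i using that u C(3) by (auto simp: bij_betw_def)
  have u_inj: "u i = u j \<longleftrightarrow> i = j" if "i < r" "j < r" for i j
    using that u by (auto simp: bij_betw_def inj_on_def)
  obtain A B where AB: "fg_direct_sum G act V A B" "fg_iso G act A (free_act G) (free_module G r)"
    "fv.dim A = r * card G" "\<And>x i. x \<in> B \<Longrightarrow> i < r \<Longrightarrow> lam i x = 0"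
  proof (rule free_summand[of r v lam])
    show "lam i (x + y) = lam i x + lam i y" for i x y
      using fv.representation_add[OF C(1), of y x] C(2) by (simp add: lam_def)
    show "lam i (fscale c x) = c * lam i x" for i c x
      using fv.representation_scale[OF C(1), of x c] C(2) by (simp add: lam_def)
    show "lam i (nm (v j)) = (if i = j then 1 else 0)" if "i < r" "j < r" for i j
      using that uC u_inj v(2) by (simp add: lam_def fv.representation_basis[OF C(1)])
  qed (use v in auto)
  interpret F: pmodule G p "free_act G" "free_module G r :: (nat \<times> (nat \<Rightarrow> nat) \<Rightarrow> 'a) set"
    by (rule pmodule_free) (rule char_p)
  have "fg_direct_sum G (free_act G) (free_module G r :: (nat \<times> (nat \<Rightarrow> nat) \<Rightarrow> 'a) set) (free_module G r) {0}"
    using F.fg_submodule_self fv.subspace_0[OF F.sub] F.act_0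
    by (auto simp: fg_direct_sum_def fg_submodule_def fv.subspace_single_0)
  then have "fg_projective G act A"
    using AB(2) unfolding fg_projective_def by blast
  moreover have "nm ` B = {0}"
  proof -
    interpret B: pmodule G p act B by (rule direct_sum_parts(2)[OF AB(1)])
    have BV: "B \<subseteq> V"
    proof
      fix b assume "b \<in> B"
      moreover have "0 \<in> A" using AB(1) by (auto simp: fg_direct_sum_def)
      ultimately show "b \<in> V" using AB(1) unfolding fg_direct_sum_def
        by (metis (mono_tags, lifting) add_0 mem_Collect_eq)
    qed
    have "nm x = 0" if "x \<in> B" for x
    proof -
      have B: "nm x \<in> B" using B.nm_in that by blast
      have "nm x \<in> nm ` V" using that BV by blast
      then have "nm x \<in> fv.span U" using U(4) by blast
      then have eq: "fv.representation C (nm x) = fv.representation U (nm x)"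
        by (rule fv.representation_extend[OF C(1) _ C(3)])
      have "fv.representation U (nm x) w = 0" if "w \<in> U" for w
      proof -
        from that u obtain i where "i < r" "w = u i" by (auto simp: bij_betw_def)
        then show ?thesis using AB(4)[OF B, of i] eq by (simp add: lam_def)
      qed
      moreover have "(\<Sum>w\<in>U. fscale (fv.representation U (nm x) w) w) = nm x"
        using fv.sum_representation_eq[OF U(3) \<open>nm x \<in> fv.span U\<close> U(1)] by simp
      ultimately show "nm x = 0" by (metis (no_types, lifting) fv.scale_zero_left sum.neutral)
    qed
    then show ?thesis using fv.subspace_0[OF B.sub] by (auto simp: image_iff)
  qed
  ultimately show thesis using AB(1,3) that U(5) by (simp add: r_def)
qed

lemma card_times_norm_rank_le: "fv.dim (nm ` V) * card G \<le> fv.dim V"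
proof -
  obtain A B where "fg_direct_sum G act V A B" "fv.dim A = fv.dim (nm ` V) * card G"
    using split_off_free .
  then show ?thesis using direct_sum_parts(3)[of A B] by simp
qed

end

lemma (in p_group) norm_rank_free:
  assumes "CHAR('a::field) = p"
  shows "fv.dim (free_module G n :: (nat \<times> (nat \<Rightarrow> nat) \<Rightarrow> 'a) set) = n * card G"
    "n \<le> fv.dim (norm_map G (free_act G) ` (free_module G n :: (nat \<times> (nat \<Rightarrow> nat) \<Rightarrow> 'a) set))"
proof -
  interpret F: pmodule G p "free_act G" "free_module G n :: (nat \<times> (nat \<Rightarrow> nat) \<Rightarrow> 'a) set"
    by (rule pmodule_free) (rule assms)
  show "fv.dim (free_module G n :: (nat \<times> (nat \<Rightarrow> nat) \<Rightarrow> 'a) set) = n * card G"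
    using dim_supported(2)[of "{..<n} \<times> G"] finite_G by (simp add: free_module_eq card_cartesian_product)
  let ?d = "\<lambda>i. norm_map G (free_act G) (delta (i, id)) :: nat \<times> (nat \<Rightarrow> nat) \<Rightarrow> 'a"
  have d: "?d i (j, id) = (if i = j then 1 else 0)" for i j
  proof -
    have "?d i (j, id) = (\<Sum>g\<in>G. free_act G (delta (i, id)) g (j, id))"
      by (simp add: norm_map_def sum_apply)
    also have "\<dots> = (\<Sum>g\<in>G. if g = id then (if i = j then 1 else 0) else 0)"
    proof (intro sum.cong refl)
      fix g assume g: "g \<in> G"
      have "inv' g = id \<longleftrightarrow> g = id" using g comp_inv by (metis comp_id inv_id)
      then show "free_act G (delta (i, id)) g (j, id) = (if g = id then (if i = j then 1 else 0) else (0 :: 'a))"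
        using g id_in by (auto simp: free_act_apply delta_def)
    qed
    also have "\<dots> = (if i = j then 1 else 0)" using finite_G id_in by (simp add: sum.delta)
    finally show ?thesis .
  qed
  have "card {..<n} \<le> fv.dim (norm_map G (free_act G) ` (free_module G n :: (nat \<times> (nat \<Rightarrow> nat) \<Rightarrow> 'a) set))"
  proof (rule indep_family_card_le)
    show "indep_family {..<n} ?d"
    proof (rule indep_familyI)
      fix c :: "nat \<Rightarrow> 'a" and i assume c: "(\<Sum>i<n. fscale (c i) (?d i)) = 0" "i \<in> {..<n}"
      have "0 = (\<Sum>k<n. fscale (c k) (?d k)) (i, id)" using c(1) by simp
      also have "\<dots> = (\<Sum>k<n. c k * (if k = i then 1 else 0))"
        by (simp add: sum_apply fscale_def d)
      also have "\<dots> = c i" using c(2) by (simp add: if_distrib sum.delta cong: if_cong)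
      finally show "c i = 0" by simp
    qed
    show "?d ` {..<n} \<subseteq> norm_map G (free_act G) ` free_module G n"
    proof (intro image_subsetI imageI)
      fix i assume "i \<in> {..<n}"
      then show "delta (i, id) \<in> (free_module G n :: (nat \<times> (nat \<Rightarrow> nat) \<Rightarrow> 'a) set)"
        unfolding free_module_def delta_def using id_in by simp
    qed
  qed (use F.fin_dim_nm in auto)
  then show "n \<le> fv.dim (norm_map G (free_act G) ` (free_module G n :: (nat \<times> (nat \<Rightarrow> nat) \<Rightarrow> 'a) set))"
    by simp
qed

context pmodule
begin

text \<open>
  The inequality \<open>card_times_norm_rank_le\<close> holds for a module and for its complement in a free module. For the free module it is
  an equality, so it is one for both.
\<close>

lemma projective_dim:
  assumes "fg_projective G act V"
  shows "fv.dim V = fv.dim (nm ` V) * card G"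
proof -
  obtain n A B where n: "fg_direct_sum G (free_act G) (free_module G n) A B"
    "fg_iso G act V (free_act G) A"
    using assms unfolding fg_projective_def by blast
  interpret F: pmodule G p "free_act G" "free_module G n :: (nat \<times> (nat \<Rightarrow> nat) \<Rightarrow> 'a) set"
    by (rule pmodule_free) (rule char_p)
  note parts = F.direct_sum_parts[OF n(1)]
  interpret A: pmodule G p "free_act G" A by (rule parts(1))
  interpret B: pmodule G p "free_act G" B by (rule parts(2))
  have "fv.dim A + fv.dim B \<le> fv.dim (A.nm ` A) * card G + fv.dim (A.nm ` B) * card G"
    using norm_rank_free[OF char_p, of n] parts(3,4)
    by (metis add_mult_distrib mult_le_mono1)
  then have "fv.dim A = fv.dim (A.nm ` A) * card G"
    using A.card_times_norm_rank_le B.card_times_norm_rank_le by linarith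
  then show ?thesis
    using fg_iso_dims[OF _ parts(1) n(2)] pmodule_axioms by simp
qed

text \<open>
  A module without nonzero projective summand has norm map zero, since \<open>split_off_free\<close> would split off a free summand; all of
  the norm rank therefore comes from the projective part, where it determines the dimension.
\<close>

lemma pf_dim_eq: "pf_dim G act V + card G * fv.dim (nm ` V) = fv.dim V"
proof -
  have dim: "fv.dim Wpf + card G * fv.dim (nm ` V) = fv.dim V"
    if "pr_pf_decomposition G act V Wpr Wpf" for Wpr Wpf
  proof -
    from that have ds: "fg_direct_sum G act V Wpr Wpf" and pr: "fg_projective G act Wpr"
      and pf: "\<And>A B. fg_direct_sum G act Wpf A B \<Longrightarrow> fg_projective G act A \<Longrightarrow> A = {0}"
      unfolding pr_pf_decomposition_def by blast+
    note parts = direct_sum_parts[OF ds]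
    interpret R: pmodule G p act Wpr by (rule parts(1))
    interpret Q: pmodule G p act Wpf by (rule parts(2))
    obtain A B where AB: "fg_direct_sum G act Wpf A B" "fg_projective G act A"
      "fv.dim A = fv.dim (nm ` Wpf) * card G"
      using Q.split_off_free .
    then have "A = {0}" using pf by blast
    then have "fv.dim A = 0"
      using fv.dim_le_card[of A "{}"] by simp
    moreover have "card G \<noteq> 0" using finite_G id_in by auto
    ultimately have "fv.dim (nm ` Wpf) = 0" using AB(3) by simp
    then show ?thesis using parts(3,4) R.projective_dim[OF pr] by (simp add: mult.commute)
  qed
  obtain A B where AB: "fg_direct_sum G act V A B" "fg_projective G act A"
    "fv.dim A = fv.dim (nm ` V) * card G" "nm ` B = {0}"
    using split_off_free .
  have "pr_pf_decomposition G act V A B"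
    unfolding pr_pf_decomposition_def
  proof (intro conjI allI impI AB(1,2))
    fix A' B' assume *: "fg_direct_sum G act B A' B' \<and> fg_projective G act A'"
    interpret B: pmodule G p act B by (rule direct_sum_parts(2)[OF AB(1)])
    have ds: "fg_direct_sum G act B A' B'" using * by blast
    interpret A': pmodule G p act A' by (rule B.direct_sum_parts(1)[OF ds])
    have "fv.dim (nm ` B) = 0"
      using dim_eq_0_iff[OF B.fin_dim_nm] AB(4) by blast
    then have "fv.dim (nm ` A') = 0" using B.direct_sum_parts(4)[OF ds] by simp
    then have "fv.dim A' = 0" using A'.projective_dim * by simp
    then show "A' = {0}" using dim_eq_0_iff[OF A'.fin A'.sub] by blast
  qed
  note AB' = this
  have "pf_dim G act V = fv.dim B"
    unfolding pf_dim_def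
  proof (rule the_equality)
    show "\<exists>Wpr Wpf. pr_pf_decomposition G act V Wpr Wpf \<and> fv.dim B = fv.dim Wpf"
      using AB' by blast
    fix d assume "\<exists>Wpr Wpf. pr_pf_decomposition G act V Wpr Wpf \<and> d = fv.dim Wpf"
    then obtain Wpr Wpf where "pr_pf_decomposition G act V Wpr Wpf" "d = fv.dim Wpf" by blast
    then show "d = fv.dim B" using dim[OF AB'] dim[of Wpr Wpf] by simp
  qed
  then show ?thesis using dim[OF AB'] by simp
qed

end

section \<open>Wreath coordinates on blocks\<close>

text \<open>
  A number \<open>x \<ge> 1\<close> lies in a block of length \<open>p\<close>: here \<open>\<sigma>\<close> permutes the blocks and \<open>e i\<close> is the rotation that is
  applied inside the block \<open>i\<close> before it moves. Both \<open>\<sigma>\<^sup>[\<^sup>p\<^sup>]\<close> and \<open>\<pi>[j]\<close> have this form.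
\<close>

definition wreath :: "nat \<Rightarrow> (nat \<Rightarrow> nat) \<Rightarrow> (nat \<Rightarrow> nat) \<Rightarrow> nat \<Rightarrow> nat" where
  "wreath p \<sigma> e x = (if x = 0 then 0 else
     (\<sigma> ((x - 1) div p + 1) - 1) * p + ((x - 1) mod p + e ((x - 1) div p + 1)) mod p + 1)"

definition shifts :: "nat \<Rightarrow> nat \<Rightarrow> (nat \<Rightarrow> nat) set" where
  "shifts p k = {e. \<forall>i. e i < p \<and> (i \<notin> {1..k} \<longrightarrow> e i = 0)}"

lemma wreath_0 [simp]: "wreath p \<sigma> e 0 = 0"
  by (simp add: wreath_def)

lemma wreath_pos:
  assumes "p > 0" "i \<ge> 1" "r < p"
  shows "wreath p \<sigma> e ((i - 1) * p + r + 1) = (\<sigma> i - 1) * p + (r + e i) mod p + 1"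
  using assms by (simp add: wreath_def)

lemma pos_decomp:
  assumes "p > 0" "x > (0::nat)"
  obtains i r where "i \<ge> 1" "r < p" "x = (i - 1) * p + r + 1"
proof
  show "(x - 1) div p + 1 \<ge> 1" "(x - 1) mod p < p" using assms by auto
  show "x = ((x - 1) div p + 1 - 1) * p + (x - 1) mod p + 1" using assms by simp
qed

lemma pos_decomp_unique:
  assumes "(i - 1) * p + r + 1 = (j - 1) * p + s + 1" "r < p" "s < p" "i \<ge> (1::nat)" "j \<ge> 1"
  shows "i = j" "r = s"
proof -
  have eq: "(i - 1) * p + r = (j - 1) * p + s" using assms(1) by simp
  have "((i - 1) * p + r) div p = i - 1" "((j - 1) * p + s) div p = j - 1"
    using assms(2,3) by auto
  with eq have "i - 1 = j - 1" by metis
  then show "i = j" using assms(4,5) by simp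
  then show "r = s" using eq by simp
qed

lemma wreath_comp:
  assumes "p > 0" "\<And>i. i \<ge> 1 \<Longrightarrow> \<sigma> i \<ge> 1"
  shows "wreath p \<sigma>' e' \<circ> wreath p \<sigma> e = wreath p (\<sigma>' \<circ> \<sigma>) (\<lambda>i. (e i + e' (\<sigma> i)) mod p)"
proof
  fix x show "(wreath p \<sigma>' e' \<circ> wreath p \<sigma> e) x = wreath p (\<sigma>' \<circ> \<sigma>) (\<lambda>i. (e i + e' (\<sigma> i)) mod p) x"
  proof (cases "x = 0")
    case False
    then obtain i r where x: "i \<ge> 1" "r < p" "x = (i - 1) * p + r + 1"
      using pos_decomp[OF assms(1)] by blast
    have "wreath p \<sigma>' e' (wreath p \<sigma> e x) = (\<sigma>' (\<sigma> i) - 1) * p + ((r + e i) mod p + e' (\<sigma> i)) mod p + 1"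
      unfolding x(3) wreath_pos[OF assms(1) x(1,2)]
      by (rule wreath_pos) (use assms x in auto)
    also have "\<dots> = wreath p (\<sigma>' \<circ> \<sigma>) (\<lambda>i. (e i + e' (\<sigma> i)) mod p) x"
      unfolding x(3) wreath_pos[OF assms(1) x(1,2)] by (simp add: mod_simps add.assoc)
    finally show ?thesis by simp
  qed simp
qed

lemma wreath_id:
  assumes "p > 0"
  shows "wreath p id (\<lambda>_. 0) = id"
proof
  fix x show "wreath p id (\<lambda>_. 0) x = id x"
  proof (cases "x = 0")
    case False
    then obtain i r where x: "i \<ge> 1" "r < p" "x = (i - 1) * p + r + 1"
      using pos_decomp[OF assms(1)] by blast
    show ?thesis unfolding x(3) wreath_pos[OF assms(1) x(1,2)] using x by simp
  qed simp
qed

lemma Sym_pos: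
  assumes "\<sigma> \<in> Sym n" "i \<ge> 1"
  shows "\<sigma> i \<ge> 1"
proof (cases "i \<le> n")
  case True
  then show ?thesis using assms permutes_in_image[of \<sigma> "{1..n}" i] by (simp add: Sym_iff)
next
  case False
  then show ?thesis using assms permutes_not_in[of \<sigma> "{1..n}" i] by (simp add: Sym_iff)
qed

lemma Sym_mono: "m \<le> n \<Longrightarrow> \<sigma> \<in> Sym m \<Longrightarrow> \<sigma> \<in> Sym n"
  unfolding Sym_iff by (erule permutes_subset) simp

lemma Sym_fix: "\<sigma> \<in> Sym n \<Longrightarrow> i > n \<Longrightarrow> \<sigma> i = i"
  unfolding Sym_iff by (erule permutes_not_in) simp

lemma wreath_left_inverse:
  assumes p: "p > 0" and \<sigma>: "\<sigma> \<in> Sym m" and e: "\<And>i. e i < p"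
  shows "wreath p (inv' \<sigma>) (\<lambda>i. (p - e (inv' \<sigma> i)) mod p) \<circ> wreath p \<sigma> e = id"
proof -
  have 1: "inv' \<sigma> \<circ> \<sigma> = id" "inv' \<sigma> (\<sigma> i) = i" for i
    using \<sigma> unfolding Sym_iff by (auto simp: permutes_inv_o permutes_inverses)
  have 2: "(e i + (p - e i) mod p) mod p = 0" for i
    using e[of i] by (simp add: mod_simps)
  have "wreath p (inv' \<sigma>) (\<lambda>i. (p - e (inv' \<sigma> i)) mod p) \<circ> wreath p \<sigma> e =
      wreath p (inv' \<sigma> \<circ> \<sigma>) (\<lambda>i. (e i + (p - e (inv' \<sigma> (\<sigma> i))) mod p) mod p)"
    by (rule wreath_comp[OF p Sym_pos[OF \<sigma>]])
  also have "\<dots> = wreath p id (\<lambda>_. 0)" by (simp only: 1 2)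
  finally show ?thesis by (simp only: wreath_id[OF p])
qed

lemma wreath_in_Sym:
  assumes p: "p > 0" and \<sigma>: "\<sigma> \<in> Sym m" "m \<le> k" and e: "e \<in> shifts p k"
  shows "wreath p \<sigma> e \<in> Sym (k * p)"
proof -
  have e': "\<And>i. e i < p" using e by (simp add: shifts_def)
  have inj: "inj (wreath p \<sigma> e)"
    using wreath_left_inverse[OF p \<sigma>(1), of e] e' by (metis inj_on_id inj_on_imageI2)
  have fix_outside: "wreath p \<sigma> e x = x" if "x \<notin> {1..k * p}" for x
  proof (cases "x = 0")
    case False
    then obtain i r where x: "i \<ge> 1" "r < p" "x = (i - 1) * p + r + 1"
      using pos_decomp[OF p] by blast
    have "i > k"
    proof (rule ccontr)
      assume "\<not> i > k"
      then have "i * p \<le> k * p" by simp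
      moreover have "i * p = (i - 1) * p + p" using x(1) by (cases i) auto
      ultimately have "x \<le> k * p" using x by simp
      with that False show False by simp
    qed
    then have "\<sigma> i = i" "e i = 0" using Sym_fix[OF \<sigma>(1)] \<sigma>(2) e by (auto simp: shifts_def)
    then show ?thesis unfolding x(3) wreath_pos[OF p x(1,2)] using x(2) by simp
  qed simp
  have "wreath p \<sigma> e x \<in> {1..k * p}" if "x \<in> {1..k * p}" for x
  proof (rule ccontr)
    assume "wreath p \<sigma> e x \<notin> {1..k * p}"
    then have "wreath p \<sigma> e (wreath p \<sigma> e x) = wreath p \<sigma> e x" by (rule fix_outside)
    then have "wreath p \<sigma> e x = x" using inj by (simp add: inj_eq)
    then show False using that \<open>wreath p \<sigma> e x \<notin> {1..k * p}\<close> by simp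
  qed
  then have "wreath p \<sigma> e permutes {1..k * p}"
    by (intro inj_imp_permutes inj_on_subset[OF inj] finite_atLeastAtMost fix_outside) auto
  then show ?thesis by (simp add: Sym_iff)
qed

lemma wreath_inject:
  assumes p: "p > 0" and "\<sigma> \<in> Sym m" "\<sigma>' \<in> Sym m'" "\<And>i. e i < p" "\<And>i. e' i < p" "e 0 = e' 0"
    and eq: "wreath p \<sigma> e = wreath p \<sigma>' e'"
  shows "\<sigma> = \<sigma>' \<and> e = e'"
proof -
  have "\<sigma> i = \<sigma>' i \<and> e i = e' i" for i
  proof (cases "i = 0")
    case True
    have "\<sigma> 0 = 0" "\<sigma>' 0 = 0" using assms(2,3) unfolding Sym_iff by (auto simp: permutes_def)
    then show ?thesis using True assms(6) by simp
  next
    case False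
    then have i: "i \<ge> 1" by simp
    have "(\<sigma> i - 1) * p + (0 + e i) mod p + 1 = (\<sigma>' i - 1) * p + (0 + e' i) mod p + 1"
      using fun_cong[OF eq, of "(i - 1) * p + 0 + 1"]
      unfolding wreath_pos[OF p i p] .
    from pos_decomp_unique[OF this] show ?thesis
      using assms(2-5) p i Sym_pos by simp
  qed
  then show ?thesis by blast
qed

lemma perm_blow_wreath: "perm_blow p \<sigma> = wreath p \<sigma> (\<lambda>_. 0)"
  by (rule ext) (simp add: perm_blow_def wreath_def)

lemma perm_blow_blow:
  assumes "\<And>i. i \<ge> 1 \<Longrightarrow> \<tau> i \<ge> 1" "b > 0" "c > 0"
  shows "perm_blow (c * b) \<tau> = perm_blow b (perm_blow c \<tau>)"
proof
  fix x show "perm_blow (c * b) \<tau> x = perm_blow b (perm_blow c \<tau>) x"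
  proof (cases "x = 0")
    case False
    define y where "y = x - 1"
    have "perm_blow b (perm_blow c \<tau>) x = ((\<tau> (y div b div c + 1) - 1) * c + y div b mod c) * b + (y mod b + 1)"
      using False by (simp add: perm_blow_def y_def)
    also have "y div b div c = y div (c * b)" by (simp add: div_mult2_eq[symmetric] mult.commute)
    also have "((\<tau> (y div (c * b) + 1) - 1) * c + y div b mod c) * b + (y mod b + 1) =
        (\<tau> (y div (c * b) + 1) - 1) * (c * b) + (b * (y div b mod c) + y mod b) + 1"
      by (simp add: algebra_simps)
    also have "b * (y div b mod c) + y mod b = y mod (c * b)"
      using mod_mult2_eq[of y b c] by (simp add: mult.commute)
    finally show ?thesis using False by (simp add: perm_blow_def y_def)
  qed (simp add: perm_blow_def)
qed

text \<open>
  Both sides act on the blocks of length \<open>b\<close> with numbers from \<open>(j - 1) c + 1\<close> to \<open>j c\<close>. So the generators of \<open>P\<close> may be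
  read as block cycles \<open>\<pi>[j]\<close> blown up by a power of \<open>p\<close>.
\<close>

lemma perm_shift_blow:
  assumes \<tau>: "\<And>i. i \<ge> 1 \<Longrightarrow> \<tau> i \<ge> 1" and b: "b > 0" and j: "j \<ge> 1"
  shows "perm_shift (c * b) j (perm_blow b \<tau>) = perm_blow b (perm_shift c j \<tau>)"
proof
  fix x show "perm_shift (c * b) j (perm_blow b \<tau>) x = perm_blow b (perm_shift c j \<tau>) x"
  proof (cases "x = 0")
    case False
    then obtain i r where x: "i \<ge> 1" "r < b" "x = (i - 1) * b + r + 1"
      using pos_decomp[OF b] by blast
    have rhs: "perm_blow b (perm_shift c j \<tau>) x = (perm_shift c j \<tau> i - 1) * b + r + 1"
      unfolding perm_blow_wreath x(3) wreath_pos[OF b x(1,2)] using x(2) by simp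
    have iff: "x \<in> {(j - 1) * (c * b) + 1..(j - 1) * (c * b) + c * b} \<longleftrightarrow> i \<in> {(j - 1) * c + 1..(j - 1) * c + c}"
    proof -
      define A where "A = (j - 1) * c"
      have "A * b \<le> (i - 1) * b + r \<longleftrightarrow> A \<le> i - 1"
      proof
        assume "A * b \<le> (i - 1) * b + r"
        then have "A * b div b \<le> ((i - 1) * b + r) div b" by (rule div_le_mono)
        then show "A \<le> i - 1" using b x(2) by simp
      next
        assume "A \<le> i - 1"
        then show "A * b \<le> (i - 1) * b + r" by (simp add: trans_le_add1)
      qed
      moreover have "(i - 1) * b + r < (A + c) * b \<longleftrightarrow> i - 1 < A + c"
      proof
        assume "(i - 1) * b + r < (A + c) * b"
        then have "(i - 1) * b < (A + c) * b" by (rule le_less_trans[OF le_add1])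
        then show "i - 1 < A + c" using mult_less_cancel2[of "i - 1" b "A + c"] by blast
      next
        assume "i - 1 < A + c"
        then have "(i - 1 + 1) * b \<le> (A + c) * b" by (intro mult_le_mono1) simp
        then have "(i - 1) * b + b \<le> (A + c) * b" by (simp only: add_mult_distrib mult_1)
        then show "(i - 1) * b + r < (A + c) * b" using x(2) by linarith
      qed
      moreover have "x \<in> {A * b + 1..A * b + c * b} \<longleftrightarrow> A * b \<le> (i - 1) * b + r \<and> (i - 1) * b + r < (A + c) * b"
        unfolding x(3) by (auto simp: add_mult_distrib)
      moreover have "i \<in> {A + 1..A + c} \<longleftrightarrow> A \<le> i - 1 \<and> i - 1 < A + c"
        using x(1) by auto
      moreover have "(j - 1) * (c * b) = A * b" by (simp add: A_def)
      ultimately show ?thesis unfolding A_def[symmetric] by metis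
    qed
    show ?thesis
    proof (cases "i \<in> {(j - 1) * c + 1..(j - 1) * c + c}")
      case True
      define i' where "i' = i - (j - 1) * c"
      have i': "i = (j - 1) * c + i'" "i' \<ge> 1" using True by (auto simp: i'_def)
      have "i - 1 = (j - 1) * c + (i' - 1)" using i' by simp
      then have "x = (j - 1) * (c * b) + ((i' - 1) * b + r + 1)"
        using x(3) by (simp add: algebra_simps)
      then have xx: "x - (j - 1) * (c * b) = (i' - 1) * b + r + 1" by simp
      have "perm_shift (c * b) j (perm_blow b \<tau>) x = (j - 1) * (c * b) + perm_blow b \<tau> ((i' - 1) * b + r + 1)"
        using True iff xx by (simp only: perm_shift_def if_True)
      also have "perm_blow b \<tau> ((i' - 1) * b + r + 1) = (\<tau> i' - 1) * b + r + 1"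
        unfolding perm_blow_wreath wreath_pos[OF b i'(2) x(2)] using x(2) by simp
      also have "(j - 1) * (c * b) + ((\<tau> i' - 1) * b + r + 1) = ((j - 1) * c + \<tau> i' - 1) * b + r + 1"
      proof -
        have "(j - 1) * c + \<tau> i' - 1 = (j - 1) * c + (\<tau> i' - 1)" using \<tau>[OF i'(2)] by simp
        then show ?thesis by (simp add: algebra_simps)
      qed
      also have "\<dots> = perm_blow b (perm_shift c j \<tau>) x"
        using True unfolding rhs by (simp add: perm_shift_def i'_def)
      finally show ?thesis .
    next
      case False
      then have "perm_shift (c * b) j (perm_blow b \<tau>) x = x"
        using iff by (simp only: perm_shift_def if_False)
      moreover have "perm_shift c j \<tau> i = i" using False by (simp only: perm_shift_def if_False)
      ultimately show ?thesis unfolding rhs using x by simp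
    qed
  qed (simp add: perm_shift_def perm_blow_def)
qed

lemma cyc_pos: "i \<ge> 1 \<Longrightarrow> cyc p i \<ge> 1"
  by (cases "i < p"; cases "i = p") (auto simp: cyc_apply)

lemma cyc_mod:
  assumes "r < p"
  shows "cyc p (r + 1) = (r + 1) mod p + 1"
proof (cases "r + 1 < p")
  case True
  then show ?thesis using cyc_apply(1)[of "r + 1" p] by simp
next
  case False
  then have "p = r + 1" using assms by simp
  then show ?thesis using cyc_apply(2)[of p] by simp
qed

definition block_cycle :: "nat \<Rightarrow> nat \<Rightarrow> nat \<Rightarrow> nat" where
  "block_cycle p j = perm_shift p j (cyc p)"

lemma block_cycle_wreath:
  assumes p: "p > 0" and j: "j \<ge> 1"
  shows "block_cycle p j = wreath p id (\<lambda>i. if i = j then 1 else 0)"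
proof
  fix x show "block_cycle p j x = wreath p id (\<lambda>i. if i = j then 1 else 0) x"
  proof (cases "x = 0")
    case False
    then obtain i r where x: "i \<ge> 1" "r < p" "x = (i - 1) * p + r + 1"
      using pos_decomp[OF p] by blast
    have mem: "x \<in> {(j - 1) * p + 1..(j - 1) * p + p} \<longleftrightarrow> i = j"
    proof
      assume "x \<in> {(j - 1) * p + 1..(j - 1) * p + p}"
      then have "\<exists>s<p. x = (j - 1) * p + s + 1"
        by (intro exI[of _ "x - 1 - (j - 1) * p"]) auto
      then obtain s where "s < p" "x = (j - 1) * p + s + 1" by blast
      then show "i = j" using pos_decomp_unique(1)[of i p r j s] x j by simp
    qed (use x in auto)
    show ?thesis
    proof (cases "i = j")
      case True
      have "x - (j - 1) * p = r + 1" using x True by simp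
      moreover have "x \<in> {(j - 1) * p + 1..(j - 1) * p + p}" using True mem by blast
      ultimately have "block_cycle p j x = (j - 1) * p + ((r + 1) mod p + 1)"
        using cyc_mod[OF x(2)] unfolding block_cycle_def perm_shift_def by (simp only: if_True)
      then show ?thesis unfolding x(3) wreath_pos[OF p x(1,2)] using True by simp
    next
      case False
      then have "block_cycle p j x = x" using mem by (simp only: block_cycle_def perm_shift_def if_False)
      then show ?thesis unfolding x(3) wreath_pos[OF p x(1,2)] using False x by simp
    qed
  qed (simp add: block_cycle_def perm_shift_def)
qed

text \<open>
  The generators of \<open>P\<close> in the form in which all of them with \<open>i > 0\<close> are generators for \<open>k div p\<close> blown up by \<open>p\<close>.
\<close>

definition P_gens :: "nat \<Rightarrow> nat \<Rightarrow> (nat \<Rightarrow> nat) set" where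
  "P_gens p k = {perm_blow (p ^ i) (block_cycle p j) | i j. 1 \<le> j \<and> j * p ^ i \<le> k}"

lemma P_group_eq:
  assumes "p > 0"
  shows "P_group p k = generate (sym_group (k * p)) (P_gens p k)"
proof -
  have "perm_shift (p ^ (i + 1)) j (perm_blow (p ^ i) (cyc p)) = perm_blow (p ^ i) (block_cycle p j)"
    if "1 \<le> j" for i j
    using perm_shift_blow[of "cyc p" "p ^ i" j p] cyc_pos[of _ p] assms that
    by (simp add: block_cycle_def)
  then have "{perm_shift (p ^ (i + 1)) j (perm_blow (p ^ i) (cyc p)) | i j. 1 \<le> j \<and> j * p ^ i \<le> k} = P_gens p k"
    unfolding P_gens_def by (intro Collect_cong) metis
  then show ?thesis by (simp add: P_group_def)
qed

section \<open>The order of the Sylow subgroup\<close>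

lemma perm_blow_1:
  assumes "p > 0" "j \<ge> 1"
  shows "perm_blow 1 (block_cycle p j) = block_cycle p j"
proof
  fix l show "perm_blow 1 (block_cycle p j) l = block_cycle p j l"
  proof (cases "l = 0")
    case False
    then have "block_cycle p j l \<ge> 1"
      unfolding block_cycle_wreath[OF assms] wreath_def by simp
    then show ?thesis using False by (simp add: perm_blow_def)
  qed (simp add: perm_blow_def block_cycle_def perm_shift_def)
qed

lemma P_gens_cases:
  assumes "p > 0" "x \<in> P_gens p k"
  obtains (cycle) j where "1 \<le> j" "j \<le> k" "x = wreath p id (\<lambda>i. if i = j then 1 else 0)"
  | (blow) y where "y \<in> P_gens p (k div p)" "x = wreath p y (\<lambda>_. 0)"
proof -
  obtain i j where x: "1 \<le> j" "j * p ^ i \<le> k" "x = perm_blow (p ^ i) (block_cycle p j)"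
    using assms(2) by (auto simp: P_gens_def)
  have pos: "block_cycle p j l \<ge> 1" if "l \<ge> 1" for l
    using that assms(1) unfolding block_cycle_wreath[OF assms(1) x(1)] wreath_def by simp
  show thesis
  proof (cases i)
    case 0
    then have "x = wreath p id (\<lambda>i. if i = j then 1 else 0)"
      unfolding x(3) block_cycle_wreath[OF assms(1) x(1), symmetric]
      using perm_blow_1[OF assms(1) x(1)] by (simp only: power_0)
    moreover have "j \<le> k" using x(2) 0 by simp
    ultimately show thesis using cycle[of j] x(1) by blast
  next
    case (Suc i')
    have "x = perm_blow p (perm_blow (p ^ i') (block_cycle p j))"
      unfolding x(3) Suc using perm_blow_blow[of "block_cycle p j" p "p ^ i'"] pos assms(1)
      by (simp add: mult.commute)
    moreover have "j * p ^ i' \<le> k div p"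
      using x(2) assms(1) unfolding Suc by (simp add: less_eq_div_iff_mult_less_eq mult.assoc mult.commute mult.left_commute)
    ultimately show thesis
      using blow[of "perm_blow (p ^ i') (block_cycle p j)"] x(1) by (auto simp: P_gens_def perm_blow_wreath)
  qed
qed

lemma P_gens_blow:
  assumes "p > 0" "y \<in> P_gens p (k div p)"
  shows "wreath p y (\<lambda>_. 0) \<in> P_gens p k"
proof -
  obtain i j where y: "1 \<le> j" "j * p ^ i \<le> k div p" "y = perm_blow (p ^ i) (block_cycle p j)"
    using assms(2) by (auto simp: P_gens_def)
  have pos: "block_cycle p j l \<ge> 1" if "l \<ge> 1" for l
    using that assms(1) unfolding block_cycle_wreath[OF assms(1) y(1)] wreath_def by simp
  have "wreath p y (\<lambda>_. 0) = perm_blow (p ^ Suc i) (block_cycle p j)"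
    unfolding y(3) perm_blow_wreath[symmetric] using perm_blow_blow[of "block_cycle p j" p "p ^ i"] pos assms(1)
    by (simp add: mult.commute)
  moreover have "j * p ^ Suc i \<le> k"
    using y(2) assms(1) by (simp add: less_eq_div_iff_mult_less_eq mult.assoc mult.commute mult.left_commute)
  ultimately show ?thesis using y(1) unfolding P_gens_def by blast
qed

lemma zero_shifts: "p > 0 \<Longrightarrow> (\<lambda>_. 0) \<in> shifts p k"
  by (simp add: shifts_def)

lemma single_shift: "p > 1 \<Longrightarrow> 1 \<le> j \<Longrightarrow> j \<le> k \<Longrightarrow> (\<lambda>i. if i = j then 1 else 0) \<in> shifts p k"
  by (auto simp: shifts_def)

lemma div_mult_le: "(k div p) * p \<le> (k::nat)"
  by simp

lemma id_in_Sym: "id \<in> Sym n"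
  by (simp add: Sym_iff permutes_id)

lemma P_gens_in_Sym:
  assumes p: "p > 1"
  shows "x \<in> P_gens p k \<Longrightarrow> x \<in> Sym (k * p)"
proof (induction k arbitrary: x rule: less_induct)
  case (less k)
  have p0: "p > 0" using p by simp
  from p0 less.prems show ?case
  proof (cases rule: P_gens_cases)
    case (cycle j)
    then show ?thesis
      using wreath_in_Sym[OF p0 id_in_Sym[of k] order_refl single_shift[OF p cycle(1,2)]] by simp
  next
    case (blow y)
    have "k > 0"
    proof (rule ccontr)
      assume "\<not> k > 0"
      then have "x \<in> P_gens p 0" using less.prems by simp
      then show False using p0 by (auto simp: P_gens_def)
    qed
    then have "k div p < k" using p by simp
    then have "y \<in> Sym ((k div p) * p)" by (rule less.IH[OF _ blow(1)])
    then show ?thesis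
      unfolding blow(2) by (rule wreath_in_Sym[OF p0 _ div_mult_le zero_shifts[OF p0]])
  qed
qed

locale sylow =
  fixes p :: nat
  assumes prime_p: "prime p"
begin

lemma p1: "p > 1" and p0: "p > 0"
  using prime_gt_1_nat[OF prime_p] by auto

lemma P_subgroup: "subgroup (P_group p k) (sym_group (k * p))"
  unfolding P_group_eq[OF p0]
  by (rule group.generate_is_subgroup[OF sym_group_is_group]) (use P_gens_in_Sym[OF p1] in blast)

lemma P_in_Sym: "x \<in> P_group p k \<Longrightarrow> x \<in> Sym (k * p)"
  using subgroup.subset[OF P_subgroup] by blast

lemma P_comp: "x \<in> P_group p k \<Longrightarrow> y \<in> P_group p k \<Longrightarrow> x \<circ> y \<in> P_group p k"
  using subgroup.m_closed[OF P_subgroup, of x k y] by (simp add: sym_group_mult)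

lemma P_id: "id \<in> P_group p k"
  using subgroup.one_closed[OF P_subgroup, of k] by (simp add: sym_group_one)

lemma P_inv: "x \<in> P_group p k \<Longrightarrow> inv' x \<in> P_group p k"
  using subgroup.m_inv_closed[OF P_subgroup, of x k] sym_group_inv_equality[OF P_in_Sym, of x k] by simp

lemma P_gen: "x \<in> P_gens p k \<Longrightarrow> x \<in> P_group p k"
  unfolding P_group_eq[OF p0] by (rule generate.incl)

lemma blow_in_P:
  assumes "\<sigma> \<in> P_group p (k div p)"
  shows "wreath p \<sigma> (\<lambda>_. 0) \<in> P_group p k"
proof -
  have comp: "wreath p (x \<circ> y) (\<lambda>_. 0) = wreath p x (\<lambda>_. 0) \<circ> wreath p y (\<lambda>_. 0)"
    if "y \<in> P_group p (k div p)" for x y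
    using wreath_comp[where \<sigma> = y and \<sigma>' = x and e = "\<lambda>_. 0" and e' = "\<lambda>_. 0", OF p0 Sym_pos[OF P_in_Sym[OF that]]]
    by simp
  show ?thesis
    using assms unfolding P_group_eq[OF p0, of "k div p"]
  proof (induction rule: generate.induct)
    case one
    show ?case unfolding sym_group_one wreath_id[OF p0] by (rule P_id)
  next
    case (incl h)
    then show ?case by (intro P_gen P_gens_blow p0)
  next
    case (inv h)
    have h: "h \<in> P_group p (k div p)" by (rule P_gen[OF inv])
    have hP: "wreath p h (\<lambda>_. 0) \<in> P_group p k" by (intro P_gen P_gens_blow p0 inv)
    have "wreath p (inv' h) (\<lambda>_. 0) \<circ> wreath p h (\<lambda>_. 0) = id"
      using comp[OF h, of "inv' h"] P_in_Sym[OF h] wreath_id[OF p0] by (simp add: Sym_iff permutes_inv_o)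
    then have "wreath p (inv' h) (\<lambda>_. 0) = inv' (wreath p h (\<lambda>_. 0))"
      using P_in_Sym[OF hP] unfolding Sym_iff
      by (metis comp_assoc comp_id id_comp permutes_inv_o(1))
    then show ?case
      using P_inv[OF hP] sym_group_inv_equality[OF P_in_Sym[OF h]] by simp
  next
    case (eng h1 h2)
    have "h2 \<in> P_group p (k div p)" using eng.hyps(2) by (simp add: P_group_eq[OF p0])
    from comp[OF this, of h1] show ?case
      unfolding sym_group_mult using P_comp[OF eng.IH] by (simp only:)
  qed
qed

text \<open>
  Induction on the sum of the rotations, which are composed of single steps \<open>\<pi>[j]\<close>.
\<close>

lemma base_in_P: "e \<in> shifts p k \<Longrightarrow> wreath p id e \<in> P_group p k"
proof (induction "\<Sum>i\<in>{1..k}. e i" arbitrary: e)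
  case 0
  have "e i = 0" for i
    using 0 by (cases "i \<in> {1..k}") (auto simp: shifts_def)
  then have "e = (\<lambda>_. 0)" by blast
  then have "wreath p id e = id" using wreath_id[OF p0] by (simp only:)
  then show ?case using P_id by (simp only:)
next
  case (Suc n)
  then obtain j where j: "j \<in> {1..k}" "e j > 0"
    by (metis Zero_not_Suc gr0I sum.neutral)
  define e' where "e' = e(j := e j - 1)"
  have e': "e' \<in> shifts p k"
    unfolding shifts_def
  proof (intro CollectI allI conjI impI)
    fix i
    show "e' i < p" using Suc.prems less_imp_diff_less by (auto simp: e'_def shifts_def)
    show "e' i = 0" if "i \<notin> {1..k}" using that Suc.prems j(1) by (auto simp: e'_def shifts_def)
  qed
  have "(\<Sum>i\<in>{1..k}. e i) = e j + (\<Sum>i\<in>{1..k} - {j}. e i)"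
    using j(1) by (intro sum.remove) auto
  moreover have "(\<Sum>i\<in>{1..k}. e' i) = e' j + (\<Sum>i\<in>{1..k} - {j}. e' i)"
    using j(1) by (intro sum.remove) auto
  moreover have "(\<Sum>i\<in>{1..k} - {j}. e' i) = (\<Sum>i\<in>{1..k} - {j}. e i)"
    by (intro sum.cong) (auto simp: e'_def)
  moreover have "e' j = e j - 1" by (simp add: e'_def)
  ultimately have "n = (\<Sum>i\<in>{1..k}. e' i)" using Suc.hyps(2) j(2) by linarith
  then have IH: "wreath p id e' \<in> P_group p k" using e' by (rule Suc.hyps(1))
  have gen: "wreath p id (\<lambda>i. if i = j then 1 else 0) \<in> P_group p k"
  proof (rule P_gen)
    have "perm_blow (p ^ 0) (block_cycle p j) = wreath p id (\<lambda>i. if i = j then 1 else 0)"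
      using perm_blow_1[OF p0, of j] block_cycle_wreath[OF p0, of j] j(1) by (simp only: power_0 atLeastAtMost_iff)
    then show "wreath p id (\<lambda>i. if i = j then 1 else 0) \<in> P_gens p k"
      unfolding P_gens_def using j(1) by (intro CollectI exI[of _ 0] exI[of _ j]) auto
  qed
  have "wreath p id (\<lambda>i. if i = j then 1 else 0) \<circ> wreath p id e' = wreath p id e"
  proof -
    have "(e' i + (if i = j then 1 else 0)) mod p = e i" for i
      using Suc.prems j by (auto simp: e'_def shifts_def)
    moreover have "wreath p id (\<lambda>i. if i = j then 1 else 0) \<circ> wreath p id e' =
        wreath p (id \<circ> id) (\<lambda>i. (e' i + (if id i = j then 1 else 0)) mod p)"
      by (rule wreath_comp[OF p0]) simp
    ultimately show ?thesis by (simp only: id_comp id_apply)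
  qed
  then show ?case using P_comp[OF gen IH] by (simp only:)
qed

text \<open>
  This is the wreath product of a cyclic group of order \<open>p\<close> with the group \<open>P\<close> for \<open>k div p\<close>.
\<close>

definition wreaths :: "nat \<Rightarrow> (nat \<Rightarrow> nat) set" where
  "wreaths k = (\<lambda>(\<sigma>, e). wreath p \<sigma> e) ` (P_group p (k div p) \<times> shifts p k)"

lemma wreathsI: "\<sigma> \<in> P_group p (k div p) \<Longrightarrow> e \<in> shifts p k \<Longrightarrow> wreath p \<sigma> e \<in> wreaths k"
  unfolding wreaths_def by blast

lemma wreathsE:
  assumes "x \<in> wreaths k"
  obtains \<sigma> e where "\<sigma> \<in> P_group p (k div p)" "e \<in> shifts p k" "x = wreath p \<sigma> e"
proof -
  obtain z where z: "z \<in> P_group p (k div p) \<times> shifts p k" "x = (\<lambda>(\<sigma>, e). wreath p \<sigma> e) z"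
    using assms unfolding wreaths_def by (rule imageE)
  then show thesis using that[of "fst z" "snd z"] by (simp add: mem_Times_iff case_prod_beta)
qed

lemma P_base_fix:
  assumes "\<sigma> \<in> P_group p (k div p)"
  shows "i \<notin> {1..k} \<Longrightarrow> \<sigma> i = i" "\<sigma> i \<in> {1..k} \<longleftrightarrow> i \<in> {1..k}"
proof -
  have "\<sigma> \<in> Sym k" using Sym_mono[OF div_mult_le P_in_Sym[OF assms]] .
  then have perm: "\<sigma> permutes {1..k}" by (simp only: Sym_iff)
  show "i \<notin> {1..k} \<Longrightarrow> \<sigma> i = i" by (rule permutes_not_in[OF perm])
  show "\<sigma> i \<in> {1..k} \<longleftrightarrow> i \<in> {1..k}" by (rule permutes_in_image[OF perm])
qed

lemma wreaths_comp:
  assumes "x \<in> wreaths k" "y \<in> wreaths k"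
  shows "x \<circ> y \<in> wreaths k"
proof -
  obtain \<sigma> e where x: "\<sigma> \<in> P_group p (k div p)" "e \<in> shifts p k" "x = wreath p \<sigma> e"
    using wreathsE[OF assms(1)] .
  obtain \<tau> d where y: "\<tau> \<in> P_group p (k div p)" "d \<in> shifts p k" "y = wreath p \<tau> d"
    using wreathsE[OF assms(2)] .
  have "x \<circ> y = wreath p (\<sigma> \<circ> \<tau>) (\<lambda>i. (d i + e (\<tau> i)) mod p)"
    unfolding x(3) y(3) by (rule wreath_comp[OF p0 Sym_pos[OF P_in_Sym[OF y(1)]]])
  moreover have "(\<lambda>i. (d i + e (\<tau> i)) mod p) \<in> shifts p k"
    using x(2) y(2) p0 P_base_fix[OF y(1)] unfolding shifts_def by simp
  ultimately show ?thesis using wreathsI[OF P_comp[OF x(1) y(1)]] by simp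
qed

lemma wreaths_inv:
  assumes "x \<in> wreaths k"
  shows "inv' x \<in> wreaths k"
proof -
  obtain \<sigma> e where x: "\<sigma> \<in> P_group p (k div p)" "e \<in> shifts p k" "x = wreath p \<sigma> e"
    using wreathsE[OF assms] .
  have e: "\<And>i. e i < p" using x(2) by (simp add: shifts_def)
  let ?e = "\<lambda>i. (p - e (inv' \<sigma> i)) mod p"
  have "wreath p (inv' \<sigma>) ?e \<circ> x = id"
    unfolding x(3) by (rule wreath_left_inverse[OF p0 P_in_Sym[OF x(1)] e])
  moreover have "x permutes {1..k * p}"
    using wreath_in_Sym[OF p0 Sym_mono[OF div_mult_le P_in_Sym[OF x(1)]] order_refl x(2)]
    unfolding x(3) Sym_iff .
  ultimately have "inv' x = wreath p (inv' \<sigma>) ?e"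
    by (metis comp_assoc comp_id id_comp permutes_inv_o(1))
  moreover have "?e \<in> shifts p k"
    using x(2) p0 P_base_fix[OF P_inv[OF x(1)]] unfolding shifts_def by simp
  ultimately show ?thesis using wreathsI[OF P_inv[OF x(1)]] by simp
qed

text \<open>
  The set \<open>wreaths k\<close> is a group that contains the generators. Conversely, each of its elements is a blown up element
  of the smaller group followed by rotations of single blocks.
\<close>

lemma P_group_wreath: "P_group p k = wreaths k"
proof
  show "wreaths k \<subseteq> P_group p k"
  proof
    fix x assume "x \<in> wreaths k"
    then obtain \<sigma> e where x: "\<sigma> \<in> P_group p (k div p)" "e \<in> shifts p k" "x = wreath p \<sigma> e"
      by (rule wreathsE)
    have e: "\<And>i. e i < p" "\<And>i. i \<notin> {1..k} \<Longrightarrow> e i = 0" using x(2) by (simp_all add: shifts_def)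
    define e' where "e' = (\<lambda>i. e (inv' \<sigma> i))"
    have perm: "inv' \<sigma> (\<sigma> i) = i" for i
      using P_in_Sym[OF x(1)] unfolding Sym_iff by (simp add: permutes_inverses)
    have "e' \<in> shifts p k"
      using e P_base_fix[OF P_inv[OF x(1)]] unfolding shifts_def e'_def by simp
    then have "wreath p id e' \<circ> wreath p \<sigma> (\<lambda>_. 0) \<in> P_group p k"
      using P_comp base_in_P blow_in_P x(1) by blast
    also have "wreath p id e' \<circ> wreath p \<sigma> (\<lambda>_. 0) = wreath p (id \<circ> \<sigma>) (\<lambda>i. (0 + e' (\<sigma> i)) mod p)"
      by (rule wreath_comp[OF p0 Sym_pos[OF P_in_Sym[OF x(1)]]])
    also have "\<dots> = x" unfolding x(3) e'_def perm using e(1) by simp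
    finally show "x \<in> P_group p k" .
  qed
  show "P_group p k \<subseteq> wreaths k"
  proof
    fix x assume "x \<in> P_group p k"
    then show "x \<in> wreaths k"
      unfolding P_group_eq[OF p0]
    proof (induction rule: generate.induct)
      case one
      have "wreath p id (\<lambda>_. 0) \<in> wreaths k" by (rule wreathsI[OF P_id zero_shifts[OF p0]])
      then show ?case unfolding sym_group_one wreath_id[OF p0] .
    next
      case (incl h)
      from p0 incl show ?case
      proof (cases rule: P_gens_cases)
        case (cycle j)
        then show ?thesis using wreathsI[OF P_id single_shift[OF p1]] by (simp only:)
      next
        case (blow y)
        then show ?thesis using wreathsI[OF P_gen zero_shifts[OF p0]] by (simp only:)
      qed
    next
      case (inv h)
      from p0 inv have "h \<in> wreaths k"
      proof (cases rule: P_gens_cases)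
        case (cycle j)
        then show ?thesis using wreathsI[OF P_id single_shift[OF p1]] by (simp only:)
      next
        case (blow y)
        then show ?thesis using wreathsI[OF P_gen zero_shifts[OF p0]] by (simp only:)
      qed
      then show ?case
        unfolding sym_group_inv_equality[OF P_gens_in_Sym[OF p1 inv]] by (rule wreaths_inv)
    next
      case (eng h1 h2)
      show ?case unfolding sym_group_mult by (rule wreaths_comp) (fact eng)+
    qed
  qed
qed

lemma card_shifts: "card (shifts p k) = p ^ k" and finite_shifts: "finite (shifts p k)"
proof -
  have bij: "bij_betw (\<lambda>e. restrict e {1..k}) (shifts p k) (PiE {1..k} (\<lambda>_. {..<p}))"
  proof (rule bij_betw_byWitness[where f' = "\<lambda>f i. if i \<in> {1..k} then f i else 0"])
    show "\<forall>e\<in>shifts p k. (\<lambda>i. if i \<in> {1..k} then restrict e {1..k} i else 0) = e"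
      by (auto simp: shifts_def fun_eq_iff)
    show "\<forall>f\<in>{1..k} \<rightarrow>\<^sub>E {..<p}. restrict (\<lambda>i. if i \<in> {1..k} then f i else 0) {1..k} = f"
      by (auto simp: fun_eq_iff PiE_def extensional_def)
    show "(\<lambda>e. restrict e {1..k}) ` shifts p k \<subseteq> {1..k} \<rightarrow>\<^sub>E {..<p}"
      by (auto simp: shifts_def)
    show "(\<lambda>f i. if i \<in> {1..k} then f i else 0) ` ({1..k} \<rightarrow>\<^sub>E {..<p}) \<subseteq> shifts p k"
      using p0 by (auto simp: shifts_def PiE_def Pi_def)
  qed
  show "card (shifts p k) = p ^ k"
    using bij_betw_same_card[OF bij] by (simp add: card_PiE)
  show "finite (shifts p k)"
    using bij_betw_finite[OF bij] by (simp add: finite_PiE)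
qed

lemma card_P_rec: "card (P_group p k) = p ^ k * card (P_group p (k div p))"
proof -
  have inj: "inj_on (\<lambda>(\<sigma>, e). wreath p \<sigma> e) (P_group p (k div p) \<times> shifts p k)"
  proof (rule inj_onI, clarify)
    fix \<sigma> e \<sigma>' e'
    assume *: "\<sigma> \<in> P_group p (k div p)" "\<sigma>' \<in> P_group p (k div p)" "e \<in> shifts p k" "e' \<in> shifts p k"
      "wreath p \<sigma> e = wreath p \<sigma>' e'"
    have "e 0 = e' 0" using *(3,4) by (simp add: shifts_def)
    then show "\<sigma> = \<sigma>' \<and> e = e'"
      using *(3,4) by (intro wreath_inject[OF p0 P_in_Sym[OF *(1)] P_in_Sym[OF *(2)] _ _ _ *(5)]) (auto simp: shifts_def)
  qed
  have "card (P_group p k) = card (P_group p (k div p) \<times> shifts p k)"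
    using P_group_wreath[of k] card_image[OF inj] unfolding wreaths_def by (simp only:)
  then show ?thesis by (simp add: card_cartesian_product card_shifts)
qed

lemma card_P_0: "card (P_group p 0) = 1"
proof -
  have "P_group p 0 \<subseteq> {id}"
    using P_in_Sym[of _ 0] by (auto simp: Sym_iff)
  then have "P_group p 0 = {id}" using P_id by blast
  then show ?thesis by simp
qed

text \<open>
  The factors after the last multiple of \<open>p\<close> are prime to \<open>p\<close>.
\<close>

lemma multiplicity_fact_div: "multiplicity p (fact k) = multiplicity p (fact ((k div p) * p) :: nat)"
proof -
  have "multiplicity p (fact ((k div p) * p + r) :: nat) = multiplicity p (fact ((k div p) * p) :: nat)" if "r < p" for r
    using that
  proof (induction r)
    case (Suc r)
    have "\<not> p dvd (k div p) * p + Suc r"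
      using Suc.prems by (simp add: dvd_add_right_iff nat_dvd_not_less del: add_Suc_right)
    then have "multiplicity p ((k div p) * p + Suc r) = 0" by (rule not_dvd_imp_multiplicity_0)
    then have "multiplicity p (((k div p) * p + Suc r) * fact ((k div p) * p + r) :: nat) = multiplicity p (fact ((k div p) * p + r) :: nat)"
      using prime_elem_multiplicity_mult_distrib[OF prime_imp_prime_elem[OF prime_p],
          of "(k div p) * p + Suc r" "fact ((k div p) * p + r)"] by (simp only: fact_nonzero) simp
    then show ?case using Suc by simp
  qed simp
  from this[of "k mod p"] show ?thesis using p0 by simp
qed

lemma multiplicity_fact_mult: "multiplicity p (fact (k * p) :: nat) = k + multiplicity p (fact k :: nat)"
proof (induction k)
  case (Suc k)
  have "(Suc k * p - 1) div p = k"
  proof -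
    have "Suc k * p - 1 = (p - 1) + k * p" using p0 by simp
    moreover have "((p - 1) + k * p) div p = k" by (subst div_mult_self1) (use p0 in auto)
    ultimately show ?thesis by (simp only:)
  qed
  then have 1: "multiplicity p (fact (Suc k * p - 1) :: nat) = multiplicity p (fact (k * p) :: nat)"
    using multiplicity_fact_div[of "Suc k * p - 1"] by simp
  have "(fact (Suc k * p) :: nat) = (Suc k * p) * fact (Suc k * p - 1)"
    using p0 by (subst fact_reduce) auto
  moreover have mult: "multiplicity p (a * b) = multiplicity p a + multiplicity p b" if "a \<noteq> 0" "b \<noteq> 0" for a b :: nat
    using prime_elem_multiplicity_mult_distrib[OF prime_imp_prime_elem[OF prime_p] that] .
  ultimately have "multiplicity p (fact (Suc k * p) :: nat) = multiplicity p (Suc k * p) + multiplicity p (fact (Suc k * p - 1) :: nat)"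
    using p0 by simp
  moreover have "multiplicity p (Suc k * p) = multiplicity p (Suc k) + 1"
    using mult[of "Suc k" p] p0 p1 multiplicity_self[of p] by simp
  moreover have "multiplicity p (fact (Suc k) :: nat) = multiplicity p (Suc k) + multiplicity p (fact k :: nat)"
    using mult[of "Suc k" "fact k"] by simp
  ultimately show ?case using Suc 1 by linarith
qed simp

text \<open>
  The order and the exponent of \<open>p\<close> in the factorial satisfy the same recursion, from \<open>k\<close> to \<open>k div p\<close>.
\<close>

lemma card_P: "card (P_group p k) = p ^ multiplicity p (fact (k * p) :: nat)"
proof (induction k rule: less_induct)
  case (less k)
  show ?case
  proof (cases "k = 0")
    case False
    then have "k div p < k" using p1 by simp
    then have "card (P_group p (k div p)) = p ^ multiplicity p (fact ((k div p) * p) :: nat)"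
      by (rule less.IH)
    then show ?thesis
      unfolding card_P_rec[of k] multiplicity_fact_mult[of k] multiplicity_fact_div[of k] power_add by simp
  qed (simp add: card_P_0)
qed

lemma card_P_le: "card (P_group p k) \<le> p ^ (2 * k)"
proof (induction k rule: less_induct)
  case (less k)
  show ?case
  proof (cases "k = 0")
    case False
    then have "k div p < k" using p1 by simp
    then have "card (P_group p k) \<le> p ^ k * p ^ (2 * (k div p))"
      unfolding card_P_rec[of k] by (intro mult_le_mono2 less.IH)
    also have "\<dots> \<le> p ^ k * p ^ k"
    proof -
      have "2 * (k div p) \<le> p * (k div p)" using p1 by (intro mult_le_mono1) simp
      also have "\<dots> \<le> k" by simp
      finally show ?thesis using p1 by (intro mult_le_mono2 power_increasing) auto
    qed
    finally show ?thesis by (simp add: power_add[symmetric] mult_2)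
  qed (simp add: card_P_0)
qed

lemma p_group_P: "p_group (P_group p k) p"
proof
  show "finite (P_group p k)"
    using P_in_Sym finite_Sym by (meson finite_subset subsetI)
  show "\<exists>e. card (P_group p k) = p ^ e" using card_P by blast
  show "bij g" if "g \<in> P_group p k" for g
    using P_in_Sym[OF that] unfolding Sym_iff by (rule permutes_bij)
qed (use P_id P_comp P_inv prime_p in auto)

end

section \<open>The Lie module over the Sylow subgroup\<close>

lemma word_comp: "word n (g \<circ> \<rho>) = map g (word n \<rho>)"
  by (simp add: word_def)

lemma ga_act_apply:
  "g \<in> Sym n \<Longrightarrow> ga_act n w g \<rho> = (if \<rho> \<in> Sym n then w (inv' g \<circ> \<rho>) else 0)"
  unfolding ga_act_def by (rule Sym.ga_mult_of_right)

lemma ga_act_lie_fun: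
  assumes g: "g \<in> Sym n"
  shows "ga_act n (lie_fun n X) g = lie_fun n (\<lambda>l. X (map (inv' g) l))"
proof
  fix \<rho> show "ga_act n (lie_fun n X) g \<rho> = lie_fun n (\<lambda>l. X (map (inv' g) l)) \<rho>"
  proof (cases "\<rho> \<in> Sym n")
    case True
    then have "inv' g \<circ> \<rho> \<in> Sym n" using Sym.comp_inv_left_iff[OF g] by blast
    then show ?thesis using True
      unfolding ga_act_apply[OF g] lie_fun_def word_comp eval_bracket_map by (simp only: if_True)
  next
    case False
    then show ?thesis unfolding ga_act_apply[OF g] lie_fun_def by (simp only: if_False)
  qed
qed

context sylow
begin

text \<open>
  An element \<open>g\<close> acts on \<open>Lie n\<close> through functionals: the letters of a word are replaced by their images under the inverse of
  \<open>g\<close> before the functional is applied.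
\<close>

lemma pmodule_Lie:
  assumes "CHAR('a::field) = p" "1 \<le> k"
  shows "pmodule (P_group p k) p (ga_act (k * p)) (Lie (k * p) :: ((nat \<Rightarrow> nat) \<Rightarrow> 'a) set)"
proof -
  let ?n = "k * p"
  have n: "1 \<le> ?n" using assms(2) p0 by simp
  interpret P: p_group "P_group p k" p by (rule p_group_P)
  show ?thesis
  proof
    show "fv.subspace (Lie ?n :: ((nat \<Rightarrow> nat) \<Rightarrow> 'a) set)" by (rule subspace_Lie[OF n])
    show "fin_dim (Lie ?n :: ((nat \<Rightarrow> nat) \<Rightarrow> 'a) set)" by (rule fin_dim_Lie[OF n])
    show "lin_on (Lie ?n :: ((nat \<Rightarrow> nat) \<Rightarrow> 'a) set) (\<lambda>x. ga_act ?n x g)" if "g \<in> P_group p k" for g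
      unfolding lin_on_def
      by (intro conjI ballI allI ext) (simp_all add: ga_act_apply[OF P_in_Sym[OF that]] fscale_def)
    show "ga_act ?n x g \<in> Lie ?n" if "g \<in> P_group p k" "x \<in> Lie ?n" for g and x :: "(nat \<Rightarrow> nat) \<Rightarrow> 'a"
    proof -
      obtain X where "x = lie_fun ?n X" using \<open>x \<in> Lie ?n\<close> unfolding Lie_eq[OF n] by blast
      then show ?thesis unfolding Lie_eq[OF n] using ga_act_lie_fun[OF P_in_Sym[OF that(1)]] by blast
    qed
    show "ga_act ?n x id = x" if "x \<in> Lie ?n" for x :: "(nat \<Rightarrow> nat) \<Rightarrow> 'a"
    proof -
      obtain X where X: "x = lie_fun ?n X" using \<open>x \<in> Lie ?n\<close> unfolding Lie_eq[OF n] by blast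
      show ?thesis unfolding X ga_act_lie_fun[OF id_in_Sym] inv_id by simp
    qed
    show "ga_act ?n (ga_act ?n x g) h = ga_act ?n x (h \<circ> g)"
      if "x \<in> Lie ?n" "g \<in> P_group p k" "h \<in> P_group p k" for g h and x :: "(nat \<Rightarrow> nat) \<Rightarrow> 'a"
    proof -
      obtain X where X: "x = lie_fun ?n X" using \<open>x \<in> Lie ?n\<close> unfolding Lie_eq[OF n] by blast
      have "inv' (h \<circ> g) = inv' g \<circ> inv' h" using P.inv_comp that(2,3) by blast
      then show ?thesis
        unfolding X ga_act_lie_fun[OF P_in_Sym[OF that(2)]] ga_act_lie_fun[OF P_in_Sym[OF that(3)]]
          ga_act_lie_fun[OF P_in_Sym[OF P_comp[OF that(3,2)]]]
        by (simp add: comp_assoc)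
    qed
  qed (rule assms(1))
qed

lemma pf_dim_Lie:
  assumes "CHAR('a::field) = p" "1 \<le> k"
  shows "pf_dim (P_group p k) (ga_act (k * p)) (Lie (k * p) :: ((nat \<Rightarrow> nat) \<Rightarrow> 'a) set) +
    card (P_group p k) * fv.dim (norm_map (P_group p k) (ga_act (k * p)) ` (Lie (k * p) :: ((nat \<Rightarrow> nat) \<Rightarrow> 'a) set))
    = fact (k * p - 1)"
proof -
  have n: "1 \<le> k * p" using assms(2) p0 by simp
  show ?thesis
    using pmodule.pf_dim_eq[OF pmodule_Lie[OF assms]] dim_Lie[OF n, where ?'a = 'a] by simp
qed

text \<open>
  If \<open>p ^ v\<close> is the exact power of \<open>p\<close> in \<open>(k p - 1)!\<close> then \<open>|P| = p ^ (v + 1)\<close>, because \<open>k p\<close> contributes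
  exactly one factor \<open>p\<close>. So \<open>pf_dim_Lie\<close> leaves a remainder that is divisible by \<open>p ^ v\<close> and not zero.
\<close>

lemma pf_dim_Lie_ge:
  assumes "CHAR('a::field) = p" "1 \<le> k" "\<not> p dvd k"
  shows "p ^ (k - 1) \<le> pf_dim (P_group p k) (ga_act (k * p)) (Lie (k * p) :: ((nat \<Rightarrow> nat) \<Rightarrow> 'a) set)"
    (is "_ \<le> ?d")
proof -
  define v where "v = multiplicity p (fact (k * p - 1) :: nat)"
  have "(fact (k * p) :: nat) = (k * p) * fact (k * p - 1)"
    using p0 assms(2) by (subst fact_reduce) auto
  then have "multiplicity p (fact (k * p) :: nat) = multiplicity p (k * p) + v"
    unfolding v_def
    using prime_elem_multiplicity_mult_distrib[OF prime_imp_prime_elem[OF prime_p], of "k * p" "fact (k * p - 1)"]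
      p0 assms(2) by simp
  moreover have "multiplicity p (k * p) = 1"
    using prime_elem_multiplicity_mult_distrib[OF prime_imp_prime_elem[OF prime_p], of k p]
      p0 p1 assms(2) multiplicity_self[of p] not_dvd_imp_multiplicity_0[OF assms(3)] by simp
  ultimately have v1: "multiplicity p (fact (k * p) :: nat) = Suc v" by simp
  then have card: "card (P_group p k) = p ^ Suc v" using card_P by simp
  have "k \<le> Suc v" using v1 multiplicity_fact_mult[of k] by simp
  have not_dvd: "\<not> p ^ Suc v dvd (fact (k * p - 1) :: nat)"
  proof
    assume "p ^ Suc v dvd (fact (k * p - 1) :: nat)"
    then have "Suc v \<le> v"
      unfolding v_def using p1 by (intro multiplicity_geI) auto
    then show False by simp
  qed
  have dvd: "p ^ v dvd (fact (k * p - 1) :: nat)"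
    unfolding v_def by (rule multiplicity_dvd)
  obtain r where r: "?d + p ^ Suc v * r = fact (k * p - 1)"
    using pf_dim_Lie[OF assms(1,2)] unfolding card by blast
  have "p ^ v dvd ?d"
    using dvd unfolding r[symmetric] by (simp add: dvd_add_left_iff)
  moreover have "?d \<noteq> 0"
  proof
    assume "?d = 0"
    then have "(fact (k * p - 1) :: nat) = p ^ Suc v * r" using r by simp
    then show False using not_dvd by (metis dvd_triv_left)
  qed
  ultimately have "p ^ v \<le> ?d" by (intro dvd_imp_le) auto
  moreover have "p ^ (k - 1) \<le> p ^ v"
    using \<open>k \<le> Suc v\<close> p1 by (intro power_increasing) auto
  ultimately show ?thesis by simp
qed

end

section \<open>Products of brackets\<close>

text \<open>
  The value of \<open>X\<close> at the associative product of the left-normed brackets of the blocks in a list.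
\<close>

fun bracket_prod :: "('b list \<Rightarrow> 'a::comm_ring_1) \<Rightarrow> 'b list list \<Rightarrow> 'a" where
  "bracket_prod X [] = X []"
| "bracket_prod X (z # zs) = eval_bracket (\<lambda>x. bracket_prod (\<lambda>t. X (x @ t)) zs) z"

lemma bracket_prod_diff: "bracket_prod (\<lambda>x. X x - Y x) zs = bracket_prod X zs - bracket_prod Y zs"
  by (induction zs arbitrary: X Y) (simp_all add: eval_bracket_diff)

lemma bracket_prod_add: "bracket_prod (\<lambda>x. X x + Y x) zs = bracket_prod X zs + bracket_prod Y zs"
  by (induction zs arbitrary: X Y) (simp_all add: eval_bracket_add)

lemma bracket_prod_scale: "bracket_prod (\<lambda>x. s * X x) zs = s * bracket_prod X zs"
  by (induction zs arbitrary: X) (simp_all add: eval_bracket_scale)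

lemma bracket_prod_zero: "bracket_prod (\<lambda>x. 0) zs = 0"
  by (induction zs) (simp_all add: eval_bracket_zero)

lemma bracket_prod_sum:
  "finite I \<Longrightarrow> bracket_prod (\<lambda>x. \<Sum>i\<in>I. X i x) zs = (\<Sum>i\<in>I. bracket_prod (X i) zs)"
  by (induction I rule: finite_induct) (simp_all add: bracket_prod_zero bracket_prod_add)

lemma bracket_prod_map: "bracket_prod X (map (map f) zs) = bracket_prod (\<lambda>l. X (map f l)) zs"
  by (induction zs arbitrary: X) (simp_all add: eval_bracket_map)

lemma eval_bracket_swap: "eval_bracket (\<lambda>x. eval_bracket (\<lambda>y. Y x y) z) w = eval_bracket (\<lambda>y. eval_bracket (\<lambda>x. Y x y) w) z"
proof (induction w arbitrary: Y rule: eval_bracket_induct)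
  case empty
  then show ?case by (simp add: eval_bracket_zero)
next
  case (single a)
  then show ?case by simp
next
  case (snoc w c)
  have "eval_bracket (\<lambda>x. eval_bracket (Y x) z) (w @ [c]) = eval_bracket (\<lambda>x. eval_bracket (\<lambda>y. Y (x @ [c]) y - Y (c # x) y) z) w"
    unfolding eval_bracket_snoc[OF snoc.hyps] coad_def eval_bracket_diff ..
  also have "\<dots> = eval_bracket (\<lambda>y. eval_bracket (\<lambda>x. Y (x @ [c]) y - Y (c # x) y) w) z"
    by (rule snoc.IH)
  also have "\<dots> = eval_bracket (\<lambda>y. eval_bracket (\<lambda>x. Y x y) (w @ [c])) z"
    unfolding eval_bracket_snoc[OF snoc.hyps] coad_def ..
  finally show ?case .
qed

lemma eval_bracket_bracket_prod_swap:
  "eval_bracket (\<lambda>x. bracket_prod (Y x) zs) w = bracket_prod (\<lambda>t. eval_bracket (\<lambda>x. Y x t) w) zs"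
proof (induction zs arbitrary: Y)
  case (Cons z zs)
  have "eval_bracket (\<lambda>x. bracket_prod (Y x) (z # zs)) w =
      eval_bracket (\<lambda>s. eval_bracket (\<lambda>x. bracket_prod (\<lambda>t. Y x (s @ t)) zs) w) z"
    unfolding bracket_prod.simps by (rule eval_bracket_swap)
  also have "\<dots> = bracket_prod (\<lambda>t. eval_bracket (\<lambda>x. Y x t) w) (z # zs)"
    unfolding bracket_prod.simps Cons.IH ..
  finally show ?case .
qed simp

lemma bracket_prod_snoc:
  "bracket_prod X (zs @ [z]) = bracket_prod (\<lambda>t. eval_bracket (\<lambda>x. X (t @ x)) z) zs"
  by (induction zs arbitrary: X) simp_all

text \<open>
  A list of blocks is a word whose letters are blocks. This equation says that bracketing with a new letter on that level is
  bracketing with the bracket of the block below.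
\<close>

lemma coad_bracket_prod: "coad z (bracket_prod X) zs = bracket_prod (coad_bracket z X) zs"
  unfolding coad_def coad_bracket_def bracket_prod_snoc bracket_prod_diff bracket_prod.simps eval_bracket_bracket_prod_swap ..

text \<open>
  The term \<open>eval_bracket (bracket_prod X) zs\<close> is the value of \<open>X\<close> at the left-normed bracket of the brackets of
  the blocks. Since this is a Lie element, it is determined by the values on left-normed brackets of letters.
\<close>

lemma eval_bracket_bracket_prod_eq_0:
  assumes "\<And>y. mset y = mset (concat zs) \<Longrightarrow> eval_bracket X y = 0" "zs \<noteq> []" "\<And>z. z \<in> set zs \<Longrightarrow> z \<noteq> []"
  shows "eval_bracket (bracket_prod X) zs = 0"
  using assms
proof (induction zs arbitrary: X rule: eval_bracket_induct)
  case (single z)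
  then show ?case using single.prems(1)[of z] by simp
next
  case (snoc zs z)
  have "eval_bracket (bracket_prod X) (zs @ [z]) = eval_bracket (bracket_prod (coad_bracket z X)) zs"
    unfolding eval_bracket_snoc[OF snoc.hyps] coad_bracket_prod[abs_def] ..
  also have "\<dots> = 0"
  proof (rule snoc.IH[OF _ snoc.hyps])
    fix y assume y: "mset y = mset (concat zs)"
    show "eval_bracket (coad_bracket z X) y = 0"
    proof (rule eval_bracket_coad_bracket_eq_0)
      show "z \<noteq> []" using snoc.prems(3) by simp
      obtain z1 zs1 where "zs = z1 # zs1" "z1 \<noteq> []"
        using snoc.hyps snoc.prems(3) by (cases zs) auto
      then have "mset (concat zs) \<noteq> {#}" by simp
      then show "y \<noteq> []" using y by auto
      fix z' assume "mset z' = mset z"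
      then show "eval_bracket X (y @ z') = 0" using y by (intro snoc.prems(1)) simp
    qed
  next
    fix z' assume "z' \<in> set zs"
    then show "z' \<noteq> []" using snoc.prems(3) by simp
  qed
  finally show ?case .
qed simp

section \<open>Words cut into blocks\<close>

text \<open>
  In Lazard elimination with respect to the letters outside \<open>A\<close>, the brackets of such blocks are the free
  generators of the ideal generated by \<open>A\<close>.
\<close>

definition block :: "'b set \<Rightarrow> 'b list \<Rightarrow> bool" where
  "block A z \<longleftrightarrow> z \<noteq> [] \<and> hd z \<in> A \<and> set (tl z) \<inter> A = {}"

lemma blockE:
  assumes "block A z"
  obtains a u where "z = a # u" "a \<in> A" "set u \<inter> A = {}"
  using assms by (cases z) (auto simp: block_def)

definition late :: "'b set \<Rightarrow> 'b list \<Rightarrow> nat" where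
  "late A x = size (filter_mset (\<lambda>c. c \<notin> A) (mset x))"

definition heads :: "'b set \<Rightarrow> 'b list \<Rightarrow> nat" where
  "heads A x = size (filter_mset (\<lambda>c. c \<in> A) (mset x))"

text \<open>
  The number of pairs of a letter outside \<open>A\<close> and a later letter in \<open>A\<close>. It detects the leading term of a product of
  brackets of blocks: in the bracket of a block, only the block itself has disorder \<open>0\<close>.
\<close>

fun disorder :: "'b set \<Rightarrow> 'b list \<Rightarrow> nat" where
  "disorder A [] = 0"
| "disorder A (c # x) = (if c \<in> A then 0 else heads A x) + disorder A x"

lemma heads_append: "heads A (x @ y) = heads A x + heads A y"
  by (simp add: heads_def)

lemma disorder_append: "disorder A (x @ y) = disorder A x + disorder A y + late A x * heads A y"
  by (induction x) (simp_all add: heads_append late_def add_mult_distrib)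

lemma disorder_block_0:
  assumes "set u \<inter> A = {}"
  shows "disorder A (a # u) = (if a \<in> A then 0 else heads A u)"
proof -
  have "disorder A u = 0 \<and> heads A u = 0"
    using assms by (induction u) (auto simp: heads_def)
  then show ?thesis by simp
qed

text \<open>
  Every term of the product other than the concatenation of the blocks moves some letter outside \<open>A\<close> in front of the
  letter of \<open>A\<close> in its block and thus has a larger disorder. Between different blocks, the contribution to the
  disorder depends on the contents of the blocks only.
\<close>

lemma bracket_prod_leading:
  assumes "\<And>z. z \<in> set zs \<Longrightarrow> block A z"
    and "\<And>x. mset x = mset (concat zs) \<Longrightarrow> disorder A (concat zs) < disorder A x \<Longrightarrow> X x = 0"
  shows "bracket_prod X zs = X (concat zs)"
  using assms
proof (induction zs arbitrary: X)
  case (Cons z zs)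
  obtain a u where z: "z = a # u" "a \<in> A" "set u \<inter> A = {}"
    using blockE[OF Cons.prems(1)[of z]] by auto
  have dz: "disorder A z = 0" unfolding z(1) disorder_block_0[OF z(3)] using z(2) by simp
  have eq: "bracket_prod (\<lambda>t. X (x @ t)) zs = X (x @ concat zs)" if x: "mset x = mset z" for x
  proof (rule Cons.IH)
    fix z' assume "z' \<in> set zs" then show "block A z'" using Cons.prems(1) by simp
  next
    fix t assume t: "mset t = mset (concat zs)" "disorder A (concat zs) < disorder A t"
    have l: "late A x = late A z" "heads A t = heads A (concat zs)"
      using x t(1) by (simp_all add: late_def heads_def)
    show "X (x @ t) = 0"
    proof (rule Cons.prems(2))
      show "mset (x @ t) = mset (concat (z # zs))" using x t(1) by simp
      show "disorder A (concat (z # zs)) < disorder A (x @ t)"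
        using t(2) by (simp add: disorder_append dz l)
    qed
  qed
  have "eval_bracket (\<lambda>x. bracket_prod (\<lambda>t. X (x @ t)) zs) (a # u) = bracket_prod (\<lambda>t. X ((a # u) @ t)) zs"
  proof (rule eval_bracket_leading)
    show "a \<notin> set u" using z by auto
    fix x assume x: "mset x = mset (a # u)" "hd x \<noteq> a"
    have "x \<noteq> []" using x(1) by auto
    then obtain b y where b: "x = b # y" by (cases x) auto
    have "b \<noteq> a" using x(2) b by simp
    have "b \<in># mset (a # u)" "a \<in># mset x" using x(1) b by (metis list.set_intros(1) set_mset_mset, simp)
    then have "b \<in> set u" "a \<in> set y" using \<open>b \<noteq> a\<close> b by auto
    then have "b \<notin> A" using z(3) by blast
    have "a \<in># filter_mset (\<lambda>c. c \<in> A) (mset y)" using \<open>a \<in> set y\<close> z(2) by simp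
    then have "heads A y > 0" unfolding heads_def by (metis empty_iff gr0I set_mset_empty size_eq_0_iff_empty)
    then have "0 < disorder A x" unfolding b using \<open>b \<notin> A\<close> by simp
    have "bracket_prod (\<lambda>t. X (x @ t)) zs = X (x @ concat zs)" by (rule eq) (simp add: x(1) z(1))
    also have "\<dots> = 0"
    proof (rule Cons.prems(2))
      show "mset (x @ concat zs) = mset (concat (z # zs))" using x(1) z(1) by simp
      have "late A x = late A z" using x(1) z(1) by (simp add: late_def)
      then show "disorder A (concat (z # zs)) < disorder A (x @ concat zs)"
        using \<open>0 < disorder A x\<close> by (simp add: disorder_append dz)
    qed
    finally show "bracket_prod (\<lambda>t. X (x @ t)) zs = 0" .
  qed
  also have "\<dots> = X (concat (z # zs))" using eq[of z] z(1) by simp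
  finally show ?case unfolding bracket_prod.simps z(1) .
qed simp

lemma concat_blocks_inject:
  assumes "\<And>z. z \<in> set zs \<Longrightarrow> block A z" "\<And>z. z \<in> set zs' \<Longrightarrow> block A z" "concat zs = concat zs'"
  shows "zs = zs'"
  using assms
proof (induction zs arbitrary: zs')
  case Nil
  then show ?case by (cases zs') (auto simp: block_def)
next
  case (Cons z zs)
  have nonempty: "z \<noteq> []" using Cons.prems(1)[of z] by (simp add: block_def)
  then obtain z' ws where zs': "zs' = z' # ws"
    using Cons.prems(3) by (cases zs') auto
  obtain a u where z: "z = a # u" "a \<in> A" "set u \<inter> A = {}"
    using blockE[OF Cons.prems(1)[of z]] by auto
  obtain a' u' where z': "z' = a' # u'" "a' \<in> A" "set u' \<inter> A = {}"
    using blockE[OF Cons.prems(2)[of z']] zs' by auto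
  have tw: "takeWhile (\<lambda>c. c \<notin> A) (v @ concat ys) = v"
    if "set v \<inter> A = {}" "\<And>y. y \<in> set ys \<Longrightarrow> block A y" for v ys
  proof -
    have "takeWhile (\<lambda>c. c \<notin> A) (concat ys) = []"
      using that(2) by (cases ys) (force elim!: blockE)+
    then show ?thesis using that(1) by (subst takeWhile_append2) auto
  qed
  have eq: "u @ concat zs = u' @ concat ws" "a = a'"
    using Cons.prems(3) unfolding zs' z(1) z'(1) by simp_all
  have "u = u'"
    using tw[OF z(3), of zs] tw[OF z'(3), of ws] Cons.prems(1,2) eq(1) zs' by simp
  moreover from this have "zs = ws"
    using eq Cons.prems(1,2) zs' by (intro Cons.IH) auto
  ultimately show ?case using eq zs' z z' by simp
qed

lemma split_into_blocks:
  assumes "x = [] \<or> hd x \<in> A"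
  shows "\<exists>zs. (\<forall>z\<in>set zs. block A z) \<and> concat zs = x"
  using assms
proof (induction "length x" arbitrary: x rule: less_induct)
  case less
  show ?case
  proof (cases x)
    case Nil
    then show ?thesis by (intro exI[of _ "[]"]) simp
  next
    case (Cons a y)
    let ?u = "takeWhile (\<lambda>c. c \<notin> A) y" and ?r = "dropWhile (\<lambda>c. c \<notin> A) y"
    have "length ?r < length x" unfolding Cons by (simp add: less_Suc_eq_le length_dropWhile_le)
    moreover have "?r = [] \<or> hd ?r \<in> A" using hd_dropWhile[of "\<lambda>c. c \<notin> A" y] by blast
    ultimately obtain zs where zs: "\<forall>z\<in>set zs. block A z" "concat zs = ?r"
      using less.hyps by blast
    have "block A (a # ?u)" using less.prems Cons by (auto simp: block_def dest: set_takeWhileD)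
    then show ?thesis using zs Cons by (intro exI[of _ "(a # ?u) # zs"]) simp
  qed
qed

lemma filter_concat_blocks:
  assumes "\<And>z. z \<in> set zs \<Longrightarrow> block A z"
  shows "filter (\<lambda>c. c \<in> A) (concat zs) = map hd zs"
    "filter (\<lambda>c. c \<notin> A) (concat zs) = concat (map tl zs)"
proof -
  have 1: "filter (\<lambda>c. c \<in> A) z = [hd z] \<and> filter (\<lambda>c. c \<notin> A) z = tl z" if "block A z" for z
  proof -
    from that obtain a u where z: "z = a # u" "a \<in> A" "set u \<inter> A = {}" by (rule blockE)
    then show ?thesis by (auto simp: filter_empty_conv filter_id_conv)
  qed
  then show "filter (\<lambda>c. c \<in> A) (concat zs) = map hd zs"
    using assms by (induction zs) auto
  show "filter (\<lambda>c. c \<notin> A) (concat zs) = concat (map tl zs)"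
    using 1 assms by (induction zs) auto
qed

text \<open>
  By the previous lemma, the matrix of the products of brackets in terms of words is unitriangular for the order by
  disorder. The values of \<open>X\<close> can therefore be chosen one disorder after the other, from the largest one down.
\<close>

lemma bracket_prod_surjective:
  assumes fin: "finite \<Omega>" and blocks: "\<And>zs z. zs \<in> \<Omega> \<Longrightarrow> z \<in> set zs \<Longrightarrow> block A z"
  shows "\<exists>X. \<forall>zs\<in>\<Omega>. bracket_prod X zs = (h zs :: 'a::comm_ring_1)"
proof -
  let ?d = "\<lambda>zs. disorder A (concat zs)"
  have inj: "zs = zs'" if "zs \<in> \<Omega>" "zs' \<in> \<Omega>" "concat zs = concat zs'" for zs zs'
    using concat_blocks_inject[of zs A zs'] that blocks by blast
  define M where "M = Suc (Max (insert 0 (?d ` \<Omega>)))"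
  have M: "?d zs < M" if "zs \<in> \<Omega>" for zs
    unfolding M_def using fin that by (simp add: less_Suc_eq_le)
  have "\<exists>X. \<forall>zs\<in>\<Omega>. m \<le> ?d zs \<longrightarrow> bracket_prod X zs = h zs" if "m \<le> M" for m
    using that
  proof (induction m rule: inc_induct)
    case base
    then show ?case using M by (auto simp: not_le[symmetric])
  next
    case (step m)
    then obtain X where X: "\<And>zs. zs \<in> \<Omega> \<Longrightarrow> Suc m \<le> ?d zs \<Longrightarrow> bracket_prod X zs = h zs" by blast
    \<comment> \<open>The correction on words of disorder \<open>m\<close>. The sum has at most one term, since blocks can be recovered from their concatenation.\<close>
    define Y where "Y x = (\<Sum>zs\<in>{zs \<in> \<Omega>. concat zs = x \<and> disorder A x = m}. h zs - bracket_prod X zs)" for x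
    have "bracket_prod (\<lambda>x. X x + Y x) zs = h zs" if zs: "zs \<in> \<Omega>" "m \<le> ?d zs" for zs
    proof -
      have "bracket_prod Y zs = Y (concat zs)"
      proof (rule bracket_prod_leading)
        show "block A z" if "z \<in> set zs" for z using blocks zs(1) that by blast
        fix x assume "?d zs < disorder A x"
        then have "{zs \<in> \<Omega>. concat zs = x \<and> disorder A x = m} = {}" using zs(2) by auto
        then show "Y x = 0" unfolding Y_def by (simp only: sum.empty)
      qed
      moreover have "Y (concat zs) = (if ?d zs = m then h zs - bracket_prod X zs else 0)"
      proof (cases "?d zs = m")
        case True
        then have "{zs' \<in> \<Omega>. concat zs' = concat zs \<and> ?d zs = m} = {zs}"
          using inj zs(1) by blast
        then show ?thesis unfolding Y_def using True by simp
      next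
        case False
        then show ?thesis unfolding Y_def by simp
      qed
      ultimately show ?thesis
        using X[OF zs(1)] zs(2) by (cases "?d zs = m") (simp_all add: bracket_prod_add)
    qed
    then show ?case by blast
  qed
  from this[of 0] show ?thesis by simp
qed

section \<open>Choosing one rotation of a list\<close>

text \<open>
  A choice of one list from each class of lists that differ by rotations.
\<close>

definition rotation_rep :: "'b list \<Rightarrow> 'b list" where
  "rotation_rep L = (SOME L'. \<exists>c. L' = rotate c L)"

lemma rotate_inverse:
  assumes "c \<le> length L"
  shows "rotate (length L - c) (rotate c L) = L"
  using assms by (simp add: rotate_rotate)

lemma rotation_rep_rotate: "rotation_rep (rotate c L) = rotation_rep L"
proof -
  have "(\<exists>i. L' = rotate i (rotate c L)) \<longleftrightarrow> (\<exists>i. L' = rotate i L)" for L'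
  proof
    assume "\<exists>i. L' = rotate i (rotate c L)"
    then show "\<exists>i. L' = rotate i L" by (metis rotate_rotate)
  next
    assume "\<exists>i. L' = rotate i L"
    then obtain i where i: "L' = rotate i L" by blast
    show "\<exists>i. L' = rotate i (rotate c L)"
    proof (cases "L = []")
      case False
      let ?m = "c mod length L"
      have "L = rotate (length L - ?m) (rotate c L)"
        using rotate_inverse[of ?m L] False by (simp add: rotate_conv_mod[of c L, symmetric] mod_less_divisor less_imp_le)
      then have "L' = rotate i (rotate (length L - ?m) (rotate c L))" using i by simp
      then show ?thesis by (metis rotate_rotate)
    qed (use i in simp)
  qed
  then show ?thesis by (simp add: rotation_rep_def)
qed

lemma rotation_rep_ex:
  assumes "L \<noteq> []"
  obtains c where "c < length L" "rotation_rep L = rotate c L"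
proof -
  have "\<exists>c. rotation_rep L = rotate c L"
    unfolding rotation_rep_def by (rule someI_ex) blast
  then obtain c where "rotation_rep L = rotate c L" by blast
  then show thesis using that[of "c mod length L"] assms rotate_conv_mod[of c L] by simp
qed

text \<open>
  A list of prime length that is fixed by a nontrivial rotation is fixed by all of them.
\<close>

lemma rotate_eq_const:
  assumes p: "prime p" and L: "length L = p" and c: "c < c'" "c' < p" and eq: "rotate c L = rotate c' L"
    and i: "i < p"
  shows "L ! i = L ! 0"
proof -
  define d where "d = c' - c"
  have p0: "p > 0" using prime_gt_0_nat[OF p] .
  \<comment> \<open>Comparing the two rotations at position \<open>j - c\<close>, where \<open>p - c\<close> avoids negative numbers, shows that \<open>d\<close> is a period.\<close>
  have step: "L ! (j mod p) = L ! ((j + d) mod p)" for j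
  proof -
    define l where "l = (j + (p - c)) mod p"
    have l: "l < p" using p0 by (simp add: l_def)
    have 1: "(l + c) mod p = j mod p"
    proof -
      have "(l + c) mod p = (j + (p - c) + c) mod p" unfolding l_def by (rule mod_add_left_eq)
      also have "j + (p - c) + c = j + p" using c by simp
      finally show ?thesis by simp
    qed
    have 2: "(l + c') mod p = (j + d) mod p"
    proof -
      have "(l + c') mod p = (j + (p - c) + c') mod p" unfolding l_def by (rule mod_add_left_eq)
      also have "j + (p - c) + c' = (j + d) + p" using c by (simp add: d_def)
      finally show ?thesis by simp
    qed
    have "rotate c L ! l = L ! ((c + l) mod p)" "rotate c' L ! l = L ! ((c' + l) mod p)"
      using nth_rotate[of l L] l L by simp_all
    then show ?thesis using eq 1 2 by (simp add: add.commute)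
  qed
  have mult: "L ! ((m * d) mod p) = L ! 0" for m
  proof (induction m)
    case (Suc m)
    have "(Suc m * d) mod p = (m * d + d) mod p" by (simp add: add.commute)
    then show ?case using step[of "m * d"] Suc by simp
  qed (use p0 in simp)
  have "coprime d p"
  proof -
    have "\<not> p dvd d" using c by (intro nat_dvd_not_less) (auto simp: d_def)
    then have "coprime p d" using p by (intro prime_imp_coprime)
    then show ?thesis by (simp only: coprime_commute)
  qed
  then obtain x where x: "[d * x = 1] (mod p)" using cong_solve_coprime_nat[of d p] by auto
  have "((i * x) * d) mod p = i mod p"
  proof -
    have "[i * (d * x) = i * 1] (mod p)" using x by (rule cong_scalar_left)
    moreover have "(i * x) * d = i * (d * x)" by (simp only: ac_simps)
    ultimately show ?thesis unfolding cong_def mult_1_right by (simp only:)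
  qed
  then show ?thesis using mult[of "i * x"] i by simp
qed

lemma rotation_rep_unique:
  assumes "prime p" "length L = p" "\<not> (\<forall>i<p. L ! i = L ! 0)" "c < p" "c' < p"
    "rotate c L = rotation_rep L" "rotate c' L = rotation_rep L"
  shows "c = c'"
  using assms rotate_eq_const[of p L] by (metis linorder_neqE_nat)

section \<open>Block lists with a marked first block\<close>

text \<open>
  If \<open>p\<close> does not divide \<open>k\<close>, the last block of \<open>p\<close> numbers is an orbit of \<open>P\<close>.
\<close>

locale sylow_point = sylow p for p +
  fixes k :: nat
  assumes k: "1 \<le> k" "\<not> p dvd k"
begin

abbreviation "n \<equiv> k * p"
abbreviation "P \<equiv> P_group p k"
abbreviation "base \<equiv> (k - 1) * p"

definition "A = {base + 1..base + p}"

lemma n_eq: "n = base + p"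
  using k by (cases k) auto

lemma n_pos: "1 \<le> n"
  using k p0 by simp

lemma A_subset: "A \<subseteq> {1..n}"
  unfolding A_def n_eq by auto

lemma finite_A: "finite A"
  by (simp add: A_def)

lemma card_A: "card A = p"
  by (simp add: A_def)

lemma A_elem: "a \<in> A \<longleftrightarrow> (\<exists>i<p. a = base + 1 + i)"
proof
  assume "a \<in> A"
  then show "\<exists>i<p. a = base + 1 + i" by (intro exI[of _ "a - (base + 1)"]) (auto simp: A_def)
qed (auto simp: A_def)

text \<open>
  The permutation of the blocks of length \<open>p\<close> that underlies an element of \<open>P\<close> moves at most \<open>(k div p) p < k\<close> blocks, so
  it fixes the last one.
\<close>

lemma P_rotates:
  assumes "g \<in> P"
  obtains t where "\<And>i. i < p \<Longrightarrow> g (base + 1 + i) = base + 1 + (i + t) mod p"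
proof -
  obtain \<sigma> e where x: "\<sigma> \<in> P_group p (k div p)" "e \<in> shifts p k" "g = wreath p \<sigma> e"
    using assms wreathsE unfolding P_group_wreath by blast
  have "(k div p) * p \<noteq> k" using k(2) by (metis dvd_triv_right)
  then have "(k div p) * p < k" using div_mult_le[of k p] by linarith
  then have fix_k: "\<sigma> k = k" by (rule Sym_fix[OF P_in_Sym[OF x(1)]])
  have "g (base + 1 + i) = base + 1 + (i + e k) mod p" if "i < p" for i
    using wreath_pos[OF p0 k(1) that, of \<sigma> e] unfolding x(3) fix_k by (simp add: ac_simps)
  then show thesis by (rule that)
qed

lemma P_bij_letters:
  assumes "g \<in> P"
  shows "inj g" "g a \<in> {1..n} \<longleftrightarrow> a \<in> {1..n}" "g a \<in> A \<longleftrightarrow> a \<in> A"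
proof -
  have perm: "g permutes {1..n}" using P_in_Sym[OF assms] by (simp only: Sym_iff)
  show inj: "inj g" using perm by (rule permutes_inj)
  show "g a \<in> {1..n} \<longleftrightarrow> a \<in> {1..n}" by (rule permutes_in_image[OF perm])
  obtain t where t: "\<And>i. i < p \<Longrightarrow> g (base + 1 + i) = base + 1 + (i + t) mod p"
    using P_rotates[OF assms] by blast
  have sub: "g ` A \<subseteq> A"
  proof
    fix b assume "b \<in> g ` A"
    then obtain a where a: "b = g a" "a \<in> A" by (rule imageE)
    then obtain i where "i < p" "a = base + 1 + i" unfolding A_elem by (elim exE conjE)
    then have "b = base + 1 + (i + t) mod p" using a(1) t by simp
    moreover have "(i + t) mod p < p" using p0 by simp
    ultimately show "b \<in> A" unfolding A_elem by (intro exI conjI)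
  qed
  have "g ` A = A"
  proof (rule card_subset_eq[OF _ sub])
    show "card (g ` A) = card A" by (rule card_image[OF inj_on_subset[OF inj subset_UNIV]])
  qed (simp add: A_def)
  then show "g a \<in> A \<longleftrightarrow> a \<in> A" using inj_image_mem_iff[OF inj, of a A] by simp
qed

definition block_lists :: "nat list list set" where
  "block_lists = {zs. (\<forall>z\<in>set zs. block A z) \<and> concat zs \<in> permutations_of_set {1..n}}"

lemma block_lists_block: "zs \<in> block_lists \<Longrightarrow> z \<in> set zs \<Longrightarrow> block A z"
  by (simp add: block_lists_def)

lemma block_lists_word: "zs \<in> block_lists \<Longrightarrow> concat zs \<in> permutations_of_set {1..n}"
  by (simp add: block_lists_def)

lemma inj_concat: "inj_on concat block_lists"
  by (intro inj_onI concat_blocks_inject[of _ A]) (auto simp: block_lists_block)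

lemma finite_block_lists: "finite block_lists"
proof -
  have "concat ` block_lists \<subseteq> permutations_of_set {1..n}" using block_lists_word by blast
  then have "finite (concat ` block_lists)" by (rule finite_subset) simp
  then show ?thesis using inj_concat by (rule finite_imageD)
qed

lemma block_lists_mset:
  assumes "zs \<in> block_lists" "mset zs' = mset zs"
  shows "zs' \<in> block_lists"
proof -
  have "mset (concat zs') = mset (concat zs)"
  proof -
    have "mset (concat ys) = sum_mset (image_mset mset (mset ys))" for ys :: "nat list list"
      by (induction ys) simp_all
    then show ?thesis using assms(2) by simp
  qed
  then have "concat zs' \<in> permutations_of_set {1..n}"
    using block_lists_word[OF assms(1)] unfolding mset_word_iff[symmetric] by simp
  moreover have "set zs' = set zs" using assms(2) by (rule mset_eq_setD)
  ultimately show ?thesis using assms(1) by (simp add: block_lists_def)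
qed

lemma block_lists_heads:
  assumes "zs \<in> block_lists"
  shows "map hd zs \<in> permutations_of_set A" "concat (map tl zs) \<in> permutations_of_set ({1..n} - A)"
proof -
  have w: "distinct (concat zs)" "set (concat zs) = {1..n}"
    using block_lists_word[OF assms] by (auto simp: permutations_of_set_def)
  have 1: "map hd zs = filter (\<lambda>c. c \<in> A) (concat zs)"
    by (rule filter_concat_blocks(1)[symmetric]) (rule block_lists_block[OF assms])
  have 2: "concat (map tl zs) = filter (\<lambda>c. c \<notin> A) (concat zs)"
    by (rule filter_concat_blocks(2)[symmetric]) (rule block_lists_block[OF assms])
  show "map hd zs \<in> permutations_of_set A"
    unfolding 1 by (intro permutations_of_setI distinct_filter w(1)) (use w(2) A_subset in \<open>auto simp only: set_filter\<close>)
  show "concat (map tl zs) \<in> permutations_of_set ({1..n} - A)"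
    unfolding 2 by (intro permutations_of_setI distinct_filter w(1)) (use w(2) in \<open>auto simp only: set_filter\<close>)
qed

lemma block_lists_length: "zs \<in> block_lists \<Longrightarrow> length zs = p"
  using block_lists_heads(1)[of zs] card_A length_finite_permutations_of_set[of "map hd zs" A] by simp

lemma block_lists_distinct_heads: "zs \<in> block_lists \<Longrightarrow> distinct (map hd zs)" "zs \<in> block_lists \<Longrightarrow> hd ` set zs = A"
  using block_lists_heads(1)[of zs] by (auto simp: permutations_of_set_def)

lemma block_lists_hd_inject: "zs \<in> block_lists \<Longrightarrow> z \<in> set zs \<Longrightarrow> z' \<in> set zs \<Longrightarrow> hd z = hd z' \<Longrightarrow> z = z'"
  using block_lists_distinct_heads(1)[of zs] by (auto simp: distinct_map inj_on_def)

text \<open>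
  The length of the block that begins with the letter number \<open>i\<close> of \<open>A\<close>, counted from \<open>0\<close>.
\<close>

definition len :: "nat list list \<Rightarrow> nat \<Rightarrow> nat" where
  "len zs i = length (THE z. z \<in> set zs \<and> hd z = base + 1 + i)"

lemma len_eq:
  assumes "zs \<in> block_lists" "z \<in> set zs" "hd z = base + 1 + i"
  shows "len zs i = length z"
proof -
  have "(THE z. z \<in> set zs \<and> hd z = base + 1 + i) = z"
    using assms block_lists_hd_inject[OF assms(1)] by (intro the_equality) auto
  then show ?thesis by (simp add: len_def)
qed

lemma len_obtain:
  assumes "zs \<in> block_lists" "i < p"
  obtains z where "z \<in> set zs" "hd z = base + 1 + i"
proof -
  have "base + 1 + i \<in> hd ` set zs" using block_lists_distinct_heads(2)[OF assms(1)] A_elem assms(2) by blast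
  then show thesis using that by auto
qed

definition lens :: "nat list list \<Rightarrow> nat list" where
  "lens zs = map (len zs) [0..<p]"

lemma length_lens [simp]: "length (lens zs) = p"
  by (simp add: lens_def)

lemma lens_nth: "i < p \<Longrightarrow> lens zs ! i = len zs i"
  by (simp add: lens_def)

lemma lens_mset: "mset zs' = mset zs \<Longrightarrow> lens zs' = lens zs"
  using mset_eq_setD[of zs' zs] by (simp add: lens_def len_def fun_eq_iff)

definition even_split :: "nat list list \<Rightarrow> bool" where
  "even_split zs \<longleftrightarrow> (\<forall>i<p. lens zs ! i = lens zs ! 0)"

definition first :: "nat list list \<Rightarrow> nat" where
  "first zs = hd (hd zs) - (base + 1)"

lemma first:
  assumes "zs \<in> block_lists"
  shows "first zs < p" "hd (hd zs) = base + 1 + first zs"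
proof -
  have "zs \<noteq> []" using block_lists_length[OF assms] p0 by auto
  then have "hd (hd zs) \<in> A" using block_lists_block[OF assms hd_in_set] by (simp add: block_def)
  then show "first zs < p" "hd (hd zs) = base + 1 + first zs"
    unfolding A_elem first_def by auto
qed

text \<open>
  A block list is marked if its first block is the right one: the list of lengths, read cyclically from the first letter
  of that block on, is the chosen rotation. Since \<open>P\<close> rotates \<open>A\<close> and the chosen rotation depends on the class only, this
  condition is invariant under \<open>P\<close>; lists with equal lengths have to be excluded because there the first block would not
  be unique.
\<close>

definition marked :: "nat list list set" where
  "marked = {zs \<in> block_lists. \<not> even_split zs \<and> rotate (first zs) (lens zs) = rotation_rep (lens zs)}"

text \<open>
  Permuting the blocks does not change the lengths, and a nonconstant list of prime length has \<open>p\<close> different rotations.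
\<close>

lemma marked_same_first:
  assumes "zs \<in> marked" "zs' \<in> marked" "mset zs' = mset zs"
  shows "hd zs' = hd zs"
proof -
  have O: "zs \<in> block_lists" "zs' \<in> block_lists" using assms by (auto simp: marked_def)
  have l: "lens zs' = lens zs" by (rule lens_mset[OF assms(3)])
  have "first zs = first zs'"
  proof (rule rotation_rep_unique[OF prime_p, of "lens zs"])
    show "\<not> (\<forall>i<p. lens zs ! i = lens zs ! 0)"
      using assms(1) unfolding marked_def even_split_def by blast
    show "rotate (first zs) (lens zs) = rotation_rep (lens zs)"
      using assms(1) unfolding marked_def by blast
    have "rotate (first zs') (lens zs') = rotation_rep (lens zs')"
      using assms(2) unfolding marked_def by blast
    then show "rotate (first zs') (lens zs) = rotation_rep (lens zs)" unfolding l .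
  qed (simp_all add: first(1)[OF O(1)] first(1)[OF O(2)])
  then have "hd (hd zs) = hd (hd zs')" using first(2)[OF O(1)] first(2)[OF O(2)] by simp
  moreover have "hd zs \<in> set zs" "hd zs' \<in> set zs"
  proof -
    have "zs \<noteq> []" "zs' \<noteq> []" using block_lists_length[OF O(1)] block_lists_length[OF O(2)] p0 by auto
    then show "hd zs \<in> set zs" "hd zs' \<in> set zs"
      using hd_in_set[of zs] hd_in_set[of zs'] unfolding mset_eq_setD[OF assms(3)] by simp_all
  qed
  ultimately show ?thesis using block_lists_hd_inject[OF O(1), of "hd zs'" "hd zs"] by simp
qed

lemma block_lists_act:
  assumes "zs \<in> block_lists" "g \<in> P"
  shows "map (map g) zs \<in> block_lists"
proof -
  note g = P_bij_letters[OF assms(2)]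
  have w: "distinct (concat zs)" "set (concat zs) = {1..n}"
    using block_lists_word[OF assms(1)] by (auto simp: permutations_of_set_def)
  have "block A (map g z)" if "z \<in> set zs" for z
    using block_lists_block[OF assms(1) that] g(3) by (auto simp: block_def hd_map map_tl[symmetric] disjoint_iff)
  moreover have "concat (map (map g) zs) \<in> permutations_of_set {1..n}"
  proof -
    have "concat (map (map g) zs) = map g (concat zs)" by (simp add: map_concat)
    moreover have "g ` {1..n} = {1..n}"
      using P_in_Sym[OF assms(2)] unfolding Sym_iff by (rule permutes_image)
    ultimately show ?thesis
      using w g(1) by (auto simp: permutations_of_set_def distinct_map simp del: set_concat intro: inj_on_subset)
  qed
  ultimately show ?thesis by (auto simp: block_lists_def)
qed

lemma len_act:
  assumes "zs \<in> block_lists" "g \<in> P" and t: "\<And>i. i < p \<Longrightarrow> g (base + 1 + i) = base + 1 + (i + t) mod p" and "i < p"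
  shows "len (map (map g) zs) ((i + t) mod p) = len zs i"
proof -
  obtain z where z: "z \<in> set zs" "hd z = base + 1 + i" using len_obtain[OF assms(1,4)] .
  have "z \<noteq> []" using block_lists_block[OF assms(1) z(1)] by (simp add: block_def)
  then have "hd (map g z) = base + 1 + (i + t) mod p" using z(2) t[OF assms(4)] by (simp add: hd_map)
  then have "len (map (map g) zs) ((i + t) mod p) = length (map g z)"
    using z(1) by (intro len_eq[OF block_lists_act[OF assms(1,2)]]) auto
  then show ?thesis using len_eq[OF assms(1) z] by simp
qed

text \<open>
  If \<open>g\<close> rotates \<open>A\<close> by \<open>t\<close>, the list of lengths is rotated by \<open>t\<close> as well, and the position of the first letter is shifted
  accordingly.
\<close>

lemma marked_act:
  assumes "zs \<in> marked" "g \<in> P"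
  shows "map (map g) zs \<in> marked"
proof -
  have O: "zs \<in> block_lists" and ne: "\<not> even_split zs" and rep: "rotate (first zs) (lens zs) = rotation_rep (lens zs)"
    using assms(1) by (auto simp: marked_def)
  let ?zs = "map (map g) zs"
  have O': "?zs \<in> block_lists" by (rule block_lists_act[OF O assms(2)])
  obtain t where t: "\<And>i. i < p \<Longrightarrow> g (base + 1 + i) = base + 1 + (i + t) mod p"
    using P_rotates[OF assms(2)] by blast
  have zs0: "zs \<noteq> []" "hd zs \<noteq> []"
    using block_lists_length[OF O] p0 block_lists_block[OF O hd_in_set] by (auto simp: block_def)
  have "hd (hd ?zs) = base + 1 + (first zs + t) mod p"
    using zs0 first[OF O] t by (simp add: hd_map)
  then have first': "first ?zs = (first zs + t) mod p" by (simp add: first_def)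
  have rot: "rotate t (lens ?zs) = lens zs"
  proof (rule nth_equalityI)
    fix i assume "i < length (rotate t (lens ?zs))"
    then have i: "i < p" by simp
    then show "rotate t (lens ?zs) ! i = lens zs ! i"
      using len_act[OF O assms(2) t i] p0 by (simp add: nth_rotate lens_nth add.commute)
  qed simp
  have "rotate (first ?zs) (lens ?zs) = rotate (first zs + t) (lens ?zs)"
    unfolding first' using rotate_conv_mod[of "first zs + t" "lens ?zs"] by simp
  also have "\<dots> = rotate (first zs) (lens zs)" unfolding rot[symmetric] by (simp add: rotate_rotate)
  also have "\<dots> = rotation_rep (lens ?zs)" unfolding rep unfolding rot[symmetric] by (rule rotation_rep_rotate)
  finally have rep': "rotate (first ?zs) (lens ?zs) = rotation_rep (lens ?zs)" .
  have "\<not> even_split ?zs"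
  proof
    assume ev: "even_split ?zs"
    have "lens zs ! i = lens ?zs ! 0" if "i < p" for i
    proof -
      have "lens zs ! i = lens ?zs ! ((t + i) mod p)"
        using that unfolding rot[symmetric] by (simp add: nth_rotate)
      also have "\<dots> = lens ?zs ! 0"
        by (rule ev[unfolded even_split_def, rule_format]) (use p0 in simp)
      finally show ?thesis .
    qed
    note all0 = this
    have "even_split zs" unfolding even_split_def
    proof (intro allI impI)
      fix i assume "i < p"
      show "lens zs ! i = lens zs ! 0" unfolding all0[OF \<open>i < p\<close>] all0[OF p0] ..
    qed
    with ne show False by simp
  qed
  then show ?thesis using O' rep' by (simp add: marked_def)
qed

text \<open>
  All letters occur in a block list, so it determines the permutation that was applied.
\<close>

lemma act_free:
  assumes "zs \<in> block_lists" "g \<in> P" "h \<in> P" "map (map g) zs = map (map h) zs"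
  shows "g = h"
proof -
  have "map g (concat zs) = map h (concat zs)" using assms(4) by (metis map_concat)
  moreover have "set (concat zs) = {1..n}"
    using block_lists_word[OF assms(1)] by (auto simp: permutations_of_set_def)
  ultimately have "g x = h x" if "x \<in> {1..n}" for x
    using that by (metis map_eq_conv)
  moreover have "g x = h x" if "x \<notin> {1..n}" for x
    using that P_in_Sym[OF assms(2)] P_in_Sym[OF assms(3)] by (simp add: Sym_iff permutes_def)
  ultimately show ?thesis by blast
qed

end

section \<open>Counting the marked block lists\<close>

context sylow_point
begin

lemma card_words_from:
  assumes "a \<in> {1..n}"
  shows "card {x \<in> permutations_of_set {1..n}. hd x = a} = fact (n - 1)"
proof -
  have "{x \<in> permutations_of_set {1..n}. hd x = a} = (\<lambda>y. a # y) ` permutations_of_set ({1..n} - {a})"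
  proof
    show "{x \<in> permutations_of_set {1..n}. hd x = a} \<subseteq> (\<lambda>y. a # y) ` permutations_of_set ({1..n} - {a})"
    proof
      fix x assume "x \<in> {x \<in> permutations_of_set {1..n}. hd x = a}"
      then have x: "set x = {1..n}" "distinct x" "hd x = a" by (auto simp: permutations_of_set_def)
      have "x \<noteq> []" using x(1) assms by auto
      then obtain y where y: "x = a # y" using x(3) by (cases x) auto
      have "a \<notin> set y" "distinct y" "insert a (set y) = {1..n}" using x(1,2) unfolding y by simp_all
      then have "set y = {1..n} - {a}" by blast
      then have "y \<in> permutations_of_set ({1..n} - {a})"
        using \<open>distinct y\<close> by (intro permutations_of_setI)
      then show "x \<in> (\<lambda>y. a # y) ` permutations_of_set ({1..n} - {a})" using y by (intro image_eqI)
    qed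
    show "(\<lambda>y. a # y) ` permutations_of_set ({1..n} - {a}) \<subseteq> {x \<in> permutations_of_set {1..n}. hd x = a}"
    proof
      fix x assume "x \<in> (\<lambda>y. a # y) ` permutations_of_set ({1..n} - {a})"
      then obtain y where y: "x = a # y" "set y = {1..n} - {a}" "distinct y"
        by (auto simp: permutations_of_set_def)
      have "set x = {1..n}" unfolding y(1) list.set y(2) using assms by blast
      moreover have "distinct x" unfolding y(1) distinct.simps y(2) using y(3) by blast
      ultimately show "x \<in> {x \<in> permutations_of_set {1..n}. hd x = a}"
        using y(1) by (simp add: permutations_of_set_def)
    qed
  qed
  then show ?thesis using assms by (simp add: card_image)
qed

text \<open>
  Every word that begins with a letter of \<open>A\<close> can be cut into blocks.
\<close>

lemma card_block_lists_ge: "p * fact (n - 1) \<le> card block_lists"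
proof -
  let ?W = "\<lambda>a. {x \<in> permutations_of_set {1..n}. hd x = a}"
  have "(\<Union>a\<in>A. ?W a) \<subseteq> concat ` block_lists"
  proof
    fix x assume "x \<in> (\<Union>a\<in>A. ?W a)"
    then have x: "x \<in> permutations_of_set {1..n}" "hd x \<in> A" by auto
    obtain zs where "\<forall>z\<in>set zs. block A z" "concat zs = x"
      using split_into_blocks[of x A] x(2) by blast
    then have "zs \<in> block_lists" "x = concat zs" using x(1) by (simp_all add: block_lists_def)
    then show "x \<in> concat ` block_lists" by blast
  qed
  then have "card (\<Union>a\<in>A. ?W a) \<le> card (concat ` block_lists)"
    using finite_block_lists by (intro card_mono) auto
  also have "\<dots> \<le> card block_lists" by (rule card_image_le[OF finite_block_lists])
  also have "card (\<Union>a\<in>A. ?W a) = (\<Sum>a\<in>A. card (?W a))"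
    by (intro card_UN_disjoint) (auto simp: A_def)
  also have "\<dots> = (\<Sum>a\<in>A. fact (n - 1))"
    by (intro sum.cong refl card_words_from) (use A_subset in blast)
  finally show ?thesis by (simp add: card_A)
qed

lemma even_split_lengths:
  assumes "zs \<in> block_lists" "even_split zs" "z \<in> set zs"
  shows "length z = k"
proof -
  have len: "length y = lens zs ! 0" if "y \<in> set zs" for y
  proof -
    have "hd y \<in> A" using block_lists_distinct_heads(2)[OF assms(1)] that by blast
    then obtain i where i: "i < p" "hd y = base + 1 + i" unfolding A_elem by (elim exE conjE)
    have "length y = lens zs ! i" using len_eq[OF assms(1) that i(2)] lens_nth[OF i(1)] by simp
    also have "\<dots> = lens zs ! 0" by (rule assms(2)[unfolded even_split_def, rule_format, OF i(1)])
    finally show ?thesis .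
  qed
  have "length (concat zs) = sum_list (map length zs)" by (rule length_concat)
  also have "map length zs = map (\<lambda>_. lens zs ! 0) zs" using len by (intro map_cong refl)
  also have "sum_list \<dots> = p * (lens zs ! 0)"
    using block_lists_length[OF assms(1)] by (simp add: sum_list_triv)
  also have "length (concat zs) = k * p"
    using length_finite_permutations_of_set[OF block_lists_word[OF assms(1)]] by simp
  finally have "k * p = lens zs ! 0 * p" by (simp only: mult.commute)
  then have "k = lens zs ! 0" using p0 mult_cancel2[of k p "lens zs ! 0"] by blast
  then show ?thesis using len[OF assms(3)] by simp
qed

text \<open>
  If all blocks have the same length, the list is determined by its first letters and the sequence of the others.
\<close>

lemma card_even_split: "card {zs \<in> block_lists. even_split zs} \<le> fact p * fact (n - p)"
proof -
  let ?E = "{zs \<in> block_lists. even_split zs}"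
  let ?f = "\<lambda>zs. (map hd zs, concat (map tl zs))"
  have inj: "inj_on ?f ?E"
  proof (rule inj_onI)
    fix zs zs' assume *: "zs \<in> ?E" "zs' \<in> ?E" "?f zs = ?f zs'"
    then have O: "zs \<in> block_lists" "even_split zs" "zs' \<in> block_lists" "even_split zs'" by blast+
    have eq: "map hd zs = map hd zs'" "concat (map tl zs) = concat (map tl zs')" using *(3) by simp_all
    have len: "length zs = length zs'" using block_lists_length O(1,3) by simp
    have tails: "length y = k - 1" if "ws \<in> block_lists" "even_split ws" and y: "y \<in> set (map tl ws)" for y ws
    proof -
      obtain z where z: "z \<in> set ws" "y = tl z" using y by auto
      show ?thesis unfolding z(2) length_tl even_split_lengths[OF \<open>ws \<in> block_lists\<close> \<open>even_split ws\<close> z(1)] ..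
    qed
    have "\<forall>(x, y)\<in>set (zip (map tl zs) (map tl zs')). length x = length y"
    proof (intro ballI case_prodI2)
      fix q x y assume "q \<in> set (zip (map tl zs) (map tl zs'))" "q = (x, y)"
      then have q: "(x, y) \<in> set (zip (map tl zs) (map tl zs'))" by simp
      show "length x = length y"
        unfolding tails[OF O(1,2) set_zip_leftD[OF q]] tails[OF O(3,4) set_zip_rightD[OF q]] ..
    qed
    moreover have "length (map tl zs) = length (map tl zs')" unfolding length_map by (rule len)
    ultimately have tl: "map tl zs = map tl zs'"
      using concat_eq_concat_iff[of "map tl zs" "map tl zs'"] eq(2) by blast
    show "zs = zs'"
    proof (rule nth_equalityI[OF len])
      fix i assume i: "i < length zs"
      then have "hd (zs ! i) = hd (zs' ! i)" "tl (zs ! i) = tl (zs' ! i)"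
        using arg_cong[OF eq(1), of "\<lambda>l. l ! i"] arg_cong[OF tl, of "\<lambda>l. l ! i"] len by simp_all
      moreover have "zs ! i \<noteq> []" "zs' ! i \<noteq> []"
        using block_lists_block[OF O(1), of "zs ! i"] block_lists_block[OF O(3), of "zs' ! i"] i len
        by (auto simp: block_def)
      ultimately show "zs ! i = zs' ! i" by (simp add: list.expand)
    qed
  qed
  have "?f ` ?E \<subseteq> permutations_of_set A \<times> permutations_of_set ({1..n} - A)"
    using block_lists_heads by (intro image_subsetI) (simp only: mem_Collect_eq mem_Times_iff fst_conv snd_conv)
  then have "card (?f ` ?E) \<le> card (permutations_of_set A \<times> permutations_of_set ({1..n} - A))"
    by (intro card_mono finite_cartesian_product finite_permutations_of_set)
  then have "card ?E \<le> card (permutations_of_set A) * card (permutations_of_set ({1..n} - A))"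
    unfolding card_image[OF inj] card_cartesian_product .
  moreover have "card (permutations_of_set A) = fact p"
    by (simp only: card_permutations_of_set[OF finite_A] card_A)
  moreover have "card (permutations_of_set ({1..n} - A)) = fact (n - p)"
  proof -
    have "card ({1..n} - A) = n - p"
      unfolding card_Diff_subset[OF finite_A A_subset] card_A card_atLeastAtMost by simp
    then show ?thesis
      by (simp only: card_permutations_of_set[OF finite_Diff[OF finite_atLeastAtMost]])
  qed
  ultimately show ?thesis by (simp only:)
qed

text \<open>
  Moving the right block to the front by a rotation of the block list marks it.
\<close>

lemma card_uneven_le: "card {zs \<in> block_lists. \<not> even_split zs} \<le> p * card marked"
proof -
  \<comment> \<open>Undoing the rotation by the position \<open>j < p\<close> of the right block is a rotation by \<open>p - j\<close>.\<close>
  have "{zs \<in> block_lists. \<not> even_split zs} \<subseteq> (\<Union>j\<in>{1..p}. rotate j ` marked)"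
  proof
    fix zs assume "zs \<in> {zs \<in> block_lists. \<not> even_split zs}"
    then have O: "zs \<in> block_lists" and ne: "\<not> even_split zs" by blast+
    have "lens zs \<noteq> []" using p0 length_lens[of zs] by (metis list.size(3) less_irrefl)
    then obtain c where c: "c < p" "rotation_rep (lens zs) = rotate c (lens zs)"
      using rotation_rep_ex[of "lens zs"] by auto
    obtain z where z: "z \<in> set zs" "hd z = base + 1 + c" using len_obtain[OF O c(1)] .
    then obtain j where j: "j < p" "zs ! j = z" using block_lists_length[OF O] by (auto simp: in_set_conv_nth)
    have "zs \<noteq> []" using z(1) by auto
    let ?zs = "rotate j zs"
    have ms: "mset ?zs = mset zs"
      unfolding rotate_drop_take by (metis append_take_drop_id mset_append union_commute)
    have l: "lens ?zs = lens zs" by (rule lens_mset[OF ms])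
    have "hd ?zs = z" using hd_rotate_conv_nth[OF \<open>zs \<noteq> []\<close>, of j] j block_lists_length[OF O] by simp
    then have "first ?zs = c" using z(2) by (simp add: first_def)
    moreover have "\<not> even_split ?zs" using ne unfolding even_split_def l .
    ultimately have "?zs \<in> marked"
      using block_lists_mset[OF O ms] c(2) l unfolding marked_def by simp
    moreover have "zs = rotate (p - j) ?zs"
      using rotate_inverse[of j zs] block_lists_length[OF O] j(1) by simp
    moreover have "p - j \<in> {1..p}" using j(1) by auto
    ultimately show "zs \<in> (\<Union>j\<in>{1..p}. rotate j ` marked)" by blast
  qed
  moreover have fin: "finite marked" using finite_block_lists by (simp add: marked_def)
  ultimately have "card {zs \<in> block_lists. \<not> even_split zs} \<le> card (\<Union>j\<in>{1..p}. rotate j ` marked)"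
    by (intro card_mono) auto
  also have "\<dots> \<le> (\<Sum>j\<in>{1..p}. card (rotate j ` marked))" by (rule card_UN_le) simp
  also have "\<dots> \<le> (\<Sum>j\<in>{1..p}. card marked)" by (intro sum_mono card_image_le fin)
  finally show ?thesis by simp
qed

lemma card_marked_ge: "fact (n - 1) \<le> card marked + fact (p - 1) * fact (n - p)"
proof -
  have "card block_lists = card {zs \<in> block_lists. even_split zs} + card {zs \<in> block_lists. \<not> even_split zs}"
    using finite_block_lists by (subst card_Un_disjoint[symmetric]) (auto intro: arg_cong[where f = card])
  then have "p * fact (n - 1) \<le> fact p * fact (n - p) + p * card marked"
    using card_block_lists_ge card_even_split card_uneven_le by linarith
  also have "(fact p :: nat) = p * fact (p - 1)" using p0 by (simp add: fact_reduce)
  finally have "p * fact (n - 1) \<le> p * (card marked + fact (p - 1) * fact (n - p))"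
    by (simp add: algebra_simps)
  then show ?thesis using p0 by simp
qed

text \<open>
  The value of \<open>X\<close> at a Lie element, the left-normed bracket of the brackets of the blocks.
\<close>

definition block_value :: "(nat list \<Rightarrow> 'a::comm_ring_1) \<Rightarrow> nat list list \<Rightarrow> 'a" where
  "block_value X zs = eval_bracket (bracket_prod X) zs"

lemma block_value_sum:
  assumes "finite I"
  shows "block_value (\<lambda>x. \<Sum>i\<in>I. X i x) zs = (\<Sum>i\<in>I. block_value (X i) zs)"
  unfolding block_value_def bracket_prod_sum[OF assms, abs_def] by (rule eval_bracket_sum[OF assms])

lemma block_value_scale: "block_value (\<lambda>x. c * X x) zs = c * block_value X zs"
  unfolding block_value_def bracket_prod_scale[abs_def] by (rule eval_bracket_scale)

lemma block_value_map: "block_value (\<lambda>l. X (map f l)) zs = block_value X (map (map f) zs)"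
  unfolding block_value_def eval_bracket_map bracket_prod_map ..

lemma block_value_eq_0:
  assumes "zs \<in> block_lists" "lie_fun n X = (0 :: _ \<Rightarrow> 'a::field)"
  shows "block_value X zs = 0"
  unfolding block_value_def
proof (rule eval_bracket_bracket_prod_eq_0)
  fix y assume "mset y = mset (concat zs)"
  also have "\<dots> = mset [1..<Suc n]" using block_lists_word[OF assms(1)] unfolding mset_word_iff .
  finally obtain \<sigma> where \<sigma>: "\<sigma> \<in> Sym n" "word n \<sigma> = y" by (rule word_obtain)
  then show "eval_bracket X y = 0" using fun_cong[OF assms(2), of \<sigma>] by (simp add: lie_fun_def)
next
  show "zs \<noteq> []" using block_lists_length[OF assms(1)] p0 by auto
  show "z \<noteq> []" if "z \<in> set zs" for z using block_lists_block[OF assms(1) that] by (simp add: block_def)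
qed

text \<open>
  The products of brackets are independent, so a functional may be prescribed on them: take it to be \<open>h\<close> on the marked lists and
  \<open>0\<close> on the others. Among the rearrangements of a marked list, which occur in the expansion of the bracket of its
  blocks, the marked ones have the same first block, and only the leading term has this first block.
\<close>

lemma block_value_surjective:
  "\<exists>X. \<forall>zs\<in>marked. block_value X zs = (h zs :: 'a::field)"
proof -
  have "\<exists>X. \<forall>zs\<in>block_lists. bracket_prod X zs = (if zs \<in> marked then h zs else 0)"
    by (rule bracket_prod_surjective[OF finite_block_lists block_lists_block])
  then obtain X where X: "\<And>zs. zs \<in> block_lists \<Longrightarrow> bracket_prod X zs = (if zs \<in> marked then h zs else 0)"
    by metis
  have "block_value X zs = h zs" if zs: "zs \<in> marked" for zs
  proof -
    have O: "zs \<in> block_lists" using zs by (simp add: marked_def)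
    have "zs \<noteq> []" using block_lists_length[OF O] p0 by auto
    then obtain z rest where zr: "zs = z # rest" by (cases zs) auto
    have "distinct zs" using block_lists_distinct_heads(1)[OF O] by (simp add: distinct_map)
    have "eval_bracket (bracket_prod X) (z # rest) = bracket_prod X (z # rest)"
    proof (rule eval_bracket_leading)
      show "z \<notin> set rest" using \<open>distinct zs\<close> zr by simp
      fix x assume x: "mset x = mset (z # rest)" "hd x \<noteq> z"
      have xO: "x \<in> block_lists" using block_lists_mset[OF O] x(1) zr by simp
      have "x \<notin> marked"
      proof
        assume "x \<in> marked"
        then have "hd x = hd zs" using x(1) zr by (intro marked_same_first[OF zs]) simp_all
        then show False using x(2) zr by simp
      qed
      then show "bracket_prod X x = 0" using X[OF xO] by simp
    qed
    then show ?thesis using X[OF O] zs unfolding block_value_def zr by simp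
  qed
  then show ?thesis by blast
qed

text \<open>
  A choice of one element from each orbit of \<open>P\<close> on block lists.
\<close>

definition orbit_rep :: "nat list list \<Rightarrow> nat list list" where
  "orbit_rep zs = (SOME y. y \<in> (\<lambda>g. map (map g) zs) ` P)"

definition orbit_reps :: "nat list list set" where
  "orbit_reps = orbit_rep ` marked"

lemma orbit_rep_in: "\<exists>g\<in>P. orbit_rep zs = map (map g) zs"
proof -
  have "map (map id) zs \<in> (\<lambda>g. map (map g) zs) ` P" using P_id by (intro imageI)
  then have "orbit_rep zs \<in> (\<lambda>g. map (map g) zs) ` P" unfolding orbit_rep_def by (rule someI)
  then show ?thesis by blast
qed

lemma orbit_rep_act:
  assumes "g \<in> P"
  shows "orbit_rep (map (map g) zs) = orbit_rep zs"
proof -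
  have comp: "map (map h) (map (map g) zs) = map (map (h \<circ> g)) zs" for h by simp
  have "(\<lambda>h. map (map h) (map (map g) zs)) ` P = (\<lambda>h. map (map h) zs) ` P"
  proof
    show "(\<lambda>h. map (map h) (map (map g) zs)) ` P \<subseteq> (\<lambda>h. map (map h) zs) ` P"
      unfolding comp using P_comp[OF _ assms] by blast
    show "(\<lambda>h. map (map h) zs) ` P \<subseteq> (\<lambda>h. map (map h) (map (map g) zs)) ` P"
    proof (rule image_subsetI)
      fix h assume h: "h \<in> P"
      have "inv' g \<circ> g = id" using P_bij_letters(1)[OF assms] by (simp add: inj_iff)
      then have "h = (h \<circ> inv' g) \<circ> g" by (simp only: comp_assoc comp_id)
      then have "map (map h) zs = map (map (h \<circ> inv' g)) (map (map g) zs)" unfolding comp by (rule arg_cong)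
      then show "map (map h) zs \<in> (\<lambda>h. map (map h) (map (map g) zs)) ` P"
        using P_comp[OF h P_inv[OF assms]] by (rule image_eqI)
    qed
  qed
  then show ?thesis unfolding orbit_rep_def by (simp only:)
qed

lemma orbit_reps_marked: "r \<in> orbit_reps \<Longrightarrow> r \<in> marked"
  unfolding orbit_reps_def using orbit_rep_in marked_act by (metis imageE)

lemma orbit_reps_fix: "r \<in> orbit_reps \<Longrightarrow> orbit_rep r = r"
  unfolding orbit_reps_def using orbit_rep_in orbit_rep_act by (metis imageE)

lemma finite_orbit_reps: "finite orbit_reps"
  using finite_block_lists by (simp add: orbit_reps_def marked_def)

lemma card_marked_le: "card marked \<le> card orbit_reps * card P"
proof -
  interpret PG: p_group P p by (rule p_group_P)
  have "marked \<subseteq> (\<lambda>(r, g). map (map g) r) ` (orbit_reps \<times> P)"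
  proof
    fix zs assume zs: "zs \<in> marked"
    obtain g where g: "g \<in> P" "orbit_rep zs = map (map g) zs" using orbit_rep_in by blast
    have "inv' g \<circ> g = id" using P_bij_letters(1)[OF g(1)] by (simp add: inj_iff)
    then have "zs = map (map (inv' g)) (orbit_rep zs)" unfolding g(2) by simp
    moreover have "(orbit_rep zs, inv' g) \<in> orbit_reps \<times> P" using zs P_inv[OF g(1)] by (simp add: orbit_reps_def)
    ultimately show "zs \<in> (\<lambda>(r, g). map (map g) r) ` (orbit_reps \<times> P)" by (metis (no_types, lifting) case_prod_conv image_eqI)
  qed
  then have "card marked \<le> card ((\<lambda>(r, g). map (map g) r) ` (orbit_reps \<times> P))"
    using finite_orbit_reps PG.finite_G by (intro card_mono) auto
  also have "\<dots> \<le> card (orbit_reps \<times> P)" using finite_orbit_reps PG.finite_G by (intro card_image_le) auto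
  finally show ?thesis by (simp add: card_cartesian_product)
qed

lemma norm_lie_fun:
  "norm_map P (ga_act n) (lie_fun n X) = lie_fun n (\<lambda>l. \<Sum>g\<in>P. X (map (inv' g) l))"
proof
  interpret PG: p_group P p by (rule p_group_P)
  fix \<rho>
  have "norm_map P (ga_act n) (lie_fun n X) \<rho> = (\<Sum>g\<in>P. lie_fun n (\<lambda>l. X (map (inv' g) l)) \<rho>)"
    unfolding norm_map_def sum_apply
  proof (intro sum.cong refl)
    fix g assume "g \<in> P"
    then show "ga_act n (lie_fun n X) g \<rho> = lie_fun n (\<lambda>l. X (map (inv' g) l)) \<rho>"
      using fun_cong[OF ga_act_lie_fun[OF P_in_Sym]] by blast
  qed
  also have "\<dots> = lie_fun n (\<lambda>l. \<Sum>g\<in>P. X (map (inv' g) l)) \<rho>"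
    unfolding lie_fun_def eval_bracket_sum[OF PG.finite_G] by simp
  finally show "norm_map P (ga_act n) (lie_fun n X) \<rho> = \<dots>" .
qed

text \<open>
  Choose functionals dual to the representatives of the orbits of marked lists. Since \<open>P\<close> acts freely on these lists, the
  values of the norms of these functionals at the representatives still form the identity matrix, and by
  \<open>block_value_eq_0\<close> these values depend on the induced elements of the Lie module only.
\<close>

lemma card_orbit_reps_le:
  assumes char: "CHAR('a::field) = p"
  shows "card orbit_reps \<le> fv.dim (norm_map P (ga_act n) ` (Lie n :: ((nat \<Rightarrow> nat) \<Rightarrow> 'a) set))"
proof -
  interpret M: pmodule P p "ga_act n" "Lie n :: ((nat \<Rightarrow> nat) \<Rightarrow> 'a) set"
    by (rule pmodule_Lie[OF char k(1)])
  have "\<exists>X. \<forall>zs\<in>marked. block_value X zs = (if zs = r then 1 else 0 :: 'a)" for r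
    by (rule block_value_surjective)
  then obtain X where X: "\<And>r zs. zs \<in> marked \<Longrightarrow> block_value (X r) zs = (if zs = r then 1 else 0 :: 'a)"
    by metis
  define v where "v r = norm_map P (ga_act n) (lie_fun n (X r))" for r
  define Z where "Z r l = (\<Sum>g\<in>P. X r (map (inv' g) l))" for r l
  have v: "v r = lie_fun n (Z r)" for r unfolding v_def Z_def by (rule norm_lie_fun)
  have Z: "block_value (Z r) s = (if s = r then 1 else 0)" if "r \<in> orbit_reps" "s \<in> orbit_reps" for r s
  proof -
    have sG: "s \<in> marked" by (rule orbit_reps_marked[OF that(2)])
    have sO: "s \<in> block_lists" using sG by (simp add: marked_def)
    have "block_value (Z r) s = (\<Sum>g\<in>P. block_value (X r) (map (map (inv' g)) s))"
      unfolding Z_def block_value_sum[OF M.finite_G] block_value_map ..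
    also have "\<dots> = (\<Sum>g\<in>P. if g = id then (if s = r then 1 else 0) else 0)"
    proof (intro sum.cong refl)
      fix g assume g: "g \<in> P"
      have "block_value (X r) (map (map (inv' g)) s) = (if map (map (inv' g)) s = r then 1 else 0)"
        by (rule X[OF marked_act[OF sG P_inv[OF g]]])
      also have "map (map (inv' g)) s = r \<longleftrightarrow> g = id \<and> s = r"
      proof
        assume *: "map (map (inv' g)) s = r"
        have "orbit_rep r = orbit_rep s" unfolding *[symmetric] by (rule orbit_rep_act[OF P_inv[OF g]])
        then have sr: "s = r" using orbit_reps_fix[OF that(1)] orbit_reps_fix[OF that(2)] by simp
        have "map (map (inv' g)) s = map (map id) s" using * sr by simp
        then have "inv' g = id" by (rule act_free[OF sO P_inv[OF g] P_id])
        then have "g = id" using M.comp_inv(1)[OF g] by simp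
        then show "g = id \<and> s = r" using sr by simp
      qed simp
      finally show "block_value (X r) (map (map (inv' g)) s) = (if g = id then (if s = r then 1 else 0) else 0)"
        by auto
    qed
    also have "\<dots> = (if s = r then 1 else 0)" using M.finite_G P_id by (simp add: sum.delta)
    finally show ?thesis .
  qed
  show ?thesis
  proof (rule indep_family_card_le[OF M.fin_dim_nm(1) finite_orbit_reps])
    show "indep_family orbit_reps v"
    proof (rule indep_familyI)
      fix c s assume c: "(\<Sum>r\<in>orbit_reps. fscale (c r) (v r)) = 0" and s: "s \<in> orbit_reps"
      have "lie_fun n (\<lambda>l. \<Sum>r\<in>orbit_reps. c r * Z r l) = (\<Sum>r\<in>orbit_reps. fscale (c r) (v r))"
      proof
        fix \<rho>
        show "lie_fun n (\<lambda>l. \<Sum>r\<in>orbit_reps. c r * Z r l) \<rho> = (\<Sum>r\<in>orbit_reps. fscale (c r) (v r)) \<rho>"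
          unfolding lie_fun_def v sum_apply fscale_def eval_bracket_sum[OF finite_orbit_reps] eval_bracket_scale by simp
      qed
      then have "lie_fun n (\<lambda>l. \<Sum>r\<in>orbit_reps. c r * Z r l) = 0" using c by simp
      then have "0 = block_value (\<lambda>l. \<Sum>r\<in>orbit_reps. c r * Z r l) s"
        using block_value_eq_0[of s] orbit_reps_marked[OF s] by (simp add: marked_def)
      also have "\<dots> = (\<Sum>r\<in>orbit_reps. c r * block_value (Z r) s)"
        unfolding block_value_sum[OF finite_orbit_reps] block_value_scale ..
      also have "\<dots> = (\<Sum>r\<in>orbit_reps. if r = s then c s else 0)"
        using Z[OF _ s] by (intro sum.cong refl) simp
      also have "\<dots> = c s" using finite_orbit_reps s by simp
      finally show "c s = 0" by simp
    qed
    show "v ` orbit_reps \<subseteq> norm_map P (ga_act n) ` Lie n"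
      unfolding v_def Lie_eq[OF n_pos] by blast
  qed
qed

lemma pf_dim_Lie_le:
  assumes char: "CHAR('a::field) = p"
  shows "pf_dim P (ga_act n) (Lie n :: ((nat \<Rightarrow> nat) \<Rightarrow> 'a) set) \<le> fact (p - 1) * fact (n - p)"
proof -
  have "fact (n - 1) \<le> card orbit_reps * card P + fact (p - 1) * fact (n - p)"
    using card_marked_ge card_marked_le by linarith
  also have "card orbit_reps * card P \<le> fv.dim (norm_map P (ga_act n) ` (Lie n :: ((nat \<Rightarrow> nat) \<Rightarrow> 'a) set)) * card P"
    by (intro mult_le_mono1 card_orbit_reps_le char)
  finally show ?thesis
    using pf_dim_Lie[OF char k(1)] by (simp add: mult.commute)
qed

end

section \<open>Products of sets of permutations\<close>

text \<open>
  One step of \<open>set_product\<close> as an image, which bounds its cardinality.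
\<close>

definition times_set :: "(nat \<Rightarrow> nat) set \<Rightarrow> (nat \<Rightarrow> nat) set \<Rightarrow> (nat \<Rightarrow> nat) set" where
  "times_set A B = (\<lambda>(\<sigma>, \<tau>). \<tau> \<circ> \<sigma>) ` (A \<times> B)"

lemma set_product_foldl: "set_product As = foldl times_set {id} As"
proof -
  have "{\<tau> \<circ> \<sigma> | \<sigma> \<tau>. \<sigma> \<in> A \<and> \<tau> \<in> B} = times_set A B" for A B
    by (auto simp: times_set_def image_iff)
  then show ?thesis by (simp add: set_product_def)
qed

lemma set_product_Nil: "set_product [] = {id}"
  by (simp add: set_product_foldl)

lemma set_product_snoc: "set_product (As @ [B]) = times_set (set_product As) B"
  by (simp add: set_product_foldl)

lemma times_set_finite: "finite A \<Longrightarrow> finite B \<Longrightarrow> finite (times_set A B)"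
  by (simp add: times_set_def)

lemma card_times_set: "finite A \<Longrightarrow> finite B \<Longrightarrow> card (times_set A B) \<le> card A * card B"
  unfolding times_set_def card_cartesian_product[symmetric] by (intro card_image_le) simp

lemma times_setI: "\<sigma> \<in> A \<Longrightarrow> \<tau> \<in> B \<Longrightarrow> \<tau> \<circ> \<sigma> \<in> times_set A B"
  unfolding times_set_def by force

lemma set_product_finite_card:
  assumes "\<And>A. A \<in> set As \<Longrightarrow> finite A"
  shows "finite (set_product As) \<and> card (set_product As) \<le> prod_list (map card As)"
  using assms
proof (induction As rule: rev_induct)
  case Nil
  then show ?case by (simp add: set_product_Nil)
next
  case (snoc B As)
  then have IH: "finite (set_product As)" "card (set_product As) \<le> prod_list (map card As)" and B: "finite B"
    by auto
  have "card (times_set (set_product As) B) \<le> card (set_product As) * card B"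
    by (rule card_times_set[OF IH(1) B])
  also have "\<dots> \<le> prod_list (map card As) * card B" by (rule mult_le_mono1[OF IH(2)])
  finally show ?case using times_set_finite[OF IH(1) B] unfolding set_product_snoc by simp
qed

lemma prod_list_le_power:
  assumes "\<And>i. i \<in> set l \<Longrightarrow> f i \<le> (c::nat) ^ e i"
  shows "prod_list (map f l) \<le> c ^ sum_list (map e l)"
  using assms by (induction l) (simp_all add: power_add mult_le_mono)

lemma set_product_subset:
  assumes "\<And>A. A \<in> set As \<Longrightarrow> A \<subseteq> H" "id \<in> H" "\<And>x y. x \<in> H \<Longrightarrow> y \<in> H \<Longrightarrow> y \<circ> x \<in> H"
  shows "set_product As \<subseteq> H"
  using assms(1)
proof (induction As rule: rev_induct)
  case Nil
  then show ?case using assms(2) by (simp add: set_product_Nil)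
next
  case (snoc B As)
  have "set_product As \<subseteq> H" "B \<subseteq> H" using snoc by auto
  then show ?case unfolding set_product_snoc times_set_def using assms(3) by fastforce
qed

section \<open>Upper bound for the sets X\<close>

lemma perm_shift_1: "perm_shift b 1 \<tau> x = (if x \<in> {1..b} then \<tau> x else x)"
  by (simp add: perm_shift_def)

context sylow
begin

lemma R_gen_in_P:
  assumes "j < m"
  shows "perm_blow (p ^ j) (cyc p) \<in> P_group p (p ^ m)"
proof -
  have "perm_blow (p ^ j) (cyc p) = perm_blow (p ^ j) (block_cycle p 1)"
  proof -
    have "block_cycle p 1 = cyc p"
    proof
      fix x show "block_cycle p 1 x = cyc p x"
        using cyc_apply(3)[of x p] unfolding block_cycle_def perm_shift_1 by auto
    qed
    then show ?thesis by simp
  qed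
  moreover have "1 * p ^ j \<le> p ^ m" using assms p0 by (simp add: power_increasing)
  ultimately have "perm_blow (p ^ j) (cyc p) \<in> P_gens p (p ^ m)"
    unfolding P_gens_def by (intro CollectI exI[of _ j] exI[of _ 1] conjI) simp_all
  then show ?thesis by (rule P_gen)
qed

lemma generate_subset_P:
  assumes "H \<subseteq> P_group p k" "H \<subseteq> Sym m"
  shows "generate (sym_group m) H \<subseteq> P_group p k"
proof
  fix x assume "x \<in> generate (sym_group m) H"
  then show "x \<in> P_group p k"
  proof (induction rule: generate.induct)
    case one
    then show ?case using P_id by (simp only: sym_group_one)
  next
    case (incl h)
    then show ?case using assms(1) by blast
  next
    case (inv h)
    have "h \<in> carrier (sym_group m)" using inv assms(2) by blast
    then have "inv\<^bsub>sym_group m\<^esub> h = inv' h" by (rule sym_group_inv_equality)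
    then show ?case using P_inv[of h] inv assms(1) by auto
  next
    case (eng h1 h2)
    then show ?case using P_comp by (simp only: sym_group_mult)
  qed
qed

lemma finite_P: "finite (P_group p k)"
proof -
  interpret p_group "P_group p k" p by (rule p_group_P)
  show ?thesis by (rule finite_G)
qed

lemma block_cycle_gen: "1 \<le> j \<Longrightarrow> j \<le> k \<Longrightarrow> block_cycle p j \<in> P_gens p k"
  using perm_blow_1[OF p0, of j] unfolding P_gens_def
  by (intro CollectI exI[of _ 0] exI[of _ j]) simp

lemma H_group_subset: "H_group p s \<subseteq> P_group p s"
  unfolding H_group_def
proof (rule set_product_subset)
  fix A assume "A \<in> set (map (\<lambda>a. generate (sym_group (s * p)) {perm_shift p a (cyc p)}) [1..<Suc s])"
  then obtain a where a: "1 \<le> a" "a \<le> s" "A = generate (sym_group (s * p)) {block_cycle p a}"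
    by (auto simp: block_cycle_def)
  show "A \<subseteq> P_group p s"
    unfolding a(3) using block_cycle_gen[OF a(1,2)] P_gen P_gens_in_Sym[OF p1]
    by (intro generate_subset_P) blast+
qed (use P_id P_comp in auto)

lemma R_group_subset: "R_group p m \<subseteq> P_group p (p ^ m)"
  unfolding R_group_def
proof (rule generate_subset_P)
  show "{perm_blow (p ^ j) (cyc p) | j. j < m} \<subseteq> P_group p (p ^ m)"
  proof clarify
    fix j assume "j < m"
    then show "perm_blow (p ^ j) (cyc p) \<in> P_group p (p ^ m)" by (rule R_gen_in_P)
  qed
  show "{perm_blow (p ^ j) (cyc p) | j. j < m} \<subseteq> Sym (p ^ m)"
  proof clarify
    fix j assume "j < m"
    have cyc: "cyc p \<in> Sym p" using cyc_permutes[of p p] p0 by simp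
    have pj: "p ^ j > 0" using p0 by simp
    have "perm_blow (p ^ j) (cyc p) \<in> Sym (p * p ^ j)"
      unfolding perm_blow_wreath by (rule wreath_in_Sym[OF pj cyc order_refl zero_shifts[OF pj]])
    moreover have "p * p ^ j \<le> p ^ m"
      using power_increasing[of "Suc j" m p] \<open>j < m\<close> p0 by simp
    ultimately show "perm_blow (p ^ j) (cyc p) \<in> Sym (p ^ m)" by (rule Sym_mono[rotated])
  qed
qed

text \<open>
  This bound and the following ones are crude; the exponents only need to be linear in the degree \<open>p ^ m\<close>, for fixed \<open>p\<close>.
\<close>

lemma R0_group_bound: "finite (R0_group p m)" "card (R0_group p m) \<le> p ^ (2 * p ^ m * (p - 1))"
proof -
  let ?L = "map (\<lambda>i. perm_shift (p ^ m) i ` R_group p m) [1..<p]"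
  have R: "finite (R_group p m)" "card (R_group p m) \<le> p ^ (2 * p ^ m)"
    using finite_subset[OF R_group_subset finite_P] card_mono[OF finite_P R_group_subset, of m] card_P_le[of "p ^ m"]
    by auto
  have fin: "finite B" if "B \<in> set ?L" for B using that R(1) by auto
  have "prod_list (map card ?L) \<le> p ^ sum_list (map (\<lambda>_. 2 * p ^ m) [1..<p])"
    unfolding map_map
  proof (rule prod_list_le_power)
    fix i show "(card \<circ> (\<lambda>i. perm_shift (p ^ m) i ` R_group p m)) i \<le> p ^ (2 * p ^ m)"
      using card_image_le[OF R(1), of "perm_shift (p ^ m) i"] R(2) by simp
  qed
  also have "sum_list (map (\<lambda>_. 2 * p ^ m) [1..<p]) = 2 * p ^ m * (p - 1)"
    by (simp add: sum_list_triv)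
  finally have "prod_list (map card ?L) \<le> p ^ (2 * p ^ m * (p - 1))" .
  moreover have "finite (set_product ?L) \<and> card (set_product ?L) \<le> prod_list (map card ?L)"
    by (rule set_product_finite_card[OF fin])
  ultimately show "finite (R0_group p m)" "card (R0_group p m) \<le> p ^ (2 * p ^ m * (p - 1))"
    unfolding R0_group_def by (blast intro: order_trans)+
qed

lemma Y_set_bound: "finite (Y_set p m)" "card (Y_set p m) \<le> p ^ ((2 * p + 1) * p ^ m)"
proof -
  let ?L = "[H_group p (p ^ m), z_perm p m ` {1..p - 1}, R0_group p m]"
  have H: "finite (H_group p (p ^ m))" "card (H_group p (p ^ m)) \<le> p ^ (2 * p ^ m)"
    using finite_subset[OF H_group_subset finite_P] card_mono[OF finite_P H_group_subset, of "p ^ m"] card_P_le[of "p ^ m"]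
    by auto
  have z: "finite (z_perm p m ` {1..p - 1})" "card (z_perm p m ` {1..p - 1}) \<le> p ^ 1"
    using card_image_le[of "{1..p - 1}" "z_perm p m"] by auto
  have Y: "finite (Y_set p m) \<and> card (Y_set p m) \<le> prod_list (map card ?L)"
    unfolding Y_set_def by (rule set_product_finite_card) (use H(1) z(1) R0_group_bound(1) in auto)
  then show "finite (Y_set p m)" by simp
  have "prod_list (map card ?L) = card (H_group p (p ^ m)) * (card (z_perm p m ` {1..p - 1}) * card (R0_group p m))"
    by simp
  also have "\<dots> \<le> p ^ (2 * p ^ m) * (p ^ 1 * p ^ (2 * p ^ m * (p - 1)))"
    by (intro mult_le_mono H(2) z(2) R0_group_bound(2))
  also have "\<dots> = p ^ (2 * p ^ m + (1 + 2 * p ^ m * (p - 1)))" by (simp only: power_add)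
  also have "\<dots> \<le> p ^ ((2 * p + 1) * p ^ m)"
  proof (rule power_increasing)
    have "2 * p ^ m + 2 * p ^ m * (p - 1) = 2 * p * p ^ m" using p0 by (cases p) (auto simp: algebra_simps)
    moreover have "1 \<le> p ^ m" using p0 by simp
    ultimately show "2 * p ^ m + (1 + 2 * p ^ m * (p - 1)) \<le> (2 * p + 1) * p ^ m"
      by (simp add: add_mult_distrib)
    show "1 \<le> p" using p0 by simp
  qed
  finally show "card (Y_set p m) \<le> p ^ ((2 * p + 1) * p ^ m)" using Y by linarith
qed

lemma sum_nth_upt: "(\<Sum>i<length l. f (l ! i)) = sum_list (map f l)" for f :: "nat \<Rightarrow> nat"
  by (simp add: sum_list_sum_nth atLeast0LessThan)

lemma X_comp_bound:
  assumes "p_composition p d l"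
  shows "finite (X_comp p l)" "card (X_comp p l) \<le> p ^ ((2 * p + 1) * d)"
proof -
  define F where "F r = perm_shift (p ^ (l ! r + 1)) (partial_sum p l (Suc r) div p ^ (l ! r)) ` Y_set p (l ! r)" for r
  have X: "X_comp p l = set_product (map F [0..<length l])"
    unfolding X_comp_def F_def ..
  have F: "finite (F r)" "card (F r) \<le> p ^ ((2 * p + 1) * p ^ (l ! r))" for r
    unfolding F_def
    by (rule finite_imageI[OF Y_set_bound(1)], rule order_trans[OF card_image_le[OF Y_set_bound(1)] Y_set_bound(2)])
  have "finite (X_comp p l) \<and> card (X_comp p l) \<le> prod_list (map card (map F [0..<length l]))"
    unfolding X by (rule set_product_finite_card) (use F(1) in auto)
  moreover have "prod_list (map card (map F [0..<length l])) \<le> p ^ sum_list (map (\<lambda>r. (2 * p + 1) * p ^ (l ! r)) [0..<length l])"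
    unfolding map_map by (rule prod_list_le_power) (use F(2) in simp)
  moreover have "sum_list (map (\<lambda>r. (2 * p + 1) * p ^ (l ! r)) [0..<length l]) = (2 * p + 1) * d"
  proof -
    have "sum_list (map (\<lambda>r. (2 * p + 1) * p ^ (l ! r)) [0..<length l]) = (\<Sum>r<length l. (2 * p + 1) * p ^ (l ! r))"
      by (simp add: interv_sum_list_conv_sum_set_nat atLeast0LessThan)
    also have "\<dots> = (2 * p + 1) * partial_sum p l (length l)"
      unfolding partial_sum_def by (rule sum_distrib_left[symmetric])
    finally show ?thesis using assms by (simp add: p_composition_def)
  qed
  ultimately show "finite (X_comp p l)" "card (X_comp p l) \<le> p ^ ((2 * p + 1) * d)" by simp_all
qed

text \<open>
  Dropping the divisibility condition of \<open>p_composition\<close> enlarges the set but makes it recursive.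
\<close>

definition pcomps :: "nat \<Rightarrow> nat list set" where
  "pcomps d = {l. sum_list (map (\<lambda>m. p ^ m) l) = d}"

text \<open>
  Removing the first part leads to a recursion that is majorized by the one for all compositions of \<open>d\<close>: the possible first
  parts \<open>p ^ m\<close> are distinct numbers between \<open>1\<close> and \<open>d\<close>.
\<close>

lemma pcomps_bound: "finite (pcomps d) \<and> card (pcomps d) \<le> 2 ^ d"
proof (induction d rule: less_induct)
  case (less d)
  show ?case
  proof (cases "d = 0")
    case True
    have "pcomps 0 = {[]}"
    proof
      show "pcomps 0 \<subseteq> {[]}"
      proof
        fix l assume "l \<in> pcomps 0"
        then show "l \<in> {[]}" using p0 by (cases l) (auto simp: pcomps_def)
      qed
    qed (simp add: pcomps_def)
    then show ?thesis using True by simp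
  next
    case False
    let ?M = "{m. p ^ m \<le> d}"
    have inj: "inj_on (\<lambda>m. p ^ m) ?M" using p1 by (auto simp: inj_on_def)
    have img: "(\<lambda>m. p ^ m) ` ?M \<subseteq> {1..d}" using p0 by auto
    have finM: "finite ?M" using inj img finite_subset[OF img] finite_imageD by blast
    have eq: "pcomps d \<subseteq> (\<Union>m\<in>?M. (\<lambda>l. m # l) ` pcomps (d - p ^ m))"
    proof
      fix l assume l: "l \<in> pcomps d"
      then obtain m l' where ml: "l = m # l'" using False by (cases l) (auto simp: pcomps_def)
      have s: "p ^ m + sum_list (map (\<lambda>m. p ^ m) l') = d" using l ml by (simp add: pcomps_def)
      then have "m \<in> ?M" "l' \<in> pcomps (d - p ^ m)" by (auto simp: pcomps_def)
      then show "l \<in> (\<Union>m\<in>?M. (\<lambda>l. m # l) ` pcomps (d - p ^ m))" using ml by blast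
    qed
    have IH: "finite (pcomps (d - p ^ m))" "card (pcomps (d - p ^ m)) \<le> 2 ^ (d - p ^ m)" if "m \<in> ?M" for m
    proof -
      have "d - p ^ m < d" using False p0 by simp
      from less.IH[OF this] show "finite (pcomps (d - p ^ m))" "card (pcomps (d - p ^ m)) \<le> 2 ^ (d - p ^ m)" by auto
    qed
    have fin: "finite (\<Union>m\<in>?M. (\<lambda>l. m # l) ` pcomps (d - p ^ m))"
      using finM IH(1) by (intro finite_UN_I finite_imageI)
    have "card (pcomps d) \<le> card (\<Union>m\<in>?M. (\<lambda>l. m # l) ` pcomps (d - p ^ m))"
      by (rule card_mono[OF fin eq])
    also have "\<dots> \<le> (\<Sum>m\<in>?M. card ((\<lambda>l. m # l) ` pcomps (d - p ^ m)))" by (rule card_UN_le[OF finM])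
    also have "\<dots> \<le> (\<Sum>m\<in>?M. 2 ^ (d - p ^ m))"
    proof (rule sum_mono)
      fix m assume "m \<in> ?M"
      then show "card ((\<lambda>l. m # l) ` pcomps (d - p ^ m)) \<le> 2 ^ (d - p ^ m)"
        using card_image_le[OF IH(1), of m "\<lambda>l. m # l"] IH(2) by (meson order_trans)
    qed
    also have "\<dots> = (\<Sum>q\<in>(\<lambda>m. p ^ m) ` ?M. 2 ^ (d - q))" using inj by (simp add: sum.reindex)
    also have "\<dots> \<le> (\<Sum>q\<in>{1..d}. 2 ^ (d - q))" using img by (intro sum_mono2) auto
    also have "\<dots> \<le> 2 ^ d"
    proof -
      have "(\<Sum>q\<in>{1..d}. 2 ^ (d - q)) + 1 = (2::nat) ^ d" for d
      proof (induction d)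
        case (Suc d)
        have "(\<Sum>q\<in>{1..Suc d}. 2 ^ (Suc d - q)) = (\<Sum>q\<in>{1..d}. 2 ^ (Suc d - q)) + (1::nat)" by simp
        also have "(\<Sum>q\<in>{1..d}. 2 ^ (Suc d - q)) = 2 * (\<Sum>q\<in>{1..d}. (2::nat) ^ (d - q))"
          unfolding sum_distrib_left by (intro sum.cong refl) (auto simp: Suc_diff_le)
        finally show ?case using Suc by simp
      qed simp
      then show ?thesis by (metis le_add1)
    qed
    finally show ?thesis using finite_subset[OF eq fin] by blast
  qed
qed

lemma X_set_bound: "finite (X_set p d)" "card (X_set p d) \<le> 2 ^ d * p ^ ((2 * p + 1) * d)"
proof -
  let ?C = "{l. p_composition p d l}"
  have sub: "?C \<subseteq> pcomps d"
    by (auto simp: p_composition_def partial_sum_def pcomps_def sum_nth_upt)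
  have C: "finite ?C" "card ?C \<le> 2 ^ d"
    using finite_subset[OF sub] card_mono[OF _ sub] pcomps_bound[of d] by (auto intro: order_trans)
  show "finite (X_set p d)"
    unfolding X_set_def using C(1) X_comp_bound(1) by (intro finite_UN_I) auto
  have "card (X_set p d) \<le> (\<Sum>l\<in>?C. card (X_comp p l))"
    unfolding X_set_def by (rule card_UN_le[OF C(1)])
  also have "\<dots> \<le> (\<Sum>l\<in>?C. p ^ ((2 * p + 1) * d))"
    by (intro sum_mono X_comp_bound(2)) simp
  also have "\<dots> \<le> 2 ^ d * p ^ ((2 * p + 1) * d)" using C(2) by simp
  finally show "card (X_set p d) \<le> 2 ^ d * p ^ ((2 * p + 1) * d)" .
qed

section \<open>Lower bound for the sets X\<close>

lemma Y_set_0: "id \<in> Y_set p 0" "cyc p \<in> Y_set p 0"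
proof -
  have sp: "set_product [A, B, C] = times_set (times_set (times_set {id} A) B) C" for A B C
    by (simp add: set_product_foldl)
  have R: "id \<in> R0_group p 0"
  proof -
    have idR: "id \<in> R_group p 0" unfolding R_group_def
      by (rule generate.one[of "sym_group (p ^ 0)", unfolded sym_group_one])
    have sh: "perm_shift (p ^ 0) i id = id" for i
      by (rule ext) (simp add: perm_shift_def)
    have "id \<in> set_product (map (\<lambda>i. perm_shift (p ^ 0) i ` R_group p 0) js)" for js
    proof (induction js rule: rev_induct)
      case Nil
      then show ?case unfolding list.map set_product_Nil by (rule singletonI)
    next
      case (snoc j js)
      have "id \<in> perm_shift (p ^ 0) j ` R_group p 0" using sh[of j] idR by (metis imageI)
      then have "id \<circ> id \<in> times_set (set_product (map (\<lambda>i. perm_shift (p ^ 0) i ` R_group p 0) js)) (perm_shift (p ^ 0) j ` R_group p 0)"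
        using snoc by (intro times_setI)
      then show ?case by (simp only: map_append list.map set_product_snoc id_comp)
    qed
    then show ?thesis unfolding R0_group_def .
  qed
  have z: "id \<in> z_perm p 0 ` {1..p - 1}"
  proof
    show "id = z_perm p 0 1"
    proof
      fix x show "id x = z_perm p 0 1 x"
        by (cases "x \<in> {1..p}") (auto simp: z_perm_def)
    qed
    show "1 \<in> {1..p - 1}" using p1 by simp
  qed
  have H: "H_group p (p ^ 0) = times_set {id} (generate (sym_group p) {cyc p})"
  proof -
    have "perm_shift p 1 (cyc p) x = cyc p x" for x
      unfolding perm_shift_1 using cyc_apply(3)[of x p] by auto
    then have "perm_shift p 1 (cyc p) = cyc p" by (rule ext)
    moreover have "[1..<Suc (p ^ 0)] = [1]" by (simp add: upt_conv_Cons)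
    ultimately show ?thesis
      unfolding H_group_def by (simp only: list.map set_product_foldl foldl.simps power_0 mult_1)
  qed
  have gen: "id \<in> generate (sym_group p) {cyc p}" "cyc p \<in> generate (sym_group p) {cyc p}"
    using generate.one[of "sym_group p" "{cyc p}"] generate.incl[of "cyc p" "{cyc p}" "sym_group p"]
    by (simp_all only: sym_group_one insertI1)
  have "x \<in> Y_set p 0" if "x \<in> generate (sym_group p) {cyc p}" for x
  proof -
    have "x \<circ> id \<in> H_group p (p ^ 0)" unfolding H by (rule times_setI[OF singletonI that])
    then have "x \<circ> id \<circ> id \<in> times_set {id} (H_group p (p ^ 0))" by (rule times_setI[OF singletonI])
    then have "id \<circ> (id \<circ> (x \<circ> id \<circ> id)) \<in> Y_set p 0"
      unfolding Y_set_def sp by (rule times_setI[OF times_setI[OF _ z] R])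
    then show ?thesis by (simp only: id_comp comp_id)
  qed
  with gen show "id \<in> Y_set p 0" "cyc p \<in> Y_set p 0" by blast+
qed

text \<open>
  Each factor contributes either the identity or the cycle \<open>\<pi>[r]\<close>. Their products are the block rotations with
  rotation numbers \<open>0\<close> and \<open>1\<close>.
\<close>

lemma subset_products_in_X:
  assumes "T \<subseteq> {1..d}"
  shows "wreath p id (\<lambda>i. if i \<in> T then 1 else 0) \<in>
    set_product (map (\<lambda>r. perm_shift p (Suc r) ` Y_set p 0) [0..<d])"
  using assms
proof (induction d arbitrary: T)
  case 0
  then have "(\<lambda>i. if i \<in> T then 1 else 0 :: nat) = (\<lambda>_. 0)" by auto
  then have "wreath p id (\<lambda>i. if i \<in> T then 1 else 0) = id" using wreath_id[OF p0] by (simp only:)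
  moreover have "set_product (map (\<lambda>r. perm_shift p (Suc r) ` Y_set p 0) [0..<0]) = {id}"
    by (simp add: set_product_Nil)
  ultimately show ?case by (simp only: singletonI)
next
  case (Suc d)
  let ?T = "T - {Suc d}"
  let ?e = "\<lambda>T i. if i \<in> T then 1 else 0 :: nat"
  have IH: "wreath p id (?e ?T) \<in> set_product (map (\<lambda>r. perm_shift p (Suc r) ` Y_set p 0) [0..<d])"
    by (rule Suc.IH) (use Suc.prems in \<open>auto simp: le_Suc_eq\<close>)
  have upt: "[0..<Suc d] = [0..<d] @ [d]" by (simp add: upt_Suc)
  have last: "wreath p id (?e (T \<inter> {Suc d})) \<in> perm_shift p (Suc d) ` Y_set p 0"
  proof (cases "Suc d \<in> T")
    case True
    then have "?e (T \<inter> {Suc d}) = (\<lambda>i. if i = Suc d then 1 else 0)" by auto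
    then have "wreath p id (?e (T \<inter> {Suc d})) = perm_shift p (Suc d) (cyc p)"
      using block_cycle_wreath[OF p0, of "Suc d"] unfolding block_cycle_def by simp
    then show ?thesis using Y_set_0(2) by blast
  next
    case False
    then have "?e (T \<inter> {Suc d}) = (\<lambda>i. 0)" by auto
    moreover have "perm_shift p (Suc d) id = id" by (rule ext) (simp add: perm_shift_def)
    ultimately have "wreath p id (?e (T \<inter> {Suc d})) = perm_shift p (Suc d) id" using wreath_id[OF p0] by (simp only:)
    then show ?thesis using Y_set_0(1) by blast
  qed
  have "wreath p id (?e (T \<inter> {Suc d})) \<circ> wreath p id (?e ?T) = wreath p (id \<circ> id) (\<lambda>i. (?e ?T i + ?e (T \<inter> {Suc d}) (id i)) mod p)"
    by (rule wreath_comp[OF p0]) simp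
  also have "(\<lambda>i. (?e ?T i + ?e (T \<inter> {Suc d}) (id i)) mod p) = ?e T"
    using p1 by (auto simp: fun_eq_iff)
  finally have "wreath p id (?e (T \<inter> {Suc d})) \<circ> wreath p id (?e ?T) = wreath p id (?e T)" by (simp only: id_comp)
  moreover have "wreath p id (?e (T \<inter> {Suc d})) \<circ> wreath p id (?e ?T) \<in> set_product (map (\<lambda>r. perm_shift p (Suc r) ` Y_set p 0) [0..<Suc d])"
    unfolding upt map_append list.map set_product_snoc by (rule times_setI[OF IH last])
  ultimately show ?case by (simp only:)
qed

lemma inj_subset_products: "inj_on (\<lambda>T. wreath p id (\<lambda>i. if i \<in> T then 1 else 0)) (Pow {1..d})"
proof (rule inj_onI)
  fix S T assume ST: "S \<in> Pow {1..d}" "T \<in> Pow {1..d}"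
    "wreath p id (\<lambda>i. if i \<in> S then 1 else 0) = wreath p id (\<lambda>i. if i \<in> T then 1 else 0)"
  have lt: "(if i \<in> U then 1 else 0) < p" for i :: nat and U using p1 by simp
  have "0 \<notin> S" "0 \<notin> T" using ST(1,2) by auto
  then have "(if 0 \<in> S then 1 else 0 :: nat) = (if 0 \<in> T then 1 else 0)" by simp
  from conjunct2[OF wreath_inject[OF p0 id_in_Sym id_in_Sym lt lt this ST(3)]]
  have eq: "(if i \<in> S then 1 else 0 :: nat) = (if i \<in> T then 1 else 0)" for i
    by (simp only: fun_eq_iff)
  show "S = T"
  proof (intro subset_antisym subsetI)
    fix i assume "i \<in> S" then show "i \<in> T" using eq[of i] by (cases "i \<in> T") simp_all
  next
    fix i assume "i \<in> T" then show "i \<in> S" using eq[of i] by (cases "i \<in> S") simp_all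
  qed
qed

lemma card_X_set_ge: "2 ^ d \<le> card (X_set p d)"
proof -
  let ?l = "replicate d (0::nat)"
  have ps: "partial_sum p ?l r = r" if "r \<le> d" for r
  proof -
    have "partial_sum p ?l r = (\<Sum>i<r. 1)" unfolding partial_sum_def
      by (intro sum.cong refl) (use that in auto)
    then show ?thesis by simp
  qed
  have comp: "p_composition p d ?l"
    using ps unfolding p_composition_def by simp
  have X: "X_comp p ?l = set_product (map (\<lambda>r. perm_shift p (Suc r) ` Y_set p 0) [0..<d])"
    unfolding X_comp_def
  proof (intro arg_cong[where f = set_product] map_cong)
    show "[0..<length ?l] = [0..<d]" by simp
    fix r assume "r \<in> set [0..<d]"
    then show "perm_shift (p ^ (?l ! r + 1)) (partial_sum p ?l (Suc r) div p ^ (?l ! r)) ` Y_set p (?l ! r) =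
        perm_shift p (Suc r) ` Y_set p 0"
      using ps[of "Suc r"] by simp
  qed
  define f where "f T = wreath p id (\<lambda>i. if i \<in> T then 1 else 0)" for T :: "nat set"
  have "f ` Pow {1..d} \<subseteq> X_comp p ?l"
    unfolding X f_def by (intro image_subsetI subset_products_in_X) (rule PowD)
  also have "\<dots> \<subseteq> X_set p d"
    unfolding X_set_def using comp by blast
  finally have "card (f ` Pow {1..d}) \<le> card (X_set p d)"
    by (rule card_mono[OF X_set_bound(1)])
  moreover have "card (f ` Pow {1..d}) = card (Pow {1..d})"
    unfolding f_def by (rule card_image[OF inj_subset_products])
  ultimately show ?thesis by (simp add: card_Pow)
qed

end

section \<open>Growth rates\<close>

lemma exp_half_le:
  assumes "k \<ge> 2"
  shows "exp (ln 2 / 2 * real k) \<le> 2 ^ (k - 1)"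
proof -
  have "ln 2 / 2 * real k \<le> ln 2 * real (k - 1)"
    using assms by (simp add: of_nat_diff field_simps)
  then have "exp (ln 2 / 2 * real k) \<le> exp (ln 2 * real (k - 1))" by simp
  also have "\<dots> = 2 ^ (k - 1)" by (simp add: exp_of_nat2_mult)
  finally show ?thesis .
qed

text \<open>
  For \<open>p \<ge> 2\<close>, already one factor \<open>n - p + 1\<close> of \<open>(n - 1)! / (n - p)!\<close> suffices.
\<close>

lemma ratio_bound:
  assumes p: "p \<ge> 2" and n: "p \<le> (n::nat)"
  shows "fact (p - 1) * fact (n - p) / (fact (n - 1) :: real) \<le> fact (p - 1) / (real n + 1 - real p)"
proof -
  have "(fact (n - p) :: real) * (real n + 1 - real p) = fact (Suc (n - p))"
    using n by (simp add: of_nat_diff algebra_simps)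
  also have "\<dots> \<le> fact (n - 1)"
    using p n by (intro fact_mono) auto
  finally have le: "(fact (n - p) :: real) * (real n + 1 - real p) \<le> fact (n - 1)" .
  have pos: "real n + 1 - real p > 0" using n by simp
  have "fact (p - 1) * (fact (n - p) * (real n + 1 - real p)) \<le> fact (p - 1) * (fact (n - 1) :: real)"
    using le by (intro mult_left_mono) auto
  then show ?thesis using pos by (simp add: field_simps)
qed

context sylow
begin

lemma card_X_set_le_exp:
  assumes "k > 0"
  shows "real (card (X_set p (k - 1))) \<le> exp ((ln 2 + (2 * real p + 1) * ln p) * real k)"
proof -
  have "card (X_set p (k - 1)) \<le> 2 ^ (k - 1) * p ^ ((2 * p + 1) * (k - 1))"
    by (rule X_set_bound(2))
  also have "\<dots> \<le> 2 ^ k * p ^ ((2 * p + 1) * k)"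
    using p0 by (intro mult_le_mono power_increasing mult_le_mono2) auto
  finally have "real (card (X_set p (k - 1))) \<le> real (2 ^ k * p ^ ((2 * p + 1) * k))"
    by (simp only: of_nat_le_iff)
  also have "\<dots> = exp (ln 2 * real k) * exp (ln p * real ((2 * p + 1) * k))"
    unfolding exp_of_nat2_mult using p0 by simp
  also have "\<dots> = exp ((ln 2 + (2 * real p + 1) * ln p) * real k)"
    by (simp add: exp_add[symmetric] algebra_simps)
  finally show ?thesis .
qed

lemma card_X_set_ge_exp:
  assumes "k > 1"
  shows "exp (ln 2 / 2 * real k) \<le> real (card (X_set p (k - 1)))"
proof -
  have "exp (ln 2 / 2 * real k) \<le> 2 ^ (k - 1)" using assms by (intro exp_half_le) simp
  also have "\<dots> \<le> real (card (X_set p (k - 1)))"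
    using card_X_set_ge[of "k - 1"] unfolding of_nat_le_iff[symmetric, where ?'a = real] by simp
  finally show ?thesis .
qed

lemma upper_exponent: "ln 2 / 2 < ln 2 + (2 * real p + 1) * ln p"
proof -
  have "0 \<le> (2 * real p + 1) * ln p" using p1 by simp
  moreover have "ln 2 / 2 < ln (2::real)" by simp
  ultimately show ?thesis by linarith
qed

end

theorem theorem6p8:
  fixes p :: nat
  assumes "prime p" and "CHAR('a::field) = p"
  shows
    "(\<exists>C1 C2 :: real. C1 < C2 \<and>
        (\<forall>k>0. \<not> p dvd k \<longrightarrow>
           exp (C1 * real k) \<le> real (card (X_set p (k - 1))) \<and>
           real (card (X_set p (k - 1))) \<le> exp (C2 * real k)))
     \<and> (\<exists>C1 C2 :: real. 0 < C1 \<and> C1 < C2 \<and>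
        (\<forall>k>1. \<not> p dvd k \<longrightarrow>
           exp (C1 * real k) \<le> real (card (X_set p (k - 1))) \<and>
           real (card (X_set p (k - 1))) \<le> exp (C2 * real k)))
     \<and> (\<exists>c :: real. 0 < c \<and>
        (\<forall>\<^sub>F k in inf at_top (principal {k. \<not> p dvd k}).
           exp (c * real k) \<le>
             real (pf_dim (P_group p k) (ga_act (k * p)) (Lie (k * p) :: ((nat \<Rightarrow> nat) \<Rightarrow> 'a) set))))
     \<and> ((\<lambda>k. real (pf_dim (P_group p k) (ga_act (k * p)) (Lie (k * p) :: ((nat \<Rightarrow> nat) \<Rightarrow> 'a) set)) /
             real (fv.dim (Lie (k * p) :: ((nat \<Rightarrow> nat) \<Rightarrow> 'a) set)))
          \<longlongrightarrow> 0) (inf at_top (principal {k. \<not> p dvd k}))"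
proof -
  interpret sylow p by unfold_locales (rule assms(1))
  let ?C = "ln 2 + (2 * real p + 1) * ln (real p)"
  let ?d = "\<lambda>k. pf_dim (P_group p k) (ga_act (k * p)) (Lie (k * p) :: ((nat \<Rightarrow> nat) \<Rightarrow> 'a) set)"
  let ?D = "\<lambda>k. fv.dim (Lie (k * p) :: ((nat \<Rightarrow> nat) \<Rightarrow> 'a) set)"
  let ?F = "inf at_top (principal {k. \<not> p dvd k})"
  have A: "\<exists>C1 C2 :: real. C1 < C2 \<and>
        (\<forall>k>0. \<not> p dvd k \<longrightarrow>
           exp (C1 * real k) \<le> real (card (X_set p (k - 1))) \<and>
           real (card (X_set p (k - 1))) \<le> exp (C2 * real k))"
  proof (rule exI[of _ 0], rule exI[of _ ?C], intro conjI allI impI)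
    have "0 < ln (2::real) / 2" by simp
    then show "0 < ?C" using upper_exponent by linarith
    fix k :: nat assume "k > 0"
    then show "real (card (X_set p (k - 1))) \<le> exp (?C * real k)" by (rule card_X_set_le_exp)
    have "1 \<le> card (X_set p (k - 1))"
      using card_X_set_ge[of "k - 1"] one_le_power[of "2::nat" "k - 1"] by linarith
    then show "exp (0 * real k) \<le> real (card (X_set p (k - 1)))" by simp
  qed
  have B: "\<exists>C1 C2 :: real. 0 < C1 \<and> C1 < C2 \<and>
        (\<forall>k>1. \<not> p dvd k \<longrightarrow>
           exp (C1 * real k) \<le> real (card (X_set p (k - 1))) \<and>
           real (card (X_set p (k - 1))) \<le> exp (C2 * real k))"
  proof (rule exI[of _ "ln 2 / 2"], rule exI[of _ ?C], intro conjI allI impI)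
    show "0 < ln (2::real) / 2" by simp
    show "ln 2 / 2 < ?C" by (rule upper_exponent)
    fix k :: nat assume k: "k > 1"
    then show "exp (ln 2 / 2 * real k) \<le> real (card (X_set p (k - 1)))" by (rule card_X_set_ge_exp)
    show "real (card (X_set p (k - 1))) \<le> exp (?C * real k)" using k by (intro card_X_set_le_exp) simp
  qed
  \<comment> \<open>The exponent is halved because \<open>k - 1 \<ge> k / 2\<close> for \<open>k \<ge> 2\<close>.\<close>
  have C: "\<exists>c :: real. 0 < c \<and> (\<forall>\<^sub>F k in ?F. exp (c * real k) \<le> real (?d k))"
  proof (intro exI[of _ "ln 2 / 2"] conjI)
    show "0 < ln (2::real) / 2" by simp
    have "exp (ln 2 / 2 * real k) \<le> real (?d k)" if k: "k \<ge> 2" "\<not> p dvd k" for k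
    proof -
      have "exp (ln 2 / 2 * real k) \<le> 2 ^ (k - 1)" by (rule exp_half_le[OF k(1)])
      also have "\<dots> \<le> real (p ^ (k - 1))" using p1 by (simp add: power_mono)
      also have "\<dots> \<le> real (?d k)"
        using pf_dim_Lie_ge[OF assms(2) _ k(2)] k(1) by (simp only: of_nat_le_iff)
      finally show ?thesis .
    qed
    then show "\<forall>\<^sub>F k in ?F. exp (ln 2 / 2 * real k) \<le> real (?d k)"
      unfolding eventually_inf_principal
      by (intro eventually_mono[OF eventually_ge_at_top[of 2]]) blast
  qed
  have D: "((\<lambda>k. real (?d k) / real (?D k)) \<longlongrightarrow> 0) ?F"
  proof (rule tendsto_sandwich)
    show "\<forall>\<^sub>F k in ?F. 0 \<le> real (?d k) / real (?D k)" by simp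
    have bound: "real (?d k) / real (?D k) \<le> fact (p - 1) / (real (k * p) + 1 - real p)"
      if k: "1 \<le> k" "\<not> p dvd k" for k
    proof -
      interpret sylow_point p k by unfold_locales (rule k)+
      have n: "1 \<le> k * p" "p \<le> k * p" using k(1) p0 by simp_all
      have "real (?d k) / real (?D k) = real (?d k) / fact (k * p - 1)"
        using dim_Lie[OF n(1), where ?'a = 'a] by simp
      also have "\<dots> \<le> real (fact (p - 1) * fact (k * p - p)) / fact (k * p - 1)"
        using pf_dim_Lie_le[OF assms(2)] by (intro divide_right_mono) (simp_all only: of_nat_le_iff fact_ge_zero)
      also have "\<dots> \<le> fact (p - 1) / (real (k * p) + 1 - real p)"
        using ratio_bound[OF _ n(2)] p1 by simp
      finally show ?thesis .
    qed
    then show "\<forall>\<^sub>F k in ?F. real (?d k) / real (?D k) \<le> fact (p - 1) / (real (k * p) + 1 - real p)"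
      unfolding eventually_inf_principal
      by (intro eventually_mono[OF eventually_ge_at_top[of 1]]) blast
    have "(\<lambda>k. fact (p - 1) / (real (k * p) + 1 - real p)) \<longlonglongrightarrow> 0"
    proof (rule real_tendsto_divide_at_top[OF tendsto_const])
      have "filterlim (\<lambda>k. (1 - real p) + real k * real p) at_top sequentially"
        using p0
        by (intro filterlim_tendsto_add_at_top[OF tendsto_const]
            filterlim_at_top_mult_tendsto_pos[OF tendsto_const] filterlim_real_sequentially) simp
      then show "filterlim (\<lambda>k. real (k * p) + 1 - real p) at_top sequentially"
        by (simp add: algebra_simps)
    qed
    then show "((\<lambda>k. fact (p - 1) / (real (k * p) + 1 - real p)) \<longlongrightarrow> 0) ?F"
      by (rule tendsto_mono[rotated]) simp
  qed simp
  show ?thesis using A B C D by blast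
qed

end
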